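(* (1) There is an algorithm that, given schemas $\sigma,\sigma^\star$, an $\exists^*$FO-sentence $\varphi$ over $\sigma$, an $\exists^*$FO-sentence $\varphi^\star$ over $\sigma^\star$ and a quantifier-free first-order interpretation $\Psi$ from $\sigma$-structures to $\sigma^\star$-structures, decides whether $\Psi$ is a reduction from the class of finite models of $\varphi$ to the class of finite models of $\varphi^\star$ (i.e. whether for every finite $\sigma$-structure $\mathcal{A}$: $\mathcal{A}\models\varphi$ iff $\Psi(\mathcal{A})\models\varphi^\star$). (2) For every fixed isomorphism-closed class $P$ of finite $\sigma$-structures there is an algorithm that, given an $\exists^*$FO-sentence $\varphi^\star$ over a schema $\sigma^\star$ and a quantifier-free first-order interpretation $\Psi$ from $\sigma$-structures to $\sigma^\star$-structures, decides whether $\Psi$ is a reduction from $P$ to the class of finite models of $\varphi^\star$. (3) For every fixed class $P^\star$ of finite graphs definable in monadic second-order logic there is an algorithm that, given an $\exists^*$FO-sentence $\varphi$ over the schema of graphs and an edge gadget $(\mathfrak{g},c,d)$, decides whether the edge gadget reduction given by $(\mathfrak{g},c,d)$ is a reduction from the class of finite graphs satisfying $\varphi$ to $P^\star$.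
   Context: All schemas are finite and purely relational; all structures are finite. An $\exists^*$FO-sentence is a first-order sentence of the form $\exists x_1\cdots\exists x_n\,\psi$ with $\psi$ quantifier-free. A map $f$ from $\sigma$-structures to $\sigma^\star$-structures is a reduction from $P$ to $P^\star$ if for every finite $\sigma$-structure $\mathcal{A}$: $\mathcal{A}\in P$ iff $f(\mathcal{A})\in P^\star$. A $d$-dimensional quantifier-free first-order interpretation $\Psi=(\varphi_U(\bar x),\varphi_\sim(\bar x_1,\bar x_2),(\varphi_R)_{R\in\sigma^\star})$ consists of quantifier-free first-order $\sigma$-formulas over $d$-tuples of variables; for a $\sigma$-structure $\mathcal{S}$ with universe $U$, $\hat\Psi(\mathcal{S})$ has universe $\hat U=\{\bar a\in U^d:\mathcal{S}\models\varphi_U(\bar a)\}$ and relations $R=\{(\bar a_1,\dots)\in\hat U^{\mathrm{ar}(R)}:\mathcal{S}\models\varphi_R(\bar a_1,\dots)\}$; the relation defined by $\varphi_\sim$ on $\hat U$ must be a congruence of $\hat\Psi(\mathcal{S})$ for every $\mathcal{S}$, and $\Psi(\mathcal{S})$ is the quotient of $\hat\Psi(\mathcal{S})$ by it. Graphs are finite, undirected and without self-loops (structures with one symmetric binary edge relation). An edge gadget is a finite graph $\mathfrak{g}$ with two distinct distinguished nodes $c,d$ such that $\mathfrak{g}$ has an automorphism exchanging $c$ and $d$; the edge gadget reduction given by it maps $G=(V,E)$ to the graph obtained by keeping all nodes of $V$ and, for every edge $\{u,v\}\in E$, adding a fresh disjoint copy of $\mathfrak{g}$ in which $c,d$ are identified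 with $u,v$. *)

theory Defs
  imports Main "HOL-Library.Nat_Bijection"
begin

section \<open>Algorithms\<close>

text \<open>Total recursive functions (closure of the basic functions under composition, primitive
  recursion and minimisation of regular functions). A \<open>k\<close>-ary function is represented by a
  function on lists, of which only the values on lists of length \<open>k\<close> are relevant.\<close>

inductive recfn :: "nat \<Rightarrow> (nat list \<Rightarrow> nat) \<Rightarrow> bool" where
  zero: "recfn k (\<lambda>xs. 0)"
| suc: "recfn 1 (\<lambda>xs. Suc (hd xs))"
| proj: "i < k \<Longrightarrow> recfn k (\<lambda>xs. xs ! i)"
| comp: "recfn (length fs) g \<Longrightarrow> (\<And>f. f \<in> set fs \<Longrightarrow> recfn k f) \<Longrightarrow>
    recfn k (\<lambda>xs. g (map (\<lambda>f. f xs) fs))"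
| prim_rec: "recfn k g \<Longrightarrow> recfn (Suc (Suc k)) h \<Longrightarrow>
    recfn (Suc k) (\<lambda>xs. rec_nat (g (tl xs)) (\<lambda>n y. h (n # y # tl xs)) (hd xs))"
| mu: "recfn (Suc k) g \<Longrightarrow> (\<And>xs. length xs = k \<Longrightarrow> \<exists>n. g (n # xs) = 0) \<Longrightarrow>
    recfn k (\<lambda>xs. LEAST n. g (n # xs) = 0)"

text \<open>\<open>decidable_on code I Q\<close>: some algorithm, given the code of an arbitrary instance in \<open>I\<close>,
  decides whether \<open>Q\<close> holds for it. On numbers that do not encode an instance in \<open>I\<close> its answer
  is irrelevant.\<close>

definition decidable_on :: "('i \<Rightarrow> nat) \<Rightarrow> 'i set \<Rightarrow> ('i \<Rightarrow> bool) \<Rightarrow> bool" where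
  "decidable_on code I Q \<longleftrightarrow>
    (\<exists>f. recfn 1 f \<and> (\<forall>i\<in>I. f [code i] = (if Q i then 1 else 0)))"


section \<open>Finite relational structures\<close>

text \<open>A schema is the list of the arities of its relation symbols; the symbols are referred to
  by their position. The universe of a structure may be empty, since an interpretation may
  produce an empty universe.\<close>

type_synonym schema = "nat list"

record 'a fstruct =
  univ :: "'a set"
  rels :: "'a list set list"

definition structs :: "schema \<Rightarrow> 'a fstruct set" where
  "structs \<sigma> = {A. finite (univ A) \<and>
    list_all2 (\<lambda>R k. R \<subseteq> {as. length as = k \<and> set as \<subseteq> univ A}) (rels A) \<sigma>}"

definition is_iso :: "('a \<Rightarrow> 'b) \<Rightarrow> 'a fstruct \<Rightarrow> 'b fstruct \<Rightarrow> bool" where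
  "is_iso h A B \<longleftrightarrow> bij_betw h (univ A) (univ B) \<and> rels B = map (\<lambda>R. map h ` R) (rels A)"

definition iso_closed :: "'a fstruct set \<Rightarrow> bool" where
  "iso_closed P \<longleftrightarrow> (\<forall>A\<in>P. \<forall>B h. is_iso h A B \<longrightarrow> B \<in> P)"


section \<open>Formulas\<close>

text \<open>Monadic second-order formulas; \<open>Mem x X\<close> states that element \<open>x\<close> is in the set \<open>X\<close>.
  First-order formulas are those without \<open>Mem\<close> and \<open>ExSet\<close>. The remaining connectives and
  the universal quantifiers are abbreviations as usual.\<close>

datatype fm =
    Falsity
  | Rel nat "nat list"
  | Eq nat nat
  | Mem nat nat
  | Neg fm
  | And fm fm
  | Ex nat fm
  | ExSet nat fm

fun sat :: "'a fstruct \<Rightarrow> (nat \<Rightarrow> 'a) \<Rightarrow> (nat \<Rightarrow> 'a set) \<Rightarrow> fm \<Rightarrow> bool" where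
  "sat A v V Falsity = False"
| "sat A v V (Rel r xs) = (map v xs \<in> rels A ! r)"
| "sat A v V (Eq x y) = (v x = v y)"
| "sat A v V (Mem x X) = (v x \<in> V X)"
| "sat A v V (Neg \<phi>) = (\<not> sat A v V \<phi>)"
| "sat A v V (And \<phi> \<psi>) = (sat A v V \<phi> \<and> sat A v V \<psi>)"
| "sat A v V (Ex x \<phi>) = (\<exists>a\<in>univ A. sat A (v(x := a)) V \<phi>)"
| "sat A v V (ExSet X \<phi>) = (\<exists>B. B \<subseteq> univ A \<and> sat A v (V(X := B)) \<phi>)"

fun wf_fm :: "schema \<Rightarrow> fm \<Rightarrow> bool" where
  "wf_fm \<sigma> (Rel r xs) = (r < length \<sigma> \<and> length xs = \<sigma> ! r)"
| "wf_fm \<sigma> (Neg \<phi>) = wf_fm \<sigma> \<phi>"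
| "wf_fm \<sigma> (And \<phi> \<psi>) = (wf_fm \<sigma> \<phi> \<and> wf_fm \<sigma> \<psi>)"
| "wf_fm \<sigma> (Ex x \<phi>) = wf_fm \<sigma> \<phi>"
| "wf_fm \<sigma> (ExSet X \<phi>) = wf_fm \<sigma> \<phi>"
| "wf_fm \<sigma> _ = True"

fun fv :: "fm \<Rightarrow> nat set" where
  "fv Falsity = {}"
| "fv (Rel r xs) = set xs"
| "fv (Eq x y) = {x, y}"
| "fv (Mem x X) = {x}"
| "fv (Neg \<phi>) = fv \<phi>"
| "fv (And \<phi> \<psi>) = fv \<phi> \<union> fv \<psi>"
| "fv (Ex x \<phi>) = fv \<phi> - {x}"
| "fv (ExSet X \<phi>) = fv \<phi>"

fun fv_set :: "fm \<Rightarrow> nat set" where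
  "fv_set (Mem x X) = {X}"
| "fv_set (Neg \<phi>) = fv_set \<phi>"
| "fv_set (And \<phi> \<psi>) = fv_set \<phi> \<union> fv_set \<psi>"
| "fv_set (Ex x \<phi>) = fv_set \<phi>"
| "fv_set (ExSet X \<phi>) = fv_set \<phi> - {X}"
| "fv_set _ = {}"

text \<open>Quantifier-free first-order formulas and their prenex existential closures.\<close>

fun qfree :: "fm \<Rightarrow> bool" where
  "qfree (Neg \<phi>) = qfree \<phi>"
| "qfree (And \<phi> \<psi>) = (qfree \<phi> \<and> qfree \<psi>)"
| "qfree (Mem x X) = False"
| "qfree (Ex x \<phi>) = False"
| "qfree (ExSet X \<phi>) = False"
| "qfree _ = True"

fun ex_prenex :: "fm \<Rightarrow> bool" where
  "ex_prenex (Ex x \<phi>) = ex_prenex \<phi>"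
| "ex_prenex \<phi> = qfree \<phi>"

definition sentence :: "schema \<Rightarrow> fm \<Rightarrow> bool" where
  "sentence \<sigma> \<phi> \<longleftrightarrow> wf_fm \<sigma> \<phi> \<and> fv \<phi> = {} \<and> fv_set \<phi> = {}"

definition exfo_sentence :: "schema \<Rightarrow> fm \<Rightarrow> bool" where
  "exfo_sentence \<sigma> \<phi> \<longleftrightarrow> sentence \<sigma> \<phi> \<and> ex_prenex \<phi>"

text \<open>The valuations are arbitrary: they do not affect the truth of sentences.\<close>

definition models :: "'a fstruct set \<Rightarrow> fm \<Rightarrow> 'a fstruct set" where
  "models D \<phi> = {A \<in> D. sat A (\<lambda>_. undefined) (\<lambda>_. {}) \<phi>}"


section \<open>Reductions and interpretations\<close>

text \<open>All source structures have their universe in \<open>nat\<close>, which covers every finite structure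
  up to isomorphism.\<close>

definition is_reduction ::
    "nat fstruct set \<Rightarrow> (nat fstruct \<Rightarrow> 'b fstruct) \<Rightarrow> nat fstruct set \<Rightarrow> 'b fstruct set \<Rightarrow> bool" where
  "is_reduction D f P Q \<longleftrightarrow> (\<forall>A\<in>D. A \<in> P \<longleftrightarrow> f A \<in> Q)"

definition congruence :: "'a fstruct \<Rightarrow> ('a \<times> 'a) set \<Rightarrow> bool" where
  "congruence A E \<longleftrightarrow> equiv (univ A) E \<and>
    (\<forall>R\<in>set (rels A). \<forall>as\<in>R. \<forall>bs. list_all2 (\<lambda>a b. (a, b) \<in> E) as bs \<longrightarrow> bs \<in> R)"

definition quot :: "'a fstruct \<Rightarrow> ('a \<times> 'a) set \<Rightarrow> 'a set fstruct" where
  "quot A E = \<lparr>univ = univ A // E, rels = map (\<lambda>R. map (\<lambda>a. E `` {a}) ` R) (rels A)\<rparr>"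

text \<open>In the formulas of a \<open>d\<close>-dimensional interpretation the \<open>i\<close>-th \<open>d\<close>-tuple of variables
  (counted from 0) consists of the variables from \<open>i * d\<close> to \<open>i * d + d - 1\<close>, so that the
  variables are evaluated by the concatenation of the given tuples.\<close>

record interp =
  dim :: nat
  phi_univ :: fm
  phi_eq :: fm
  phi_rels :: "fm list"

definition holds :: "'a fstruct \<Rightarrow> fm \<Rightarrow> 'a list \<Rightarrow> bool" where
  "holds S \<phi> as = sat S (\<lambda>x. as ! x) (\<lambda>_. {}) \<phi>"

definition hat_univ :: "interp \<Rightarrow> 'a fstruct \<Rightarrow> 'a list set" where
  "hat_univ \<Psi> S = {a. length a = dim \<Psi> \<and> set a \<subseteq> univ S \<and> holds S (phi_univ \<Psi>) a}"

definition hat_rel :: "interp \<Rightarrow> 'a fstruct \<Rightarrow> nat \<Rightarrow> fm \<Rightarrow> 'a list list set" where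
  "hat_rel \<Psi> S k \<phi> =
    {as. length as = k \<and> set as \<subseteq> hat_univ \<Psi> S \<and> holds S \<phi> (concat as)}"

definition hat :: "schema \<Rightarrow> interp \<Rightarrow> 'a fstruct \<Rightarrow> 'a list fstruct" where
  "hat \<tau> \<Psi> S = \<lparr>univ = hat_univ \<Psi> S, rels = map2 (hat_rel \<Psi> S) \<tau> (phi_rels \<Psi>)\<rparr>"

definition hat_eq :: "interp \<Rightarrow> 'a fstruct \<Rightarrow> ('a list \<times> 'a list) set" where
  "hat_eq \<Psi> S = {(a, b). a \<in> hat_univ \<Psi> S \<and> b \<in> hat_univ \<Psi> S \<and> holds S (phi_eq \<Psi>) (a @ b)}"

definition interpret_struct :: "schema \<Rightarrow> interp \<Rightarrow> 'a fstruct \<Rightarrow> 'a list set fstruct" where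
  "interpret_struct \<tau> \<Psi> S = quot (hat \<tau> \<Psi> S) (hat_eq \<Psi> S)"

definition qf_fm :: "schema \<Rightarrow> nat \<Rightarrow> fm \<Rightarrow> bool" where
  "qf_fm \<sigma> n \<phi> \<longleftrightarrow> wf_fm \<sigma> \<phi> \<and> qfree \<phi> \<and> fv \<phi> \<subseteq> {..<n}"

definition qf_interp :: "schema \<Rightarrow> schema \<Rightarrow> interp \<Rightarrow> bool" where
  "qf_interp \<sigma> \<tau> \<Psi> \<longleftrightarrow>
    qf_fm \<sigma> (dim \<Psi>) (phi_univ \<Psi>) \<and>
    qf_fm \<sigma> (2 * dim \<Psi>) (phi_eq \<Psi>) \<and>
    list_all2 (\<lambda>k \<phi>. qf_fm \<sigma> (k * dim \<Psi>) \<phi>) \<tau> (phi_rels \<Psi>) \<and>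
    (\<forall>S \<in> (structs \<sigma> :: nat fstruct set). congruence (hat \<tau> \<Psi> S) (hat_eq \<Psi> S))"


section \<open>Graphs and edge gadget reductions\<close>

definition graphs :: "'a fstruct set" where
  "graphs = {G \<in> structs [2]. \<forall>u v. [u, v] \<in> rels G ! 0 \<longrightarrow> u \<noteq> v \<and> [v, u] \<in> rels G ! 0}"

text \<open>The nodes of a gadget are \<open>0, \<dots>, n - 1\<close>, and the list of its edges contains both
  orientations of every edge.\<close>

record gadget =
  gsize :: nat
  gedges :: "(nat \<times> nat) list"
  gc :: nat
  gd :: nat

definition gadget_graph :: "gadget \<Rightarrow> nat fstruct" where
  "gadget_graph g = \<lparr>univ = {..<gsize g}, rels = [{[x, y] | x y. (x, y) \<in> set (gedges g)}]\<rparr>"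

definition edge_gadget :: "gadget \<Rightarrow> bool" where
  "edge_gadget g \<longleftrightarrow> gadget_graph g \<in> graphs \<and>
    gc g < gsize g \<and> gd g < gsize g \<and> gc g \<noteq> gd g \<and>
    (\<exists>h. is_iso h (gadget_graph g) (gadget_graph g) \<and> h (gc g) = gd g \<and> h (gd g) = gc g)"

text \<open>The node \<open>x\<close> of the copy of the gadget for the edge \<open>{u, v}\<close>, where \<open>u < v\<close>, is
  \<open>gadget_node g u v x\<close>. Because of the automorphism exchanging \<open>c\<close> and \<open>d\<close>, identifying \<open>c\<close>
  with the smaller endpoint of an edge is no restriction: the opposite choices yield isomorphic
  graphs.\<close>

definition gadget_node :: "gadget \<Rightarrow> nat \<Rightarrow> nat \<Rightarrow> nat \<Rightarrow> nat + nat \<times> nat \<times> nat" where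
  "gadget_node g u v x =
    (if x = gc g then Inl u else if x = gd g then Inl v else Inr (u, v, x))"

definition gadget_reduction :: "gadget \<Rightarrow> nat fstruct \<Rightarrow> (nat + nat \<times> nat \<times> nat) fstruct" where
  "gadget_reduction g G = \<lparr>
    univ = Inl ` univ G \<union>
      {gadget_node g u v x | u v x. [u, v] \<in> rels G ! 0 \<and> u < v \<and> x < gsize g},
    rels = [{[gadget_node g u v x, gadget_node g u v y] | u v x y.
      [u, v] \<in> rels G ! 0 \<and> u < v \<and> (x, y) \<in> set (gedges g)}]\<rparr>"


section \<open>Encoding of instances\<close>

fun fm_code :: "fm \<Rightarrow> nat" where
  "fm_code Falsity = list_encode [0]"
| "fm_code (Rel r xs) = list_encode [1, r, list_encode xs]"
| "fm_code (Eq x y) = list_encode [2, x, y]"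
| "fm_code (Mem x X) = list_encode [3, x, X]"
| "fm_code (Neg \<phi>) = list_encode [4, fm_code \<phi>]"
| "fm_code (And \<phi> \<psi>) = list_encode [5, fm_code \<phi>, fm_code \<psi>]"
| "fm_code (Ex x \<phi>) = list_encode [6, x, fm_code \<phi>]"
| "fm_code (ExSet X \<phi>) = list_encode [7, X, fm_code \<phi>]"

definition interp_code :: "interp \<Rightarrow> nat" where
  "interp_code \<Psi> = list_encode [dim \<Psi>, fm_code (phi_univ \<Psi>), fm_code (phi_eq \<Psi>),
    list_encode (map fm_code (phi_rels \<Psi>))]"

definition gadget_code :: "gadget \<Rightarrow> nat" where
  "gadget_code g = list_encode [gsize g, list_encode (map prod_encode (gedges g)), gc g, gd g]"

end

theory Submission
  imports Defs
begin

text \<open>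
  An existential sentence, and its pullback along a quantifier-free interpretation, defines a class
  that is closed under extensions and in which every structure has a substructure in the class of
  size bounded by the number of existential quantifiers (times the dimension). Two such classes of
  structures coincide as soon as they agree on the finitely many structures up to this size: a small
  witness for membership in one class is a small structure, and if the other class contains it, it
  contains all extensions. This can be checked by brute force, which gives the first part. In the
  second part either no instance is a reduction from \<open>P\<close>, and the constant answer no is correct,
  or \<open>P\<close> is the pullback given by one fixed instance, with which the pullback of the input can be
  compared.

  In the third part, a composition argument shows that the truth of \<open>\<chi>\<close> in the graph obtained from
  \<open>G\<close> depends only on \<open>G\<close> and on the truth of finitely many monadic second-order formulas in the
  gadget. Hence there are finitely many types of gadgets. For each of them, either no sentence \<open>\<phi>\<close>
  gives a reduction, or one such \<open>\<phi>\<close> is fixed in the algorithm and the input is compared with it on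
  small graphs.
\<close>

section \<open>Computable functions of one variable\<close>

text \<open>The quotient by the congruence is never computed with: sentences are evaluated on the
  tuples themselves, with the congruence formula read as equality. A pullback is then again a
  condition stable under embeddings, and both sides of a reduction are compared by one criterion. In
  the composition argument the two graphs are built over the same \<open>G\<close>, so their copies
  correspond edge by edge and no theory of \<open>G\<close> is needed: a set move is answered
  separately in each copy. The obstacle is that these local answers must fit together at the nodes
  of \<open>G\<close>; the formulas stating which terminals lie in a set enforce this. An element
  move is a set move with a singleton, and the answer must be shown to be a singleton of the whole
  graph, not just in each copy. The constants built into the algorithms (an instance, one sentence
  per gadget type) are picked by choice. Only the existence of a recursive function is claimed, so
  finitely many uncomputable choices do no harm.\<close>

definition lcomputable :: "nat \<Rightarrow> (nat list \<Rightarrow> nat) \<Rightarrow> bool" where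
  "lcomputable k f \<longleftrightarrow> (\<exists>F. recfn k F \<and> (\<forall>xs. length xs = k \<longrightarrow> F xs = f xs))"

lemma lcomputableI: "recfn k F \<Longrightarrow> (\<And>xs. length xs = k \<Longrightarrow> F xs = f xs) \<Longrightarrow> lcomputable k f"
  unfolding lcomputable_def by blast

text \<open>\<open>recfn\<close> fixes a function on lists of every length, with accidental values
  where the length differs from the arity. Agreement on length \<open>k\<close> alone is what allows
  convenient lambda terms to be substituted.\<close>

lemma lcomputable_cong:
  assumes "lcomputable k f" "\<And>xs. length xs = k \<Longrightarrow> f xs = g xs"
  shows "lcomputable k g"
  using assms unfolding lcomputable_def by metis

lemma lcomputable_comp:
  assumes "lcomputable (length fs) g" "\<And>f. f \<in> set fs \<Longrightarrow> lcomputable k f"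
  shows "lcomputable k (\<lambda>xs. g (map (\<lambda>f. f xs) fs))"
proof -
  from assms(1) obtain G where G: "recfn (length fs) G" "\<And>xs. length xs = length fs \<Longrightarrow> G xs = g xs"
    unfolding lcomputable_def by blast
  from assms(2) have "\<forall>f\<in>set fs. \<exists>F. recfn k F \<and> (\<forall>xs. length xs = k \<longrightarrow> F xs = f xs)"
    unfolding lcomputable_def by blast
  then obtain c where c: "\<forall>f\<in>set fs. recfn k (c f) \<and> (\<forall>xs. length xs = k \<longrightarrow> c f xs = f xs)"
    by metis
  show ?thesis
  proof (rule lcomputableI)
    show "recfn k (\<lambda>xs. G (map (\<lambda>f. f xs) (map c fs)))"
      using G(1) c by (intro recfn.comp) auto
    fix xs :: "nat list" assume "length xs = k"
    then have eq: "map (\<lambda>f. f xs) (map c fs) = map (\<lambda>f. f xs) fs" using c by auto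
    then show "G (map (\<lambda>f. f xs) (map c fs)) = g (map (\<lambda>f. f xs) fs)"
      unfolding eq using G(2) by simp
  qed
qed

lemma lcomputable_comp1:
  "lcomputable (Suc 0) g \<Longrightarrow> lcomputable k f \<Longrightarrow> lcomputable k (\<lambda>xs. g [f xs])"
  using lcomputable_comp[of "[f]" g k] by simp

lemma lcomputable_comp2:
  "lcomputable 2 g \<Longrightarrow> lcomputable k f1 \<Longrightarrow> lcomputable k f2 \<Longrightarrow> lcomputable k (\<lambda>xs. g [f1 xs, f2 xs])"
  using lcomputable_comp[of "[f1, f2]" g k] by (auto simp: numeral_2_eq_2)

lemma lcomputable_proj: "i < k \<Longrightarrow> lcomputable k (\<lambda>xs. xs ! i)"
  by (rule lcomputableI[OF recfn.proj]) auto

lemma lcomputable_Suc: "lcomputable k f \<Longrightarrow> lcomputable k (\<lambda>xs. Suc (f xs))"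
  using lcomputable_comp1[of "\<lambda>xs. Suc (hd xs)" k f] lcomputableI[OF recfn.suc] by simp

lemma lcomputable_const: "lcomputable k (\<lambda>xs. c)"
proof (induction c)
  case 0
  show ?case by (rule lcomputableI[OF recfn.zero]) simp
next
  case (Suc c)
  then show ?case by (rule lcomputable_Suc)
qed

lemma lcomputable_rec:
  assumes "lcomputable k g" "lcomputable (Suc (Suc k)) h"
  shows "lcomputable (Suc k) (\<lambda>xs. rec_nat (g (tl xs)) (\<lambda>n y. h (n # y # tl xs)) (hd xs))"
proof -
  from assms obtain G H where G: "recfn k G" "\<And>xs. length xs = k \<Longrightarrow> G xs = g xs"
    and H: "recfn (Suc (Suc k)) H" "\<And>xs. length xs = Suc (Suc k) \<Longrightarrow> H xs = h xs"
    unfolding lcomputable_def by blast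
  show ?thesis
  proof (rule lcomputableI[OF recfn.prim_rec[OF G(1) H(1)]])
    fix xs :: "nat list" assume xs: "length xs = Suc k"
    have "rec_nat (G (tl xs)) (\<lambda>n y. H (n # y # tl xs)) m =
        rec_nat (g (tl xs)) (\<lambda>n y. h (n # y # tl xs)) m" for m
      using xs G H by (induction m) auto
    then show "rec_nat (G (tl xs)) (\<lambda>n y. H (n # y # tl xs)) (hd xs) =
        rec_nat (g (tl xs)) (\<lambda>n y. h (n # y # tl xs)) (hd xs)" .
  qed
qed

lemma lcomputable_rec0:
  assumes "lcomputable 2 h"
  shows "lcomputable (Suc 0) (\<lambda>xs. rec_nat c (\<lambda>n y. h [n, y]) (hd xs))"
proof (rule lcomputable_cong)
  show "lcomputable (Suc 0) (\<lambda>xs. rec_nat c (\<lambda>n y. h (n # y # tl xs)) (hd xs))"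
    using lcomputable_rec[of 0 "\<lambda>_. c" h] assms lcomputable_const by (simp add: numeral_2_eq_2)
qed (auto simp: length_Suc_conv)

lemma lcomputable_rec1:
  assumes "lcomputable (Suc 0) g" "lcomputable 3 h"
  shows "lcomputable 2 (\<lambda>xs. rec_nat (g [xs ! 1]) (\<lambda>n y. h [n, y, xs ! 1]) (xs ! 0))"
proof (rule lcomputable_cong)
  show "lcomputable 2 (\<lambda>xs. rec_nat (g (tl xs)) (\<lambda>n y. h (n # y # tl xs)) (hd xs))"
    using lcomputable_rec[of "Suc 0" g h] assms by (simp add: numeral_2_eq_2 numeral_3_eq_3)
qed (auto simp: length_Suc_conv numeral_2_eq_2)

lemma lcomputable_mu:
  assumes "lcomputable (Suc k) g" "\<And>xs. length xs = k \<Longrightarrow> \<exists>n. g (n # xs) = 0"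
  shows "lcomputable k (\<lambda>xs. LEAST n. g (n # xs) = 0)"
proof -
  from assms obtain G where G: "recfn (Suc k) G" "\<And>xs. length xs = Suc k \<Longrightarrow> G xs = g xs"
    unfolding lcomputable_def by blast
  show ?thesis
    by (rule lcomputableI[OF recfn.mu[OF G(1)]]) (use G assms(2) in auto)
qed

section \<open>Elementary arithmetic functions\<close>

lemma lcomputable_add: "lcomputable 2 (\<lambda>xs. xs ! 0 + xs ! 1)"
proof (rule lcomputable_cong)
  show "lcomputable 2 (\<lambda>xs. rec_nat ([xs ! 1] ! 0) (\<lambda>n y. Suc ([n, y, xs ! 1] ! 1)) (xs ! 0))"
    by (rule lcomputable_rec1; intro lcomputable_Suc lcomputable_proj; simp)
  have "rec_nat b (\<lambda>n. Suc) a = a + b" for a b :: nat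
    by (induction a) auto
  then show "rec_nat ([xs ! 1] ! 0) (\<lambda>n y. Suc ([n, y, xs ! 1] ! 1)) (xs ! 0) = xs ! 0 + xs ! 1"
    for xs :: "nat list" by simp
qed

lemma lcomputable_pred: "lcomputable (Suc 0) (\<lambda>xs. xs ! 0 - 1)"
proof (rule lcomputable_cong)
  show "lcomputable (Suc 0) (\<lambda>xs. rec_nat 0 (\<lambda>n y. [n, y] ! 0) (hd xs))"
    by (rule lcomputable_rec0; rule lcomputable_proj; simp)
  have "rec_nat 0 (\<lambda>n y. n) a = a - 1" for a :: nat
    by (cases a) auto
  then show "length xs = Suc 0 \<Longrightarrow> rec_nat 0 (\<lambda>n y. [n, y] ! 0) (hd xs) = xs ! 0 - 1"
    for xs :: "nat list" by (cases xs) auto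
qed

text \<open>The arguments are swapped because primitive recursion runs on the first one, whereas
  truncated subtraction recurses on the number being subtracted.\<close>

lemma lcomputable_rdiff: "lcomputable 2 (\<lambda>xs. xs ! 1 - xs ! 0)"
proof (rule lcomputable_cong)
  show "lcomputable 2 (\<lambda>xs. rec_nat ([xs ! 1] ! 0) (\<lambda>n y. [[n, y, xs ! 1] ! 1] ! 0 - 1) (xs ! 0))"
    by (rule lcomputable_rec1; intro lcomputable_comp1[OF lcomputable_pred] lcomputable_proj; simp)
  have "rec_nat b (\<lambda>n y. y - Suc 0) a = b - a" for a b :: nat
    by (induction a) auto
  then show "rec_nat ([xs ! 1] ! 0) (\<lambda>n y. [[n, y, xs ! 1] ! 1] ! 0 - 1) (xs ! 0) = xs ! 1 - xs ! 0"
    for xs :: "nat list" by simp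
qed

lemma lcomputable_add': "lcomputable k f \<Longrightarrow> lcomputable k g \<Longrightarrow> lcomputable k (\<lambda>xs. f xs + g xs)"
  using lcomputable_comp2[OF lcomputable_add, of k f g] by simp

lemma lcomputable_diff': "lcomputable k f \<Longrightarrow> lcomputable k g \<Longrightarrow> lcomputable k (\<lambda>xs. f xs - g xs)"
  using lcomputable_comp2[OF lcomputable_rdiff, of k g f] by simp

lemma lcomputable_triangle: "lcomputable k f \<Longrightarrow> lcomputable k (\<lambda>xs. triangle (f xs))"
proof -
  assume f: "lcomputable k f"
  have "lcomputable (Suc 0) (\<lambda>xs. triangle (hd xs))"
  proof (rule lcomputable_cong)
    show "lcomputable (Suc 0) (\<lambda>xs. rec_nat 0 (\<lambda>n y. [n, y] ! 1 + Suc ([n, y] ! 0)) (hd xs))"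
      by (rule lcomputable_rec0; intro lcomputable_add' lcomputable_Suc lcomputable_proj; simp)
    have "rec_nat 0 (\<lambda>n y. y + Suc n) a = triangle a" for a
      by (induction a) auto
    then show "rec_nat 0 (\<lambda>n y. [n, y] ! 1 + Suc ([n, y] ! 0)) (hd xs) = triangle (hd xs)"
      for xs :: "nat list" by simp
  qed
  from lcomputable_comp1[OF this f] show ?thesis by simp
qed

section \<open>The Cantor pairing function and its projections\<close>

definition pair :: "nat \<Rightarrow> nat \<Rightarrow> nat" where "pair a b = prod_encode (a, b)"
definition pfst :: "nat \<Rightarrow> nat" where "pfst x = fst (prod_decode x)"
definition psnd :: "nat \<Rightarrow> nat" where "psnd x = snd (prod_decode x)"

lemma pfst_pair [simp]: "pfst (pair a b) = a" and psnd_pair [simp]: "psnd (pair a b) = b"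
  by (auto simp: pair_def pfst_def psnd_def)

lemma pair_eq: "pair a b = triangle (a + b) + a"
  by (simp add: pair_def prod_encode_def)

lemma pair_surj: "pair (pfst z) (psnd z) = z"
  by (simp add: pair_def pfst_def psnd_def)

lemma triangle_mono: "a \<le> b \<Longrightarrow> triangle a \<le> triangle b"
  by (induction b) (auto simp: le_Suc_eq)

lemma pair_mono: "a \<le> a' \<Longrightarrow> b \<le> b' \<Longrightarrow> pair a b \<le> pair a' b'"
  unfolding pair_eq by (intro add_mono triangle_mono) auto

text \<open>The sum of the components of \<open>z\<close> is the index of the diagonal containing \<open>z\<close>, which can be
  found by minimisation.\<close>

lemma pair_diagonal: "(LEAST k. Suc z - triangle (Suc k) = 0) = pfst z + psnd z"
proof -
  define a b where "a = pfst z" and "b = psnd z"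
  have z: "z = triangle (a + b) + a" by (metis pair_surj pair_eq a_def b_def)
  show ?thesis unfolding a_def[symmetric] b_def[symmetric]
  proof (rule Least_equality)
    show "Suc z - triangle (Suc (a + b)) = 0" using z by simp
    fix k assume "Suc z - triangle (Suc k) = 0"
    then have "z < triangle (Suc k)" by simp
    then show "a + b \<le> k" using triangle_mono[of "Suc k" "a + b"] z by (meson le_add1 le_trans not_less not_less_eq_eq)
  qed
qed

lemma lcomputable_pair: "lcomputable k f \<Longrightarrow> lcomputable k g \<Longrightarrow> lcomputable k (\<lambda>xs. pair (f xs) (g xs))"
  unfolding pair_eq by (intro lcomputable_add' lcomputable_triangle)

lemma lcomputable_diagonal:
  "lcomputable k f \<Longrightarrow> lcomputable k (\<lambda>xs. pfst (f xs) + psnd (f xs))"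
proof -
  assume f: "lcomputable k f"
  have "lcomputable (Suc 0) (\<lambda>xs. LEAST n. Suc ((n # xs) ! 1) - triangle (Suc ((n # xs) ! 0)) = 0)"
  proof (rule lcomputable_mu)
    show "lcomputable (Suc (Suc 0)) (\<lambda>xs. Suc (xs ! 1) - triangle (Suc (xs ! 0)))"
      by (intro lcomputable_diff' lcomputable_Suc lcomputable_triangle lcomputable_proj) auto
    show "\<exists>n. Suc ((n # xs) ! 1) - triangle (Suc ((n # xs) ! 0)) = 0" for xs :: "nat list"
      \<comment> \<open>The number itself is a large enough index, since
        \<open>triangle (Suc z) \<ge> Suc z\<close>; hence the minimisation is regular.\<close>
      by (rule exI[of _ "xs ! 0"]) (simp add: triangle_def)
  qed
  then have "lcomputable (Suc 0) (\<lambda>xs. pfst (xs ! 0) + psnd (xs ! 0))"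
    by (rule lcomputable_cong) (use pair_diagonal in simp)
  from lcomputable_comp1[OF this f] show ?thesis by simp
qed

lemma lcomputable_pfst: "lcomputable k f \<Longrightarrow> lcomputable k (\<lambda>xs. pfst (f xs))"
proof -
  assume f: "lcomputable k f"
  have "pfst z = z - triangle (pfst z + psnd z)" for z
    by (metis pair_surj pair_eq add_diff_cancel_left')
  then show ?thesis using f by (subst \<open>\<And>z. pfst z = _\<close>) (intro lcomputable_diff' lcomputable_triangle lcomputable_diagonal)
qed

lemma lcomputable_psnd: "lcomputable k f \<Longrightarrow> lcomputable k (\<lambda>xs. psnd (f xs))"
proof -
  assume f: "lcomputable k f"
  have "lcomputable k (\<lambda>xs. (pfst (f xs) + psnd (f xs)) - pfst (f xs))"
    using f by (intro lcomputable_diff' lcomputable_pfst lcomputable_diagonal)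
  then show ?thesis by simp
qed

section \<open>Computability and decidability with a single argument\<close>

definition computable :: "(nat \<Rightarrow> nat) \<Rightarrow> bool" where
  "computable f \<longleftrightarrow> lcomputable (Suc 0) (\<lambda>xs. f (xs ! 0))"

definition decidable :: "(nat \<Rightarrow> bool) \<Rightarrow> bool" where
  "decidable P \<longleftrightarrow> computable (\<lambda>x. of_bool (P x))"

named_theorems comp_intros

lemma computable_id [comp_intros]: "computable (\<lambda>x. x)"
  unfolding computable_def by (rule lcomputable_proj) simp

lemma computable_const [comp_intros]: "computable (\<lambda>x. c)"
  unfolding computable_def by (rule lcomputable_const)

lemma computable_comp: "computable f \<Longrightarrow> computable g \<Longrightarrow> computable (\<lambda>x. f (g x))"
  unfolding computable_def
  using lcomputable_comp1[of "\<lambda>xs. f (xs ! 0)" "Suc 0" "\<lambda>xs. g (xs ! 0)"] by simp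

lemma computable_Suc [comp_intros]: "computable f \<Longrightarrow> computable (\<lambda>x. Suc (f x))"
  unfolding computable_def by (rule lcomputable_Suc)

lemma computable_add [comp_intros]: "computable f \<Longrightarrow> computable g \<Longrightarrow> computable (\<lambda>x. f x + g x)"
  unfolding computable_def by (rule lcomputable_add')

lemma computable_diff [comp_intros]: "computable f \<Longrightarrow> computable g \<Longrightarrow> computable (\<lambda>x. f x - g x)"
  unfolding computable_def by (rule lcomputable_diff')

lemma computable_pair [comp_intros]: "computable f \<Longrightarrow> computable g \<Longrightarrow> computable (\<lambda>x. pair (f x) (g x))"
  unfolding computable_def by (rule lcomputable_pair)

lemma computable_pfst [comp_intros]: "computable f \<Longrightarrow> computable (\<lambda>x. pfst (f x))"
  unfolding computable_def by (rule lcomputable_pfst)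

lemma computable_psnd [comp_intros]: "computable f \<Longrightarrow> computable (\<lambda>x. psnd (f x))"
  unfolding computable_def by (rule lcomputable_psnd)

text \<open>Counter, previous value and parameter travel as one nested pair \<open>p\<close>, so
  that the step function can be treated by the closure rules for one variable.\<close>

lemma computable_rec:
  assumes g: "computable g" and b: "computable b"
    and h: "computable (\<lambda>p. h (pfst p) (pfst (psnd p)) (psnd (psnd p)))"
  shows "computable (\<lambda>x. rec_nat (g x) (\<lambda>n y. h n y x) (b x))"
proof -
  have "lcomputable 3 (\<lambda>xs. h (xs ! 0) (xs ! 1) (xs ! 2))"
    using lcomputable_comp1[OF h[unfolded computable_def], of 3 "\<lambda>xs. pair (xs ! 0) (pair (xs ! 1) (xs ! 2))"]
    by (simp add: lcomputable_pair lcomputable_proj)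
  from lcomputable_rec1[OF g[unfolded computable_def] this]
  have "lcomputable 2 (\<lambda>xs. rec_nat (g (xs ! 1)) (\<lambda>n y. h n y (xs ! 1)) (xs ! 0))" by simp
  from lcomputable_comp2[OF this b[unfolded computable_def] computable_id[unfolded computable_def]]
  show ?thesis by (simp add: computable_def)
qed

lemma computable_mult [comp_intros]:
  assumes "computable f" "computable g" shows "computable (\<lambda>x. f x * g x)"
proof -
  have "rec_nat 0 (\<lambda>n y. y + b) a = a * b" for a b :: nat
    by (induction a) auto
  moreover have "computable (\<lambda>x. rec_nat 0 (\<lambda>n y. y + g x) (f x))"
    by (intro computable_rec comp_intros computable_comp[OF assms(2)] assms(1))
  ultimately show ?thesis by simp
qed

lemma computable_power [comp_intros]:
  assumes "computable f" "computable g" shows "computable (\<lambda>x. f x ^ g x)"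
proof -
  have "rec_nat 1 (\<lambda>n y. y * b) a = b ^ a" for a b :: nat
    by (induction a) auto
  moreover have "computable (\<lambda>x. rec_nat 1 (\<lambda>n y. y * f x) (g x))"
    by (intro computable_rec comp_intros computable_comp[OF assms(1)] assms)
  ultimately show ?thesis by simp
qed

lemma decidable_const [comp_intros]: "decidable (\<lambda>x. b)"
  unfolding decidable_def by (rule comp_intros)

lemma decidable_comp: "decidable P \<Longrightarrow> computable g \<Longrightarrow> decidable (\<lambda>x. P (g x))"
  unfolding decidable_def by (rule computable_comp)

lemma decidable_not [comp_intros]: "decidable P \<Longrightarrow> decidable (\<lambda>x. \<not> P x)"
proof -
  have "of_bool (\<not> b) = 1 - (of_bool b :: nat)" for b by simp
  then show "decidable P \<Longrightarrow> ?thesis" unfolding decidable_def by (simp only:) (intro comp_intros)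
qed

lemma decidable_conj [comp_intros]: "decidable P \<Longrightarrow> decidable Q \<Longrightarrow> decidable (\<lambda>x. P x \<and> Q x)"
  unfolding decidable_def of_bool_conj by (intro comp_intros)

lemma decidable_disj [comp_intros]: "decidable P \<Longrightarrow> decidable Q \<Longrightarrow> decidable (\<lambda>x. P x \<or> Q x)"
proof -
  have eq: "P x \<or> Q x \<longleftrightarrow> \<not> (\<not> P x \<and> \<not> Q x)" for x by blast
  show "decidable P \<Longrightarrow> decidable Q \<Longrightarrow> ?thesis" unfolding eq by (intro comp_intros)
qed

lemma decidable_imp [comp_intros]: "decidable P \<Longrightarrow> decidable Q \<Longrightarrow> decidable (\<lambda>x. P x \<longrightarrow> Q x)"
  unfolding imp_conv_disj by (intro comp_intros)

lemma decidable_iff [comp_intros]: "decidable P \<Longrightarrow> decidable Q \<Longrightarrow> decidable (\<lambda>x. P x \<longleftrightarrow> Q x)"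
  unfolding iff_conv_conj_imp by (intro comp_intros)

lemma decidable_pos: "computable f \<Longrightarrow> decidable (\<lambda>x. f x > 0)"
proof -
  have eq: "of_bool (f x > 0) = 1 - (1 - f x)" for x by auto
  show "computable f \<Longrightarrow> ?thesis" unfolding decidable_def eq by (intro comp_intros)
qed

lemma decidable_less [comp_intros]: "computable f \<Longrightarrow> computable g \<Longrightarrow> decidable (\<lambda>x. f x < g x)"
  using decidable_pos[OF computable_diff[of g f]] by simp

lemma decidable_eq [comp_intros]: "computable f \<Longrightarrow> computable g \<Longrightarrow> decidable (\<lambda>x. f x = g x)"
  proof -
  have "m = n \<longleftrightarrow> \<not> m < n \<and> \<not> n < m" for m n :: nat by auto
  then show "computable f \<Longrightarrow> computable g \<Longrightarrow> ?thesis" by (simp only:) (intro comp_intros)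
qed

lemma computable_of_bool [comp_intros]: "decidable P \<Longrightarrow> computable (\<lambda>x. of_bool (P x))"
  unfolding decidable_def .

lemma computable_if [comp_intros]:
  assumes "decidable P" "computable f" "computable g"
  shows "computable (\<lambda>x. if P x then f x else g x)"
proof -
  have "(if b then m else n) = of_bool b * m + (1 - of_bool b) * n" for b and m n :: nat by simp
  then show ?thesis using assms by (simp only:) (intro comp_intros)
qed

lemma decidable_if [comp_intros]:
  assumes "decidable P" "decidable Q" "decidable R"
  shows "decidable (\<lambda>x. if P x then Q x else R x)"
  unfolding if_bool_eq_conj using assms by (intro comp_intros)

text \<open>The recursion carries a flag that stays 1 once a witness has been met. Bound variable
  and parameter are packed into one pair in the premise, so the rule can be nested.\<close>

lemma decidable_bex [comp_intros]:
  assumes "decidable (\<lambda>p. P (pfst p) (psnd p))" "computable b"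
  shows "decidable (\<lambda>x. \<exists>n<b x. P n x)"
proof -
  have "rec_nat 0 (\<lambda>n y. of_bool (y = 1 \<or> P n x)) m = (of_bool (\<exists>n<m. P n x) :: nat)" for m x
    by (induction m) (auto simp: less_Suc_eq)
  moreover have "decidable (\<lambda>p. P (pfst p) (psnd (psnd p)))"
    using decidable_comp[OF assms(1) computable_pair[OF computable_pfst[OF computable_id]
          computable_psnd[OF computable_psnd[OF computable_id]]]] by simp
  then have "computable (\<lambda>x. rec_nat 0 (\<lambda>n y. of_bool (y = 1 \<or> P n x)) (b x))"
    by (intro computable_rec comp_intros assms(2))
  ultimately show ?thesis unfolding decidable_def by simp
qed

lemma decidable_ball [comp_intros]:
  assumes "decidable (\<lambda>p. P (pfst p) (psnd p))" "computable b"
  shows "decidable (\<lambda>x. \<forall>n<b x. P n x)"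
proof -
  have "decidable (\<lambda>x. \<not> (\<exists>n<b x. \<not> P n x))" using assms by (intro comp_intros)
  then show ?thesis by simp
qed

lemma computable_funpow:
  assumes "computable f" "computable g" "computable b"
  shows "computable (\<lambda>x. (f ^^ b x) (g x))"
proof -
  have "rec_nat a (\<lambda>n. f) m = (f ^^ m) a" for m a
    by (induction m) auto
  moreover have "computable (\<lambda>x. rec_nat (g x) (\<lambda>n. f) (b x))"
    by (intro computable_rec comp_intros computable_comp[OF assms(1)] assms)
  ultimately show ?thesis by simp
qed

text \<open>The quotient grows exactly when \<open>Suc a\<close> reaches the next multiple of
  \<open>b\<close>, which a primitive recursion can test from the previous quotient. For
  \<open>b = 0\<close> the test never succeeds, in accordance with
  \<open>a div 0 = 0\<close>.\<close>

lemma div_Suc_eq: "Suc a div b = (if Suc a = b + a div b * b then Suc (a div b) else a div b)"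
proof (cases "Suc a mod b = 0")
  case True
  then have "Suc a div b = Suc (a div b)" by (simp add: div_Suc)
  moreover have "Suc a = Suc a div b * b" using True by (metis add.right_neutral div_mult_mod_eq)
  ultimately show ?thesis by (metis mult_Suc)
next
  case False
  then have "Suc a div b = a div b" by (simp add: div_Suc)
  moreover have "Suc a \<noteq> b + a div b * b" using False by (metis mod_mult_self2_is_0 mult_Suc mult.commute)
  ultimately show ?thesis by (simp only: if_False)
qed

lemma computable_div [comp_intros]:
  assumes "computable f" "computable g" shows "computable (\<lambda>x. f x div g x)"
proof -
  have eq: "f x div g x = rec_nat 0 (\<lambda>n y. if Suc n = g x + y * g x then Suc y else y) (f x)" for x
  proof -
    have "a div b = rec_nat 0 (\<lambda>n y. if Suc n = b + y * b then Suc y else y) a" for a b :: nat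
    proof (induction a)
      case (Suc a)
      show ?case unfolding div_Suc_eq[of a b] by (simp only: Suc.IH[symmetric] nat.rec)
    qed simp
    then show ?thesis .
  qed
  show ?thesis unfolding eq
    by (intro computable_rec comp_intros computable_comp[OF assms(2)] assms(1))
qed

lemma computable_mod [comp_intros]:
  "computable f \<Longrightarrow> computable g \<Longrightarrow> computable (\<lambda>x. f x mod g x)"
  unfolding minus_div_mult_eq_mod[symmetric] by (intro comp_intros)

text \<open>Numbers \<open>w < b ^ L\<close> code the functions from \<open>{..<L}\<close> to \<open>{..<b}\<close>.\<close>

definition digit :: "nat \<Rightarrow> nat \<Rightarrow> nat \<Rightarrow> nat" where
  "digit b w i = w div b ^ i mod b"

lemma computable_digit [comp_intros]:
  "computable f \<Longrightarrow> computable g \<Longrightarrow> computable h \<Longrightarrow> computable (\<lambda>x. digit (f x) (g x) (h x))"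
  unfolding digit_def by (intro comp_intros)

text \<open>Horner's scheme with \<open>f 0\<close> as the lowest digit. This turns an existential
  quantifier over valuations, assignments of tuples, node sets or structures into a bounded search
  over numbers.\<close>

lemma ex_digits: "(\<And>i. i < L \<Longrightarrow> f i < b) \<Longrightarrow> \<exists>w<b ^ L. \<forall>i<L. digit b w i = f i"
proof (induction L arbitrary: f)
  case (Suc L)
  obtain w where w: "w < b ^ L" "\<And>i. i < L \<Longrightarrow> digit b w i = f (Suc i)"
    using Suc.IH[of "\<lambda>i. f (Suc i)"] Suc.prems by auto
  have f0: "f 0 < b" using Suc.prems by simp
  have "digit b (w * b + f 0) i = f i" if "i < Suc L" for i
  proof (cases i)
    case 0
    then show ?thesis using f0 by (simp add: digit_def)
  next
    case (Suc j)
    then have "digit b (w * b + f 0) i = digit b w j"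
      using f0 by (simp add: digit_def div_mult2_eq)
    then show ?thesis using Suc w that by simp
  qed
  moreover have "w * b + f 0 < b ^ Suc L"
  proof -
    have "w * b + f 0 < Suc w * b" using f0 by simp
    also have "\<dots> \<le> b ^ L * b" using w(1) by (intro mult_le_mono1) simp
    finally show ?thesis by (simp add: mult.commute)
  qed
  ultimately show ?case by blast
qed simp

section \<open>Codes of lists and course-of-values recursion\<close>

definition chd :: "nat \<Rightarrow> nat" where "chd c = pfst (c - 1)"
definition ctl :: "nat \<Rightarrow> nat" where "ctl c = psnd (c - 1)"
definition cnth :: "nat \<Rightarrow> nat \<Rightarrow> nat" where "cnth c i = chd ((ctl ^^ i) c)"

lemma list_encode_Cons: "list_encode (x # xs) = Suc (pair x (list_encode xs))"
  by (simp add: pair_def)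

declare list_encode.simps(2) [simp del]
declare list_encode_Cons [simp]

lemma chd_Suc_pair [simp]: "chd (Suc (pair x c)) = x" and ctl_Suc_pair [simp]: "ctl (Suc (pair x c)) = c"
  by (auto simp: chd_def ctl_def)

lemma computable_chd [comp_intros]: "computable f \<Longrightarrow> computable (\<lambda>x. chd (f x))"
  and computable_ctl [comp_intros]: "computable f \<Longrightarrow> computable (\<lambda>x. ctl (f x))"
  unfolding chd_def ctl_def by (intro comp_intros; assumption)+

lemma computable_drop [comp_intros]:
  "computable f \<Longrightarrow> computable g \<Longrightarrow> computable (\<lambda>x. (ctl ^^ g x) (f x))"
  by (intro computable_funpow comp_intros)

lemma computable_cnth [comp_intros]:
  "computable f \<Longrightarrow> computable g \<Longrightarrow> computable (\<lambda>x. cnth (f x) (g x))"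
  unfolding cnth_def by (intro comp_intros)

lemma ctl_drop: "i \<le> length xs \<Longrightarrow> (ctl ^^ i) (list_encode xs) = list_encode (drop i xs)"
proof (induction i)
  case (Suc i)
  then have "drop i xs = xs ! i # drop (Suc i) xs" by (simp add: Cons_nth_drop_Suc)
  then show ?case using Suc by simp
qed simp

lemma cnth_list_encode: "i < length xs \<Longrightarrow> cnth (list_encode xs) i = xs ! i"
  by (simp add: cnth_def ctl_drop Cons_nth_drop_Suc[symmetric])

lemma cnth_simps [simp]:
  "cnth (Suc (pair x c)) 0 = x" "cnth (Suc (pair x c)) (Suc n) = cnth c n"
  "cnth (Suc (pair x c)) (numeral k) = cnth c (pred_numeral k)"
  by (simp_all add: cnth_def funpow_swap1 numeral_eq_Suc)

lemma le_pair1: "a \<le> pair a b" and le_pair2: "b \<le> pair a b"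
  by (simp_all add: pair_def le_prod_encode_1 le_prod_encode_2)

lemma length_le_list_encode: "length xs \<le> list_encode xs"
proof (induction xs)
  case (Cons x xs)
  then show ?case using le_pair2[of "list_encode xs" x] by simp
qed simp

text \<open>Strictness matters: a subformula has a smaller code than the formula, so its truth value
  is found in the table of a course-of-values recursion. The same estimate bounds bound variables
  and arities by the code in which they occur.\<close>

lemma in_set_less_list_encode: "x \<in> set xs \<Longrightarrow> x < list_encode xs"
proof (induction xs)
  case (Cons y xs)
  then show ?case using le_pair2[of "list_encode xs" y] le_pair1[of y "list_encode xs"] by auto
qed simp

text \<open>Course-of-values recursion: the values at the smaller arguments are passed as a list code,
  the value at \<open>c - 1\<close> being the first element.\<close>

definition history :: "(nat \<Rightarrow> nat) \<Rightarrow> nat \<Rightarrow> nat" where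
  "history g c = rec_nat 0 (\<lambda>n y. Suc (pair (g n) y)) c"

lemma cnth_history: "m < c \<Longrightarrow> cnth (history g c) (c - Suc m) = g m"
proof (induction c)
  case (Suc c)
  show ?case
  proof (cases "m = c")
    case False
    then have "Suc c - Suc m = Suc (c - Suc m)" using Suc.prems by simp
    then show ?thesis using Suc False by (simp add: history_def)
  qed (simp add: history_def)
qed simp

definition cov :: "(nat \<Rightarrow> nat \<Rightarrow> nat) \<Rightarrow> nat \<Rightarrow> nat" where
  "cov h c = chd (rec_nat 0 (\<lambda>n y. Suc (pair (h n y) y)) (Suc c))"

lemma cov_unfold: "cov h c = h c (history (cov h) c)"
proof -
  have "history (cov h) c = rec_nat 0 (\<lambda>n y. Suc (pair (h n y) y)) c"
    by (induction c) (simp_all add: history_def cov_def)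
  then show ?thesis by (simp add: cov_def)
qed

lemma computable_cov:
  assumes h: "computable (\<lambda>p. h (psnd (psnd p)) (pfst p) (pfst (psnd p)))" and g: "computable g"
  shows "computable (\<lambda>x. cov (h x) (g x))"
  unfolding cov_def
  by (intro comp_intros computable_rec[where h = "\<lambda>n y x. Suc (pair (h x n y) y)"] g h)

section \<open>Evaluation of coded formulas in coded structures\<close>

text \<open>By the layout of the table, index \<open>c - Suc (ctl c)\<close> holds the result
  already computed for the tail.\<close>

definition cmap :: "(nat \<Rightarrow> nat) \<Rightarrow> nat \<Rightarrow> nat" where
  "cmap f = cov (\<lambda>c H. if c = 0 then 0 else Suc (pair (f (chd c)) (cnth H (c - Suc (ctl c)))))"

lemma cmap_list_encode [simp]: "cmap f (list_encode xs) = list_encode (map f xs)"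
proof (induction xs)
  case Nil
  show ?case unfolding cmap_def by (subst cov_unfold) simp
next
  case (Cons x xs)
  have "list_encode xs < list_encode (x # xs)"
    using le_pair2[of "list_encode xs" x] by simp
  from cnth_history[OF this, of "cmap f"] show ?case
    using Cons unfolding cmap_def by (subst cov_unfold) simp
qed

lemma computable_cmap:
  assumes f: "computable (\<lambda>p. f (psnd p) (pfst p))" and g: "computable g"
  shows "computable (\<lambda>x. cmap (f x) (g x))"
proof -
  have "computable (\<lambda>p. f (psnd (psnd p)) (chd (pfst p)))"
    using computable_comp[OF f computable_pair[OF computable_chd[OF computable_pfst[OF computable_id]]
        computable_psnd[OF computable_psnd[OF computable_id]]]] by simp
  then show ?thesis unfolding cmap_def
    by (intro computable_cov comp_intros g)
qed

text \<open>Quantifiers are skipped, so that on prenex formulas only the quantifier-free part is evaluated.\<close>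

fun matrix :: "(nat \<Rightarrow> nat list \<Rightarrow> bool) \<Rightarrow> (nat \<Rightarrow> nat \<Rightarrow> bool) \<Rightarrow> fm \<Rightarrow> bool" where
  "matrix R E (Rel r xs) = R r xs"
| "matrix R E (Eq x y) = E x y"
| "matrix R E (Neg \<phi>) = (\<not> matrix R E \<phi>)"
| "matrix R E (And \<phi> \<psi>) = (matrix R E \<phi> \<and> matrix R E \<psi>)"
| "matrix R E (Ex x \<phi>) = matrix R E \<phi>"
| "matrix R E _ = False"

text \<open>The tests select constructor tags of \<open>fm_code\<close>; on truth values 0 and 1,
  negation is subtraction from 1 and conjunction is multiplication. The atoms are parameters because
  for interpretations they are themselves answered by evaluating a formula.\<close>

definition cmatrix :: "(nat \<Rightarrow> nat \<Rightarrow> bool) \<Rightarrow> (nat \<Rightarrow> nat \<Rightarrow> bool) \<Rightarrow> nat \<Rightarrow> nat" where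
  "cmatrix R E = cov (\<lambda>c H.
     if cnth c 0 = 1 then of_bool (R (cnth c 1) (cnth c 2))
     else if cnth c 0 = 2 then of_bool (E (cnth c 1) (cnth c 2))
     else if cnth c 0 = 4 then 1 - cnth H (c - Suc (cnth c 1))
     else if cnth c 0 = 5 then cnth H (c - Suc (cnth c 1)) * cnth H (c - Suc (cnth c 2))
     else if cnth c 0 = 6 then cnth H (c - Suc (cnth c 2))
     else 0)"

lemma cmatrix_fm_code:
  "cmatrix R E (fm_code \<phi>) = of_bool (matrix (\<lambda>r xs. R r (list_encode xs)) E \<phi>)"
proof (induction \<phi>)
  case (Neg \<phi>)
  have "fm_code \<phi> < fm_code (Neg \<phi>)" by (simp del: list_encode_Cons add: in_set_less_list_encode)
  note h = cnth_history[OF this, of "cmatrix R E"]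
  show ?case using Neg h unfolding cmatrix_def by (subst cov_unfold) simp
next
  case (And \<phi> \<psi>)
  have "fm_code \<phi> < fm_code (And \<phi> \<psi>)" "fm_code \<psi> < fm_code (And \<phi> \<psi>)"
    by (simp_all del: list_encode_Cons add: in_set_less_list_encode)
  note h = this[THEN cnth_history, of "cmatrix R E"]
  show ?case using And h unfolding cmatrix_def by (subst cov_unfold) simp
next
  case (Ex x \<phi>)
  have "fm_code \<phi> < fm_code (Ex x \<phi>)" by (simp del: list_encode_Cons add: in_set_less_list_encode)
  note h = cnth_history[OF this, of "cmatrix R E"]
  show ?case using Ex h unfolding cmatrix_def by (subst cov_unfold) simp
qed (unfold cmatrix_def, (subst cov_unfold, simp)+)

lemma computable_cmatrix:
  assumes R: "decidable (\<lambda>p. R (psnd (psnd p)) (pfst p) (pfst (psnd p)))"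
    and E: "decidable (\<lambda>p. E (psnd (psnd p)) (pfst p) (pfst (psnd p)))"
    and g: "computable g"
  shows "computable (\<lambda>x. cmatrix (R x) (E x) (g x))"
proof -
  have c: "computable (\<lambda>p. pair (cnth (pfst p) 1) (pair (cnth (pfst p) 2) (psnd (psnd p))))"
    by (intro comp_intros)
  show ?thesis unfolding cmatrix_def
    using decidable_comp[OF R c] decidable_comp[OF E c]
    by (intro computable_cov comp_intros g) simp_all
qed

text \<open>A pair \<open>(n, s)\<close> of numbers codes a structure with universe \<open>{..<n}\<close>, the tuple \<open>as\<close> being in
  the \<open>r\<close>-th relation iff the bit of \<open>s\<close> with index \<open>(r, as)\<close> is set.\<close>

definition bit_rel :: "nat \<Rightarrow> nat \<Rightarrow> nat \<Rightarrow> bool" where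
  "bit_rel s r as = (digit 2 s (pair r as) = 1)"

definition bit_struct :: "schema \<Rightarrow> nat \<Rightarrow> nat \<Rightarrow> nat fstruct" where
  "bit_struct \<sigma> n s = \<lparr>univ = {..<n}, rels = map (\<lambda>r.
     {as. length as = \<sigma> ! r \<and> set as \<subseteq> {..<n} \<and> bit_rel s r (list_encode as)}) [0..<length \<sigma>]\<rparr>"

definition ceval :: "nat \<Rightarrow> (nat \<Rightarrow> nat) \<Rightarrow> nat \<Rightarrow> bool" where
  "ceval s f c \<longleftrightarrow> cmatrix (\<lambda>r xs. bit_rel s r (cmap f xs)) (\<lambda>x y. f x = f y) c = 1"

lemma decidable_ceval:
  assumes "computable s" "computable (\<lambda>p. f (psnd p) (pfst p))" "computable g"
  shows "decidable (\<lambda>x. ceval (s x) (f x) (g x))"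
proof -
  have 1: "computable (\<lambda>p. f (psnd (psnd (psnd p))) (pfst p))"
    using computable_comp[OF assms(2) computable_pair[OF computable_pfst[OF computable_id]
      computable_psnd[OF computable_psnd[OF computable_psnd[OF computable_id]]]]] by simp
  have 2: "computable (\<lambda>p. f (psnd (psnd p)) (pfst p))"
    using computable_comp[OF assms(2) computable_pair[OF computable_pfst[OF computable_id]
      computable_psnd[OF computable_psnd[OF computable_id]]]] by simp
  have 3: "computable (\<lambda>p. f (psnd (psnd p)) (pfst (psnd p)))"
    using computable_comp[OF assms(2) computable_pair[OF computable_pfst[OF computable_psnd[OF computable_id]]
      computable_psnd[OF computable_psnd[OF computable_id]]]] by simp
  show ?thesis unfolding ceval_def bit_rel_def
    by (intro comp_intros computable_cmatrix computable_cmap computable_comp[OF assms(1)] 1 2 3 assms(3))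
qed

text \<open>A valuation is coded by the number \<open>w\<close> with the values as digits. In \<open>tuple_val\<close> these values
  are grouped into \<open>d\<close>-tuples, and the variables of a formula of a \<open>d\<close>-dimensional interpretation are
  evaluated by the concatenation of the tuples with the indices in the list coded by \<open>xs\<close>.\<close>

definition tuple_val :: "nat \<Rightarrow> nat \<Rightarrow> nat \<Rightarrow> nat \<Rightarrow> nat \<Rightarrow> nat" where
  "tuple_val n w d xs y = digit (Suc n) w (cnth xs (y div d) * d + y mod d)"

text \<open>The base is \<open>Suc n\<close>, not \<open>n\<close>, so that a valuation exists even
  for \<open>n = 0\<close>. The digits are confined to the universe only when the formula starts
  with a quantifier (tag 6): an empty universe then makes it false, while a quantifier-free sentence
  keeps its truth value. There are \<open>c\<close> digits since every variable of the prefix is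
  below the code \<open>c\<close>.\<close>

definition csat :: "nat \<Rightarrow> nat \<Rightarrow> nat \<Rightarrow> bool" where
  "csat n s c \<longleftrightarrow> (\<exists>w<Suc n ^ c. (chd c = 6 \<longrightarrow> (\<forall>x<c. digit (Suc n) w x < n)) \<and>
     ceval s (digit (Suc n) w) c)"

text \<open>Digit block \<open>x\<close> of length \<open>cnth i 0\<close> is the tuple assigned to
  variable \<open>x\<close>, and \<open>Suc (pair x 0)\<close> codes the list \<open>[x]\<close>.
  The outer evaluation handles the sentence over the target schema; each of its atoms calls the
  inner evaluation of a source formula on concatenated tuples.\<close>

definition csat_interp :: "nat \<Rightarrow> nat \<Rightarrow> nat \<Rightarrow> nat \<Rightarrow> bool" where
  "csat_interp n s c i \<longleftrightarrow> (\<exists>w<Suc n ^ (c * cnth i 0).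
     (chd c = 6 \<longrightarrow> (\<forall>x<c. (\<forall>j<cnth i 0. digit (Suc n) w (x * cnth i 0 + j) < n) \<and>
        ceval s (tuple_val n w (cnth i 0) (Suc (pair x 0))) (cnth i 1))) \<and>
     cmatrix (\<lambda>r xs. ceval s (tuple_val n w (cnth i 0) xs) (cnth (cnth i 3) r))
       (\<lambda>x y. ceval s (tuple_val n w (cnth i 0) (Suc (pair x (Suc (pair y 0))))) (cnth i 2)) c = 1)"

lemma decidable_csat:
  assumes "computable n" "computable s" "computable c"
  shows "decidable (\<lambda>x. csat (n x) (s x) (c x))"
  unfolding csat_def
  by (intro comp_intros decidable_ceval computable_comp[OF assms(1)] computable_comp[OF assms(2)]
      computable_comp[OF assms(3)])

lemma decidable_csat_interp:
  assumes "computable n" "computable s" "computable c" "computable i"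
  shows "decidable (\<lambda>x. csat_interp (n x) (s x) (c x) (i x))"
  unfolding csat_interp_def tuple_val_def
  by (intro comp_intros decidable_ceval computable_cmatrix computable_comp[OF assms(1)]
      computable_comp[OF assms(2)] computable_comp[OF assms(3)] computable_comp[OF assms(4)])

text \<open>This is the code of the list of \<open>l\<close> copies of \<open>n\<close>. By
  monotonicity of pairing it dominates the codes of all lists over \<open>{..<n}\<close> of length
  at most \<open>l\<close>.\<close>

primrec list_bound :: "nat \<Rightarrow> nat \<Rightarrow> nat" where
  "list_bound n 0 = 0"
| "list_bound n (Suc l) = Suc (pair n (list_bound n l))"

lemma list_bound_mono: "k \<le> l \<Longrightarrow> list_bound n k \<le> list_bound n l"
proof (induction l)
  case (Suc l)
  have "list_bound n l \<le> list_bound n (Suc l)"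
    using le_pair2[of "list_bound n l" n] by simp
  then show ?case using Suc by (cases "k = Suc l") auto
qed simp

lemma list_encode_le_list_bound: "set xs \<subseteq> {..<n} \<Longrightarrow> list_encode xs \<le> list_bound n (length xs)"
  by (induction xs) (auto intro!: pair_mono)

lemma computable_list_bound:
  assumes "computable n" "computable l" shows "computable (\<lambda>x. list_bound (n x) (l x))"
proof -
  have eq: "list_bound k j = rec_nat 0 (\<lambda>i y. Suc (pair k y)) j" for k j
    by (induction j) simp_all
  show ?thesis unfolding eq
    by (intro comp_intros computable_rec computable_comp[OF assms(1)] assms(2))
qed

text \<open>All indices of bits that are relevant for structures of size at most \<open>m\<close> over the schema with
  code \<open>c\<close> are below this bound.\<close>

definition bit_bound :: "nat \<Rightarrow> nat \<Rightarrow> nat" where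
  "bit_bound c m = Suc (pair c (list_bound m c))"

lemma ex_bit_struct:
  assumes A: "A \<in> structs \<sigma>" "univ A = {..<n}" and n: "n \<le> m"
  shows "\<exists>s<2 ^ bit_bound (list_encode \<sigma>) m. A = bit_struct \<sigma> n s"
proof -
  define f :: "nat \<Rightarrow> nat" where
    "f i = of_bool (\<exists>as. i = pair (pfst i) (list_encode as) \<and> as \<in> rels A ! pfst i)" for i
  have "f i < 2" for i by (simp add: f_def)
  from ex_digits[of "bit_bound (list_encode \<sigma>) m" f, OF this] obtain s where s: "s < 2 ^ bit_bound (list_encode \<sigma>) m"
    "\<And>i. i < bit_bound (list_encode \<sigma>) m \<Longrightarrow> digit 2 s i = f i" by blast
  have len: "length (rels A) = length \<sigma>" and rel: "\<And>r. r < length \<sigma> \<Longrightarrow>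
      rels A ! r \<subseteq> {as. length as = \<sigma> ! r \<and> set as \<subseteq> {..<n}}"
    using A by (auto simp: structs_def list_all2_conv_all_nth)
  have bit: "bit_rel s r (list_encode as) \<longleftrightarrow> as \<in> rels A ! r"
    if "r < length \<sigma>" "length as = \<sigma> ! r" "set as \<subseteq> {..<n}" for r as
  proof -
    \<comment> \<open>The schema code bounds the arities as well as the symbol indices, so it can
      serve in both components of \<open>bit_bound\<close>.\<close>
    have "length as \<le> list_encode \<sigma>"
      using in_set_less_list_encode[of "\<sigma> ! r" \<sigma>] that by simp
    then have "list_encode as \<le> list_bound m (list_encode \<sigma>)"
      using list_encode_le_list_bound[of as m] that(3) n list_bound_mono[of "length as"] le_trans
      by (smt (verit, best) lessThan_subset_iff subset_trans)
    moreover have "r \<le> list_encode \<sigma>" using length_le_list_encode[of \<sigma>] that(1) by linarith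
    ultimately have "pair r (list_encode as) < bit_bound (list_encode \<sigma>) m"
      unfolding bit_bound_def by (simp add: less_Suc_eq_le pair_mono)
    then have "bit_rel s r (list_encode as) \<longleftrightarrow> f (pair r (list_encode as)) = 1"
      using s(2) by (simp add: bit_rel_def)
    also have "\<dots> \<longleftrightarrow> as \<in> rels A ! r"
      unfolding f_def by (auto dest: arg_cong[where f = psnd] simp: list_encode_eq)
    finally show ?thesis .
  qed
  have "A = bit_struct \<sigma> n s"
  proof (rule fstruct.equality)
    show "rels A = rels (bit_struct \<sigma> n s)"
    proof (rule nth_equalityI)
      fix r assume "r < length (rels A)"
      then have r: "r < length \<sigma>" by (simp add: len)
      show "rels A ! r = rels (bit_struct \<sigma> n s) ! r"
        using bit[OF r] rel[OF r] r by (auto simp: bit_struct_def)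
    qed (simp add: bit_struct_def len)
  qed (use A in \<open>auto simp: bit_struct_def\<close>)
  then show ?thesis using s(1) by blast
qed

lemma bit_struct_in_structs: "bit_struct \<sigma> n s \<in> structs \<sigma>"
  by (auto simp: structs_def bit_struct_def list_all2_conv_all_nth)

section \<open>Existential sentences and small witnesses\<close>

fun qvars :: "fm \<Rightarrow> nat set" where
  "qvars (Ex x \<phi>) = insert x (qvars \<phi>)"
| "qvars _ = {}"

lemma finite_qvars [simp]: "finite (qvars \<phi>)"
  by (induction \<phi> rule: qvars.induct) auto

text \<open>Links the evaluator's test for tag 6 to the presence of a quantifier prefix.\<close>

lemma qvars_empty_iff: "qvars \<phi> = {} \<longleftrightarrow> chd (fm_code \<phi>) \<noteq> 6"
  by (cases \<phi>) auto

lemma qvars_less_fm_code: "x \<in> qvars \<phi> \<Longrightarrow> x < fm_code \<phi>"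
proof (induction \<phi> rule: qvars.induct)
  case (1 y \<phi>)
  have "y < fm_code (Ex y \<phi>)" "fm_code \<phi> < fm_code (Ex y \<phi>)"
    by (simp_all del: list_encode_Cons add: in_set_less_list_encode)
  then show ?case using 1 by auto
qed auto

lemma card_qvars: "card (qvars \<phi>) \<le> fm_code \<phi>"
  using card_mono[of "{..<fm_code \<phi>}" "qvars \<phi>"] qvars_less_fm_code by auto

lemma qfree_qvars [simp]: "qfree \<phi> \<Longrightarrow> qvars \<phi> = {}" and qfree_ex_prenex: "qfree \<phi> \<Longrightarrow> ex_prenex \<phi>"
  by (cases \<phi>; simp)+

lemma matrix_cong:
  assumes "wf_fm \<sigma> \<phi>" "ex_prenex \<phi>" "fv \<phi> \<union> qvars \<phi> \<subseteq> X"
    "\<And>r xs. r < length \<sigma> \<Longrightarrow> length xs = \<sigma> ! r \<Longrightarrow> set xs \<subseteq> X \<Longrightarrow> R r xs = R' r xs"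
    "\<And>x y. x \<in> X \<Longrightarrow> y \<in> X \<Longrightarrow> E x y = E' x y"
  shows "matrix R E \<phi> = matrix R' E' \<phi>"
  using assms(1-3)
proof (induction \<phi>)
  case (Ex x \<phi>)
  then show ?case by (auto simp: subset_iff)
qed (use assms(4,5) in \<open>auto simp: qfree_ex_prenex\<close>)

text \<open>Satisfaction of a prenex existential sentence in a structure given by its universe, its
  relations and an interpretation of equality.\<close>

definition exsat :: "'a set \<Rightarrow> (nat \<Rightarrow> 'a list \<Rightarrow> bool) \<Rightarrow> ('a \<Rightarrow> 'a \<Rightarrow> bool) \<Rightarrow> fm \<Rightarrow> bool" where
  "exsat U R E \<phi> \<longleftrightarrow> (\<exists>v. (\<forall>x\<in>qvars \<phi>. v x \<in> U) \<and>
     matrix (\<lambda>r xs. R r (map v xs)) (\<lambda>x y. E (v x) (v y)) \<phi>)"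

lemma sat_qfree:
  "qfree \<phi> \<Longrightarrow> sat A v V \<phi> \<longleftrightarrow> matrix (\<lambda>r xs. map v xs \<in> rels A ! r) (\<lambda>x y. v x = v y) \<phi>"
  by (induction \<phi>) auto

text \<open>The whole prefix is chosen at once. If a variable is bound repeatedly, only its
  innermost binding counts, so a single function \<open>u\<close> suffices, tied to \<open>v\<close>
  just outside the prefix.\<close>

lemma sat_ex_prenex:
  assumes "ex_prenex \<phi>"
  shows "sat A v V \<phi> \<longleftrightarrow> (\<exists>u. (\<forall>x\<in>qvars \<phi>. u x \<in> univ A) \<and> (\<forall>x. x \<notin> qvars \<phi> \<longrightarrow> u x = v x) \<and>
     matrix (\<lambda>r xs. map u xs \<in> rels A ! r) (\<lambda>x y. u x = u y) \<phi>)"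
proof (cases "qfree \<phi>")
  case True
  then have "(\<forall>x. x \<notin> qvars \<phi> \<longrightarrow> u x = v x) \<longleftrightarrow> u = v" for u by auto
  with True show ?thesis by (simp add: sat_qfree)
next
  case False
  with assms show ?thesis
  proof (induction \<phi> arbitrary: v)
    case (Ex x \<phi>)
    let ?M = "\<lambda>u. matrix (\<lambda>r xs. map u xs \<in> rels A ! r) (\<lambda>x y. u x = u y) \<phi>"
    have IH: "sat A v V \<phi> \<longleftrightarrow> (\<exists>u. (\<forall>x\<in>qvars \<phi>. u x \<in> univ A) \<and> (\<forall>x. x \<notin> qvars \<phi> \<longrightarrow> u x = v x) \<and> ?M u)" for v
    proof (cases "qfree \<phi>")
      case True
      then have "(\<forall>x. x \<notin> qvars \<phi> \<longrightarrow> u x = v x) \<longleftrightarrow> u = v" for u by auto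
      with True show ?thesis by (simp add: sat_qfree)
    qed (use Ex in auto)
    show ?case
    proof
      assume "sat A v V (Ex x \<phi>)"
      then obtain a u where "a \<in> univ A" "\<forall>x\<in>qvars \<phi>. u x \<in> univ A"
        "\<forall>y. y \<notin> qvars \<phi> \<longrightarrow> u y = (v(x := a)) y" "?M u" using IH by auto
      then show "\<exists>u. (\<forall>x\<in>qvars (Ex x \<phi>). u x \<in> univ A) \<and> (\<forall>y. y \<notin> qvars (Ex x \<phi>) \<longrightarrow> u y = v y) \<and>
          matrix (\<lambda>r xs. map u xs \<in> rels A ! r) (\<lambda>x y. u x = u y) (Ex x \<phi>)"
        by (intro exI[of _ u]) (auto simp: fun_upd_def split: if_splits)
    next
      assume "\<exists>u. (\<forall>x\<in>qvars (Ex x \<phi>). u x \<in> univ A) \<and> (\<forall>y. y \<notin> qvars (Ex x \<phi>) \<longrightarrow> u y = v y) \<and>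
          matrix (\<lambda>r xs. map u xs \<in> rels A ! r) (\<lambda>x y. u x = u y) (Ex x \<phi>)"
      then obtain u where "\<forall>x\<in>qvars (Ex x \<phi>). u x \<in> univ A"
        "\<forall>y. y \<notin> qvars (Ex x \<phi>) \<longrightarrow> u y = v y" "?M u" by auto
      then have "sat A (v(x := u x)) V \<phi>" "u x \<in> univ A" unfolding IH by auto
      then show "sat A v V (Ex x \<phi>)" by auto
    qed
  qed auto
qed

lemma exfo_sentence_sat:
  assumes "exfo_sentence \<sigma> \<phi>"
  shows "sat A v V \<phi> \<longleftrightarrow> exsat (univ A) (\<lambda>r as. as \<in> rels A ! r) (=) \<phi>"
proof
  assume "sat A v V \<phi>"
  then show "exsat (univ A) (\<lambda>r as. as \<in> rels A ! r) (=) \<phi>"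
    using assms by (auto simp: exsat_def exfo_sentence_def sat_ex_prenex)
next
  assume "exsat (univ A) (\<lambda>r as. as \<in> rels A ! r) (=) \<phi>"
  then obtain u where u: "\<forall>x\<in>qvars \<phi>. u x \<in> univ A"
    "matrix (\<lambda>r xs. map u xs \<in> rels A ! r) (\<lambda>x y. u x = u y) \<phi>" by (auto simp: exsat_def)
  define u' where "u' x = (if x \<in> qvars \<phi> then u x else v x)" for x
  have "matrix (\<lambda>r xs. map u' xs \<in> rels A ! r) (\<lambda>x y. u' x = u' y) \<phi> =
    matrix (\<lambda>r xs. map u xs \<in> rels A ! r) (\<lambda>x y. u x = u y) \<phi>"
  proof (rule matrix_cong)
    fix r and xs :: "nat list" assume "set xs \<subseteq> qvars \<phi>"
    then have "map u' xs = map u xs" by (auto simp: u'_def)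
    then show "(map u' xs \<in> rels A ! r) = (map u xs \<in> rels A ! r)" by (simp only:)
  qed (use assms in \<open>auto simp: exfo_sentence_def sentence_def u'_def\<close>)
  then have "(\<forall>x\<in>qvars \<phi>. u' x \<in> univ A) \<and> (\<forall>x. x \<notin> qvars \<phi> \<longrightarrow> u' x = v x) \<and>
     matrix (\<lambda>r xs. map u' xs \<in> rels A ! r) (\<lambda>x y. u' x = u' y) \<phi>" using u by (auto simp: u'_def)
  then show "sat A v V \<phi>"
    using assms by (subst sat_ex_prenex) (auto simp: exfo_sentence_def)
qed

text \<open>A valuation is composed with \<open>h\<close>. Injectivity is replaced by the
  correspondence of \<open>E\<close> and \<open>E'\<close>, so \<open>h\<close> may be the inverse
  of an embedding, or a quotient map with \<open>E\<close> a congruence and \<open>E'\<close>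
  equality.\<close>

lemma exsat_mono:
  assumes \<phi>: "exfo_sentence \<tau> \<phi>" and sat: "exsat U R E \<phi>" and h: "h ` U \<subseteq> U'"
    and R: "\<And>r as. r < length \<tau> \<Longrightarrow> length as = \<tau> ! r \<Longrightarrow> set as \<subseteq> U \<Longrightarrow> R r as \<longleftrightarrow> R' r (map h as)"
    and E: "\<And>a b. a \<in> U \<Longrightarrow> b \<in> U \<Longrightarrow> E a b \<longleftrightarrow> E' (h a) (h b)"
  shows "exsat U' R' E' \<phi>"
proof -
  from sat obtain v where v: "\<forall>x\<in>qvars \<phi>. v x \<in> U"
    "matrix (\<lambda>r xs. R r (map v xs)) (\<lambda>x y. E (v x) (v y)) \<phi>" by (auto simp: exsat_def)
  have "matrix (\<lambda>r xs. R r (map v xs)) (\<lambda>x y. E (v x) (v y)) \<phi> =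
    matrix (\<lambda>r xs. R' r (map (h \<circ> v) xs)) (\<lambda>x y. E' ((h \<circ> v) x) ((h \<circ> v) y)) \<phi>"
  proof (rule matrix_cong)
    fix r and xs :: "nat list" assume "set xs \<subseteq> qvars \<phi>" "r < length \<tau>" "length xs = \<tau> ! r"
    then show "R r (map v xs) = R' r (map (h \<circ> v) xs)"
      using v(1) R[of r "map v xs"] by (auto simp: subset_iff)
  qed (use \<phi> v(1) E in \<open>auto simp: exfo_sentence_def sentence_def\<close>)
  with v have "(\<forall>x\<in>qvars \<phi>. (h \<circ> v) x \<in> U') \<and>
     matrix (\<lambda>r xs. R' r (map (h \<circ> v) xs)) (\<lambda>x y. E' ((h \<circ> v) x) ((h \<circ> v) y)) \<phi>"
    using h by auto
  then show ?thesis unfolding exsat_def by blast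
qed

lemma exsat_surj:
  assumes \<phi>: "exfo_sentence \<tau> \<phi>" and h: "h ` U = U'"
    and R: "\<And>r as. r < length \<tau> \<Longrightarrow> length as = \<tau> ! r \<Longrightarrow> set as \<subseteq> U \<Longrightarrow> R r as \<longleftrightarrow> R' r (map h as)"
    and E: "\<And>a b. a \<in> U \<Longrightarrow> b \<in> U \<Longrightarrow> E a b \<longleftrightarrow> E' (h a) (h b)"
  shows "exsat U R E \<phi> \<longleftrightarrow> exsat U' R' E' \<phi>"
proof
  assume "exsat U R E \<phi>"
  then show "exsat U' R' E' \<phi>" by (rule exsat_mono[OF \<phi>]) (use h R E in auto)
next
  assume "exsat U' R' E' \<phi>"
  then show "exsat U R E \<phi>"
  proof (rule exsat_mono[OF \<phi>, where h = "inv_into U h"])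
    show "inv_into U h ` U' \<subseteq> U" using h by (auto intro: inv_into_into)
    fix r as assume "r < length \<tau>" "length as = \<tau> ! r" and as: "set as \<subseteq> U'"
    moreover have "map h (map (inv_into U h) as) = as"
      using as h by (auto intro!: map_idI simp: f_inv_into_f)
    moreover have "set (map (inv_into U h) as) \<subseteq> U" using as h by (auto intro: inv_into_into)
    ultimately show "R' r as = R r (map (inv_into U h) as)" using R[of r "map (inv_into U h) as"] by simp
  next
    fix a b assume "a \<in> U'" "b \<in> U'"
    then show "E' a b = E (inv_into U h a) (inv_into U h b)"
      using E[of "inv_into U h a" "inv_into U h b"] h by (auto simp: inv_into_into f_inv_into_f)
  qed
qed

text \<open>The values of the prefix variables suffice, and the code of the sentence is a crude
  bound on their number that an algorithm has at hand.\<close>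

lemma exsat_bounded:
  assumes "exsat U R E \<phi>"
  shows "\<exists>X\<subseteq>U. finite X \<and> card X \<le> fm_code \<phi> \<and> exsat X R E \<phi>"
proof -
  from assms obtain v where v: "\<forall>x\<in>qvars \<phi>. v x \<in> U"
    "matrix (\<lambda>r xs. R r (map v xs)) (\<lambda>x y. E (v x) (v y)) \<phi>" by (auto simp: exsat_def)
  have "card (v ` qvars \<phi>) \<le> fm_code \<phi>"
    using card_image_le[of "qvars \<phi>" v] card_qvars[of \<phi>] by simp
  then show ?thesis
    using v by (intro exI[of _ "v ` qvars \<phi>"]) (auto simp: exsat_def)
qed

text \<open>Prepares the coding by digits, which assigns a value to every variable below the code
  and not just to the prefix. With a prefix, the other variables repeat the value of some prefix
  variable; without one, the universe may be empty and \<open>c\<close> is a free default.\<close>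

lemma exsat_total:
  assumes \<phi>: "exfo_sentence \<tau> \<phi>" and sat: "exsat U R E \<phi>"
  shows "\<exists>v. (qvars \<phi> \<noteq> {} \<longrightarrow> (\<forall>x. v x \<in> U)) \<and> (qvars \<phi> = {} \<longrightarrow> (\<forall>x. v x = c)) \<and>
     matrix (\<lambda>r xs. R r (map v xs)) (\<lambda>x y. E (v x) (v y)) \<phi>"
proof -
  from sat obtain v where v: "\<forall>x\<in>qvars \<phi>. v x \<in> U"
    "matrix (\<lambda>r xs. R r (map v xs)) (\<lambda>x y. E (v x) (v y)) \<phi>" by (auto simp: exsat_def)
  define u where "u x = (if qvars \<phi> = {} then c else if x \<in> qvars \<phi> then v x else v (SOME x. x \<in> qvars \<phi>))" for x
  have "(SOME x. x \<in> qvars \<phi>) \<in> qvars \<phi>" if "qvars \<phi> \<noteq> {}" using that by (simp add: some_in_eq)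
  then have "qvars \<phi> \<noteq> {} \<longrightarrow> (\<forall>x. u x \<in> U)" "qvars \<phi> = {} \<longrightarrow> (\<forall>x. u x = c)" using v(1) by (auto simp: u_def)
  moreover have "matrix (\<lambda>r xs. R r (map u xs)) (\<lambda>x y. E (u x) (u y)) \<phi> =
    matrix (\<lambda>r xs. R r (map v xs)) (\<lambda>x y. E (v x) (v y)) \<phi>"
  proof (rule matrix_cong)
    fix r and xs :: "nat list" assume "set xs \<subseteq> qvars \<phi>"
    then have "map u xs = map v xs" by (auto simp: u_def)
    then show "R r (map u xs) = R r (map v xs)" by (simp only:)
  qed (use \<phi> in \<open>auto simp: exfo_sentence_def sentence_def u_def\<close>)
  ultimately show ?thesis using v(2) by blast
qed

definition isat :: "interp \<Rightarrow> fm \<Rightarrow> nat fstruct \<Rightarrow> bool" where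
  "isat \<Psi> \<psi> A = exsat (hat_univ \<Psi> A) (\<lambda>r as. holds A (phi_rels \<Psi> ! r) (concat as))
     (\<lambda>a b. holds A (phi_eq \<Psi>) (a @ b)) \<psi>"

definition dsat :: "fm \<Rightarrow> nat fstruct \<Rightarrow> bool" where
  "dsat \<phi> A = exsat (univ A) (\<lambda>r as. as \<in> rels A ! r) (=) \<phi>"

lemma finite_hat_univ: "finite (univ A) \<Longrightarrow> finite (hat_univ \<Psi> A)"
  unfolding hat_univ_def by (rule finite_subset[OF _ finite_lists_length_eq[of "univ A" "dim \<Psi>"]]) auto

lemma interpret_struct_in_structs:
  assumes "qf_interp \<sigma> \<tau> \<Psi>" "A \<in> structs \<sigma>"
  shows "interpret_struct \<tau> \<Psi> A \<in> structs \<tau>"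
proof -
  have "finite (hat_univ \<Psi> A)" using assms(2) by (auto simp: structs_def intro: finite_hat_univ)
  moreover have "length (phi_rels \<Psi>) = length \<tau>"
    using assms(1) by (auto simp: qf_interp_def dest: list_all2_lengthD)
  ultimately show ?thesis
    by (auto simp: interpret_struct_def quot_def hat_def structs_def list_all2_conv_all_nth hat_rel_def
        quotient_def subset_iff) blast
qed

lemma interpret_struct_sat:
  assumes \<Psi>: "qf_interp \<sigma> \<tau> \<Psi>" and A: "A \<in> structs \<sigma>" and \<psi>: "exfo_sentence \<tau> \<psi>"
  shows "interpret_struct \<tau> \<Psi> A \<in> models (structs \<tau>) \<psi> \<longleftrightarrow> isat \<Psi> \<psi> A"
proof -
  let ?E = "hat_eq \<Psi> A" and ?H = "hat \<tau> \<Psi> A" and ?I = "interpret_struct \<tau> \<Psi> A"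
  have cong: "congruence ?H ?E" using \<Psi> A by (auto simp: qf_interp_def)
  then have equiv: "equiv (hat_univ \<Psi> A) ?E" by (simp add: congruence_def hat_def)
  have len: "length (phi_rels \<Psi>) = length \<tau>"
    using \<Psi> by (auto simp: qf_interp_def dest: list_all2_lengthD)
  have "isat \<Psi> \<psi> A \<longleftrightarrow> exsat (univ ?I) (\<lambda>r as. as \<in> rels ?I ! r) (=) \<psi>"
    unfolding isat_def
  proof (rule exsat_surj[OF \<psi>])
    show "(\<lambda>a. ?E `` {a}) ` hat_univ \<Psi> A = univ ?I"
      by (auto simp: interpret_struct_def quot_def hat_def quotient_def)
    fix a b assume ab: "a \<in> hat_univ \<Psi> A" "b \<in> hat_univ \<Psi> A"
    then have "?E `` {a} = ?E `` {b} \<longleftrightarrow> (a, b) \<in> ?E" using equiv by (simp add: eq_equiv_class_iff)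
    then show "holds A (phi_eq \<Psi>) (a @ b) = (?E `` {a} = ?E `` {b})" using ab by (simp add: hat_eq_def)
  next
    fix r as assume r: "r < length \<tau>" and as: "length as = \<tau> ! r" "set as \<subseteq> hat_univ \<Psi> A"
    let ?R = "rels ?H ! r" and ?c = "map (\<lambda>a. ?E `` {a})"
    have R: "?R = hat_rel \<Psi> A (\<tau> ! r) (phi_rels \<Psi> ! r)" using r len by (simp add: hat_def)
    have RH: "?R \<in> set (rels ?H)" using r len by (intro nth_mem) (simp add: hat_def)
    have "holds A (phi_rels \<Psi> ! r) (concat as) \<longleftrightarrow> as \<in> ?R" using as by (auto simp: R hat_rel_def)
    \<comment> \<open>The congruence property enters here: a tuple that is entrywise equivalent to
      one in \<open>?R\<close> is itself in \<open>?R\<close>, so passing to classes adds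
      nothing.\<close>
    also have "\<dots> \<longleftrightarrow> ?c as \<in> ?c ` ?R"
    proof
      assume "?c as \<in> ?c ` ?R"
      then obtain bs where bs: "bs \<in> ?R" "?c as = ?c bs" by auto
      have "set bs \<subseteq> hat_univ \<Psi> A" using bs(1) by (auto simp: R hat_rel_def)
      have "list_all2 (\<lambda>a b. (a, b) \<in> ?E) bs as"
        unfolding list_all2_conv_all_nth
      proof (intro conjI allI impI)
        show "length bs = length as" using bs(2) map_eq_imp_length_eq by metis
        fix i assume i: "i < length bs"
        then have "?E `` {bs ! i} = ?E `` {as ! i}"
          using bs(2) \<open>length bs = length as\<close> by (metis nth_map)
        moreover have "bs ! i \<in> hat_univ \<Psi> A" "as ! i \<in> hat_univ \<Psi> A"
          using i \<open>length bs = length as\<close> as(2) \<open>set bs \<subseteq> hat_univ \<Psi> A\<close> by auto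
        ultimately show "(bs ! i, as ! i) \<in> ?E" using equiv by (simp add: eq_equiv_class_iff)
      qed
      then show "as \<in> ?R" using cong RH bs(1) unfolding congruence_def by blast
    qed blast
    also have "?c ` ?R = rels ?I ! r"
      using r len by (simp add: interpret_struct_def quot_def hat_def)
    finally show "holds A (phi_rels \<Psi> ! r) (concat as) \<longleftrightarrow> ?c as \<in> rels ?I ! r" .
  qed
  then show ?thesis
    using interpret_struct_in_structs[OF \<Psi> A] by (simp add: models_def exfo_sentence_sat[OF \<psi>])
qed

lemma models_dsat: "exfo_sentence \<sigma> \<phi> \<Longrightarrow> A \<in> D \<Longrightarrow> A \<in> models D \<phi> \<longleftrightarrow> dsat \<phi> A"
  by (simp add: models_def exfo_sentence_sat dsat_def)

section \<open>Embeddings and small witnesses\<close>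

definition emb :: "schema \<Rightarrow> (nat \<Rightarrow> nat) \<Rightarrow> nat fstruct \<Rightarrow> nat fstruct \<Rightarrow> bool" where
  "emb \<sigma> h A B \<longleftrightarrow> inj_on h (univ A) \<and> h ` univ A \<subseteq> univ B \<and>
    (\<forall>r<length \<sigma>. \<forall>as. set as \<subseteq> univ A \<longrightarrow> (as \<in> rels A ! r \<longleftrightarrow> map h as \<in> rels B ! r))"

lemma sat_emb:
  assumes "emb \<sigma> h A B" "qfree \<theta>" "wf_fm \<sigma> \<theta>" "\<forall>x\<in>fv \<theta>. v x \<in> univ A \<and> v' x = h (v x)"
  shows "sat A v V \<theta> \<longleftrightarrow> sat B v' V' \<theta>"
  using assms(2-)
proof (induction \<theta>)
  case (Rel r xs)
  then have eq: "map v' xs = map h (map v xs)" and r: "r < length \<sigma>" and "set (map v xs) \<subseteq> univ A" by auto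
  then have "map v xs \<in> rels A ! r \<longleftrightarrow> map h (map v xs) \<in> rels B ! r"
    using assms(1) unfolding emb_def by blast
  then show ?case by (simp only: sat.simps eq)
next
  case (Eq x y)
  then show ?case using assms(1) by (auto simp: emb_def inj_on_def)
qed auto

lemma holds_emb:
  assumes "emb \<sigma> h A B" "qf_fm \<sigma> (length a) \<theta>" "set a \<subseteq> univ A"
  shows "holds A \<theta> a \<longleftrightarrow> holds B \<theta> (map h a)"
  unfolding holds_def
proof (rule sat_emb[OF assms(1)])
  show "\<forall>x\<in>fv \<theta>. a ! x \<in> univ A \<and> map h a ! x = h (a ! x)"
    using assms(2,3) by (auto simp: qf_fm_def subset_iff)
qed (use assms in \<open>auto simp: qf_fm_def\<close>)

lemma hat_univ_emb:
  assumes "emb \<sigma> h A B" "qf_interp \<sigma> \<tau> \<Psi>" "set a \<subseteq> univ A"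
  shows "a \<in> hat_univ \<Psi> A \<longleftrightarrow> map h a \<in> hat_univ \<Psi> B"
  using assms holds_emb[OF assms(1) _ assms(3), of "phi_univ \<Psi>"]
  by (auto simp: hat_univ_def qf_interp_def emb_def)

text \<open>Embeddings take the place of substructures.\<close>

definition small_witness :: "schema \<Rightarrow> nat \<Rightarrow> (nat fstruct \<Rightarrow> bool) \<Rightarrow> bool" where
  "small_witness \<sigma> N C \<longleftrightarrow>
     (\<forall>A\<in>structs \<sigma>. \<forall>B\<in>structs \<sigma>. \<forall>h. emb \<sigma> h A B \<and> C A \<longrightarrow> C B) \<and>
     (\<forall>B\<in>structs \<sigma>. C B \<longrightarrow> (\<exists>X\<subseteq>univ B. finite X \<and> card X \<le> N \<and>
        (\<forall>A\<in>structs \<sigma>. \<forall>h. emb \<sigma> h A B \<and> X \<subseteq> h ` univ A \<longrightarrow> C A)))"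

lemma small_witness_mono: "small_witness \<sigma> M C \<Longrightarrow> M \<le> N \<Longrightarrow> small_witness \<sigma> N C"
  unfolding small_witness_def by (meson le_trans)

lemma small_witness_dsat:
  assumes \<phi>: "exfo_sentence \<sigma> \<phi>"
  shows "small_witness \<sigma> (fm_code \<phi>) (dsat \<phi>)"
  unfolding small_witness_def
proof (intro conjI ballI allI impI)
  fix A B h assume h: "emb \<sigma> h A B \<and> dsat \<phi> A"
  then have "exsat (univ A) (\<lambda>r as. as \<in> rels A ! r) (=) \<phi>" by (simp add: dsat_def)
  then show "dsat \<phi> B" unfolding dsat_def
  proof (rule exsat_mono[OF \<phi>, where h = h])
    show "a = b \<longleftrightarrow> h a = h b" if "a \<in> univ A" "b \<in> univ A" for a b
      using h that by (auto simp: emb_def inj_on_def)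
  qed (use h in \<open>simp_all add: emb_def\<close>)
next
  fix B assume "dsat \<phi> B"
  from exsat_bounded[OF this[unfolded dsat_def]]
  obtain X where X: "X \<subseteq> univ B" "finite X" "card X \<le> fm_code \<phi>"
    "exsat X (\<lambda>r as. as \<in> rels B ! r) (=) \<phi>" by blast
  show "\<exists>X\<subseteq>univ B. finite X \<and> card X \<le> fm_code \<phi> \<and>
     (\<forall>A\<in>structs \<sigma>. \<forall>h. emb \<sigma> h A B \<and> X \<subseteq> h ` univ A \<longrightarrow> dsat \<phi> A)"
  proof (intro exI[of _ X] conjI ballI allI impI X)
    fix A h assume h: "emb \<sigma> h A B \<and> X \<subseteq> h ` univ A"
    let ?g = "inv_into (univ A) h"
    have g: "?g a \<in> univ A" "h (?g a) = a" if "a \<in> X" for a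
      using h that by (auto intro: inv_into_into simp: f_inv_into_f subset_iff)
    show "dsat \<phi> A" unfolding dsat_def
    proof (rule exsat_mono[OF \<phi> X(4), of ?g])
      fix r as assume "r < length \<sigma>" "length as = \<sigma> ! r" and as: "set as \<subseteq> X"
      moreover have "map h (map ?g as) = as" using as g by (auto intro!: map_idI)
      moreover have "set (map ?g as) \<subseteq> univ A" using as g by auto
      ultimately show "(as \<in> rels B ! r) = (map ?g as \<in> rels A ! r)"
        using h unfolding emb_def by metis
    qed (use g in \<open>auto, metis\<close>)
  qed
qed

text \<open>The witness is a set of tuples, and \<open>X\<close> consists of their entries, whence
  the factor \<open>dim \<Psi>\<close>. Pulled back along \<open>h\<close>, the tuples still belong
  to the universe of the interpretation, because its defining formula is quantifier-free.\<close>

lemma small_witness_isat: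
  assumes \<Psi>: "qf_interp \<sigma> \<tau> \<Psi>" and \<psi>: "exfo_sentence \<tau> \<psi>"
  shows "small_witness \<sigma> (fm_code \<psi> * dim \<Psi>) (isat \<Psi> \<psi>)"
proof -
  have rels: "qf_fm \<sigma> (\<tau> ! r * dim \<Psi>) (phi_rels \<Psi> ! r)" if "r < length \<tau>" for r
    using \<Psi> that by (auto simp: qf_interp_def list_all2_conv_all_nth)
  have eq: "qf_fm \<sigma> (2 * dim \<Psi>) (phi_eq \<Psi>)" using \<Psi> by (simp add: qf_interp_def)
  have len: "length (concat as) = length as * dim \<Psi>" if "set as \<subseteq> hat_univ \<Psi> A" for as A
    using that by (induction as) (auto simp: hat_univ_def)
  have R: "holds A (phi_rels \<Psi> ! r) (concat as) \<longleftrightarrow> holds B (phi_rels \<Psi> ! r) (concat (map (map h) as))"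
    if "emb \<sigma> h A B" "r < length \<tau>" "length as = \<tau> ! r" "set as \<subseteq> hat_univ \<Psi> A" for h A B r as
  proof -
    have "qf_fm \<sigma> (length (concat as)) (phi_rels \<Psi> ! r)"
      using rels[OF that(2)] len[OF that(4)] that(3) by (simp only:)
    moreover have "set (concat as) \<subseteq> univ A" using that(4) by (auto simp: hat_univ_def)
    ultimately show ?thesis using holds_emb[OF that(1)] by (simp only: map_concat)
  qed
  have E: "holds A (phi_eq \<Psi>) (a @ b) \<longleftrightarrow> holds B (phi_eq \<Psi>) (map h a @ map h b)"
    if "emb \<sigma> h A B" "a \<in> hat_univ \<Psi> A" "b \<in> hat_univ \<Psi> A" for h A B a b
    using holds_emb[OF that(1), of "a @ b"] eq that by (auto simp: hat_univ_def mult_2)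
  have U: "map h a \<in> hat_univ \<Psi> B" if "emb \<sigma> h A B" "a \<in> hat_univ \<Psi> A" for h A B a
    using hat_univ_emb[OF that(1) \<Psi>, of a] that(2) by (auto simp: hat_univ_def)
  show ?thesis unfolding small_witness_def
  proof (intro conjI ballI allI impI)
    fix A B h assume h: "emb \<sigma> h A B \<and> isat \<Psi> \<psi> A"
    then have "exsat (hat_univ \<Psi> A) (\<lambda>r as. holds A (phi_rels \<Psi> ! r) (concat as))
      (\<lambda>a b. holds A (phi_eq \<Psi>) (a @ b)) \<psi>" by (simp add: isat_def)
    then show "isat \<Psi> \<psi> B" unfolding isat_def
      by (rule exsat_mono[OF \<psi>, where h = "map h"]) (use h U R E in auto)
  next
    fix B assume "isat \<Psi> \<psi> B"
    from exsat_bounded[OF this[unfolded isat_def]]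
    obtain Y where Y: "Y \<subseteq> hat_univ \<Psi> B" "finite Y" "card Y \<le> fm_code \<psi>"
      "exsat Y (\<lambda>r as. holds B (phi_rels \<Psi> ! r) (concat as)) (\<lambda>a b. holds B (phi_eq \<Psi>) (a @ b)) \<psi>"
      by blast
    let ?X = "\<Union>(set ` Y)"
    have "card ?X \<le> (\<Sum>a\<in>Y. card (set a))" using Y(2) by (rule card_UN_le)
    also have "\<dots> \<le> (\<Sum>a\<in>Y. dim \<Psi>)"
    proof (rule sum_mono)
      fix a assume "a \<in> Y"
      then have "length a = dim \<Psi>" using Y(1) by (auto simp: hat_univ_def)
      then show "card (set a) \<le> dim \<Psi>" using card_length[of a] by simp
    qed
    also have "\<dots> \<le> fm_code \<psi> * dim \<Psi>" using Y(3) by simp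
    finally have cX: "card ?X \<le> fm_code \<psi> * dim \<Psi>" .
    show "\<exists>X\<subseteq>univ B. finite X \<and> card X \<le> fm_code \<psi> * dim \<Psi> \<and>
       (\<forall>A\<in>structs \<sigma>. \<forall>h. emb \<sigma> h A B \<and> X \<subseteq> h ` univ A \<longrightarrow> isat \<Psi> \<psi> A)"
    proof (intro exI[of _ ?X] conjI ballI allI impI cX)
      show "?X \<subseteq> univ B" using Y(1) by (auto simp: hat_univ_def)
      show "finite ?X" using Y(2) by simp
      fix A h assume h: "emb \<sigma> h A B \<and> ?X \<subseteq> h ` univ A"
      let ?g = "inv_into (univ A) h"
      have g: "map h (map ?g a) = a" "set (map ?g a) \<subseteq> univ A" if "a \<in> Y" for a
      proof -
        have "x \<in> h ` univ A" if "x \<in> set a" for x using h \<open>a \<in> Y\<close> that by blast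
        then show "map h (map ?g a) = a" "set (map ?g a) \<subseteq> univ A"
          by (auto simp: f_inv_into_f inv_into_into intro!: map_idI)
      qed
      then have gU: "map ?g a \<in> hat_univ \<Psi> A" if "a \<in> Y" for a
        using h Y(1) that hat_univ_emb[OF _ \<Psi>, of h A B "map ?g a"] by auto
      show "isat \<Psi> \<psi> A" unfolding isat_def
      proof (rule exsat_mono[OF \<psi> Y(4), of "map ?g"])
        fix r as assume r: "r < length \<tau>" "length as = \<tau> ! r" and as: "set as \<subseteq> Y"
        have "map (map h) (map (map ?g) as) = as" using as by (induction as) (simp_all add: g(1) del: map_map)
        moreover have "set (map (map ?g) as) \<subseteq> hat_univ \<Psi> A" using as gU by auto
        ultimately show "holds B (phi_rels \<Psi> ! r) (concat as) =
            holds A (phi_rels \<Psi> ! r) (concat (map (map ?g) as))"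
          using R[of h A B r "map (map ?g) as"] h r by simp
      next
        fix a b assume "a \<in> Y" "b \<in> Y"
        then show "holds B (phi_eq \<Psi>) (a @ b) = holds A (phi_eq \<Psi>) (map ?g a @ map ?g b)"
          using E[of h A B "map ?g a" "map ?g b"] h gU g(1) by (simp del: map_map)
      qed (use gU in auto)
    qed
  qed
qed

text \<open>Pulling back along \<open>h\<close>, instead of restricting to a subset, makes the
  universe an initial segment, so that the result is equal and not merely isomorphic to a coded
  structure.\<close>

definition induced :: "(nat \<Rightarrow> nat) \<Rightarrow> nat \<Rightarrow> nat fstruct \<Rightarrow> nat fstruct" where
  "induced h n B = \<lparr>univ = {..<n}, rels = map (\<lambda>R. {as. set as \<subseteq> {..<n} \<and> map h as \<in> R}) (rels B)\<rparr>"

lemma induced_in_structs: "B \<in> structs \<sigma> \<Longrightarrow> induced h n B \<in> structs \<sigma>"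
  by (fastforce simp: structs_def induced_def list_all2_conv_all_nth)

lemma emb_induced:
  assumes "B \<in> structs \<sigma>" "inj_on h {..<n}" "h ` {..<n} \<subseteq> univ B"
  shows "emb \<sigma> h (induced h n B) B"
  using assms by (auto simp: emb_def induced_def structs_def dest: list_all2_lengthD)

text \<open>The witness of a counterexample to \<open>C \<subseteq> C'\<close> is itself a counterexample, since \<open>C'\<close> is closed
  under extensions.\<close>

lemma small_witness_subset:
  assumes C: "small_witness \<sigma> N C" "small_witness \<sigma> N C'"
    and D: "D \<subseteq> structs \<sigma>" "\<And>B h n. B \<in> D \<Longrightarrow> inj_on h {..<n} \<Longrightarrow> h ` {..<n} \<subseteq> univ B \<Longrightarrow> induced h n B \<in> D"
    and small: "\<And>n s. n \<le> N \<Longrightarrow> s < 2 ^ bit_bound (list_encode \<sigma>) N \<Longrightarrow> bit_struct \<sigma> n s \<in> D \<Longrightarrow>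
      C (bit_struct \<sigma> n s) \<Longrightarrow> C' (bit_struct \<sigma> n s)"
    and B: "B \<in> D" "C B"
  shows "C' B"
proof -
  have BS: "B \<in> structs \<sigma>" using B D(1) by blast
  then obtain X where X: "X \<subseteq> univ B" "finite X" "card X \<le> N"
    "\<And>A h. A \<in> structs \<sigma> \<Longrightarrow> emb \<sigma> h A B \<Longrightarrow> X \<subseteq> h ` univ A \<Longrightarrow> C A"
    using C(1) B(2) unfolding small_witness_def by meson
  define n where "n = card X"
  obtain h where h: "bij_betw h {..<n} X"
    using ex_bij_betw_nat_finite[OF X(2)] by (auto simp: n_def atLeast0LessThan)
  let ?A = "induced h n B"
  have hh: "inj_on h {..<n}" "h ` {..<n} \<subseteq> univ B" using h X(1) by (auto simp: bij_betw_def)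
  have A: "?A \<in> D" "?A \<in> structs \<sigma>" using D B(1) hh by auto
  have e: "emb \<sigma> h ?A B" using emb_induced[OF BS hh] .
  have "univ ?A = {..<n}" by (simp add: induced_def)
  then obtain s where s: "s < 2 ^ bit_bound (list_encode \<sigma>) N" "?A = bit_struct \<sigma> n s"
    using ex_bit_struct[OF A(2)] X(3) unfolding n_def by blast
  have "C ?A" using X(4)[OF A(2) e] h by (simp add: induced_def bij_betw_def)
  then have "C' ?A" using small[of n s] s A(1) X(3) by (simp add: n_def)
  then show ?thesis using C(2) A(2) BS e unfolding small_witness_def by blast
qed

text \<open>The domain \<open>D\<close> is a parameter because the criterion is applied both to all
  structures and to the graphs, which are likewise closed under induced substructures.\<close>

lemma small_witness_eq:
  assumes "small_witness \<sigma> N C" "small_witness \<sigma> N C'" "D \<subseteq> structs \<sigma>"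
    and "\<And>B h n. B \<in> D \<Longrightarrow> inj_on h {..<n} \<Longrightarrow> h ` {..<n} \<subseteq> univ B \<Longrightarrow> induced h n B \<in> D"
  shows "(\<forall>A\<in>D. C A \<longleftrightarrow> C' A) \<longleftrightarrow> (\<forall>n<Suc N. \<forall>s<2 ^ bit_bound (list_encode \<sigma>) N.
     bit_struct \<sigma> n s \<in> D \<longrightarrow> (C (bit_struct \<sigma> n s) \<longleftrightarrow> C' (bit_struct \<sigma> n s)))"
proof
  assume R: "\<forall>n<Suc N. \<forall>s<2 ^ bit_bound (list_encode \<sigma>) N.
     bit_struct \<sigma> n s \<in> D \<longrightarrow> (C (bit_struct \<sigma> n s) \<longleftrightarrow> C' (bit_struct \<sigma> n s))"
  show "\<forall>A\<in>D. C A \<longleftrightarrow> C' A"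
  proof (intro ballI iffI)
    fix A assume A: "A \<in> D" "C A"
    show "C' A"
      by (rule small_witness_subset[OF assms(1-3)]) (use A R assms(4) in \<open>simp_all add: less_Suc_eq_le\<close>)
  next
    fix A assume A: "A \<in> D" "C' A"
    show "C A"
      by (rule small_witness_subset[OF assms(2,1,3)]) (use A R assms(4) in \<open>simp_all add: less_Suc_eq_le\<close>)
  qed
qed auto

section \<open>Correctness of the coded evaluation\<close>

lemma univ_bit_struct [simp]: "univ (bit_struct \<sigma> n s) = {..<n}"
  by (simp add: bit_struct_def)

lemma rels_bit_struct: "r < length \<sigma> \<Longrightarrow> as \<in> rels (bit_struct \<sigma> n s) ! r \<longleftrightarrow>
    length as = \<sigma> ! r \<and> set as \<subseteq> {..<n} \<and> bit_rel s r (list_encode as)"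
  by (simp add: bit_struct_def)

lemma ceval_fm_code:
  "ceval s f (fm_code \<phi>) \<longleftrightarrow> matrix (\<lambda>r xs. bit_rel s r (list_encode (map f xs))) (\<lambda>x y. f x = f y) \<phi>"
  by (simp add: ceval_def cmatrix_fm_code)

lemma ceval_bit_struct:
  assumes "wf_fm \<sigma> \<phi>" "ex_prenex \<phi>" "fv \<phi> \<union> qvars \<phi> \<subseteq> X" "\<And>x. x \<in> X \<Longrightarrow> f x = v x \<and> v x < n"
  shows "ceval s f (fm_code \<phi>) \<longleftrightarrow>
    matrix (\<lambda>r xs. map v xs \<in> rels (bit_struct \<sigma> n s) ! r) (\<lambda>x y. v x = v y) \<phi>"
  unfolding ceval_fm_code
proof (rule matrix_cong[OF assms(1-3)])
  fix r and xs :: "nat list" assume r: "r < length \<sigma>" "length xs = \<sigma> ! r" and xs: "set xs \<subseteq> X"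
  then have "map f xs = map v xs" "set (map v xs) \<subseteq> {..<n}" using assms(4) by auto
  with r show "bit_rel s r (list_encode (map f xs)) = (map v xs \<in> rels (bit_struct \<sigma> n s) ! r)"
    by (simp only: rels_bit_struct length_map simp_thms)
qed (use assms(4) in auto)

lemma csat_iff_dsat:
  assumes \<phi>: "exfo_sentence \<sigma> \<phi>"
  shows "csat n s (fm_code \<phi>) \<longleftrightarrow> dsat \<phi> (bit_struct \<sigma> n s)"
proof -
  have wf: "wf_fm \<sigma> \<phi>" "ex_prenex \<phi>" "fv \<phi> \<union> qvars \<phi> \<subseteq> qvars \<phi>"
    using \<phi> by (auto simp: exfo_sentence_def sentence_def)
  show ?thesis
  proof
    assume "csat n s (fm_code \<phi>)"
    then obtain w where w: "chd (fm_code \<phi>) = 6 \<longrightarrow> (\<forall>x<fm_code \<phi>. digit (Suc n) w x < n)"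
      "ceval s (digit (Suc n) w) (fm_code \<phi>)" by (auto simp: csat_def)
    have v: "digit (Suc n) w x < n" if "x \<in> qvars \<phi>" for x
      using w(1) that qvars_empty_iff[of \<phi>] qvars_less_fm_code[OF that] by auto
    then show "dsat \<phi> (bit_struct \<sigma> n s)"
      using ceval_bit_struct[OF wf, of "digit (Suc n) w" "digit (Suc n) w" n s] w(2)
      unfolding dsat_def exsat_def by (intro exI[of _ "digit (Suc n) w"]) auto
  next
    assume "dsat \<phi> (bit_struct \<sigma> n s)"
    \<comment> \<open>The default 0 is a legal digit in base \<open>Suc n\<close> even when the
      universe is empty.\<close>
    from exsat_total[OF \<phi> this[unfolded dsat_def], of 0]
    obtain v where v: "qvars \<phi> \<noteq> {} \<longrightarrow> (\<forall>x. v x \<in> {..<n})" "qvars \<phi> = {} \<longrightarrow> (\<forall>x. v x = 0)"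
      and m: "matrix (\<lambda>r xs. map v xs \<in> rels (bit_struct \<sigma> n s) ! r) (\<lambda>x y. v x = v y) \<phi>"
      by auto
    have "v x < Suc n" for x using v by (cases "qvars \<phi> = {}") (auto simp: less_Suc_eq)
    then obtain w where w: "w < Suc n ^ fm_code \<phi>" "\<forall>x<fm_code \<phi>. digit (Suc n) w x = v x"
      using ex_digits[of "fm_code \<phi>" v "Suc n"] by blast
    have "ceval s (digit (Suc n) w) (fm_code \<phi>)"
      using ceval_bit_struct[OF wf, of "digit (Suc n) w" v n s] m v(1) w(2) qvars_less_fm_code by fastforce
    moreover have "chd (fm_code \<phi>) = 6 \<longrightarrow> (\<forall>x<fm_code \<phi>. digit (Suc n) w x < n)"
      using v(1) w(2) qvars_empty_iff[of \<phi>] by auto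
    ultimately show "csat n s (fm_code \<phi>)" using w(1) by (auto simp: csat_def)
  qed
qed

lemma ceval_iff_holds:
  assumes "qf_fm \<sigma> (length a) \<theta>" "\<And>y. y < length a \<Longrightarrow> f y = a ! y" "set a \<subseteq> {..<n}"
  shows "ceval s f (fm_code \<theta>) \<longleftrightarrow> holds (bit_struct \<sigma> n s) \<theta> a"
proof -
  have "qfree \<theta>" using assms(1) by (simp add: qf_fm_def)
  then show ?thesis unfolding holds_def
    using assms ceval_bit_struct[of \<sigma> \<theta> "{..<length a}" f "(!) a" n s]
    by (auto simp: sat_qfree qf_fm_def qfree_ex_prenex subset_iff)
qed

lemma nth_concat_map:
  assumes "\<And>x. length (g x) = d"
  shows "y < length xs * d \<Longrightarrow> concat (map g xs) ! y = g (xs ! (y div d)) ! (y mod d)"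
proof (induction xs arbitrary: y)
  case (Cons x xs)
  show ?case
  proof (cases "y < d")
    case False
    moreover have "0 < d" using Cons.prems by (cases d) auto
    ultimately have "y div d = Suc ((y - d) div d)" "y mod d = (y - d) mod d"
      by (simp_all add: le_div_geq le_mod_geq)
    then show ?thesis using Cons False assms by (simp add: nth_append)
  qed (use assms in \<open>simp add: nth_append\<close>)
qed simp

definition tuple_of :: "nat \<Rightarrow> nat \<Rightarrow> nat \<Rightarrow> nat \<Rightarrow> nat list" where
  "tuple_of n w d x = map (\<lambda>j. digit (Suc n) w (x * d + j)) [0..<d]"

lemma length_tuple_of [simp]: "length (tuple_of n w d x) = d"
  by (simp add: tuple_of_def)

lemma length_concat_tuple_of [simp]: "length (concat (map (tuple_of n w d) xs)) = length xs * d"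
  by (induction xs) auto

lemma tuple_val_eq_nth:
  assumes "y < length xs * d"
  shows "tuple_val n w d (list_encode xs) y = concat (map (tuple_of n w d) xs) ! y"
proof -
  have "0 < d" using assms by (cases d) auto
  moreover have "y div d < length xs" using assms by (simp add: less_mult_imp_div_less)
  ultimately show ?thesis
    using nth_concat_map[of "tuple_of n w d" d y xs] assms
    by (simp add: tuple_val_def cnth_list_encode) (simp add: tuple_of_def)
qed

lemma ceval_tuple_val:
  assumes "qf_fm \<sigma> (length xs * d) \<theta>" "\<And>x. x \<in> set xs \<Longrightarrow> set (tuple_of n w d x) \<subseteq> {..<n}"
  shows "ceval s (tuple_val n w d (list_encode xs)) (fm_code \<theta>) \<longleftrightarrow>
    holds (bit_struct \<sigma> n s) \<theta> (concat (map (tuple_of n w d) xs))"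
  by (rule ceval_iff_holds) (use assms in \<open>auto simp: tuple_val_eq_nth subset_iff\<close>)

lemma cnth_interp_code [simp]:
  "cnth (interp_code \<Psi>) 0 = dim \<Psi>" "cnth (interp_code \<Psi>) (Suc 0) = fm_code (phi_univ \<Psi>)"
  "cnth (interp_code \<Psi>) 2 = fm_code (phi_eq \<Psi>)"
  "cnth (interp_code \<Psi>) 3 = list_encode (map fm_code (phi_rels \<Psi>))"
  by (simp_all add: interp_code_def)

lemma csat_interp_iff_isat:
  assumes \<Psi>: "qf_interp \<sigma> \<tau> \<Psi>" and \<psi>: "exfo_sentence \<tau> \<psi>"
  shows "csat_interp n s (fm_code \<psi>) (interp_code \<Psi>) \<longleftrightarrow> isat \<Psi> \<psi> (bit_struct \<sigma> n s)"
proof -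
  let ?A = "bit_struct \<sigma> n s" and ?d = "dim \<Psi>"
  have wf: "wf_fm \<tau> \<psi>" "ex_prenex \<psi>" "fv \<psi> \<union> qvars \<psi> \<subseteq> qvars \<psi>"
    using \<psi> by (auto simp: exfo_sentence_def sentence_def)
  have len: "length (phi_rels \<Psi>) = length \<tau>" and
    rels: "qf_fm \<sigma> (\<tau> ! r * ?d) (phi_rels \<Psi> ! r)" if "r < length \<tau>" for r
    using \<Psi> that by (auto simp: qf_interp_def list_all2_conv_all_nth)
  have U: "(\<forall>j<?d. digit (Suc n) w (x * ?d + j) < n) \<and>
      ceval s (tuple_val n w ?d (Suc (pair x 0))) (fm_code (phi_univ \<Psi>)) \<longleftrightarrow> tuple_of n w ?d x \<in> hat_univ \<Psi> ?A" for w x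
  proof -
    have "(\<forall>j<?d. digit (Suc n) w (x * ?d + j) < n) \<longleftrightarrow> set (tuple_of n w ?d x) \<subseteq> {..<n}"
      by (auto simp: tuple_of_def image_subset_iff)
    then show ?thesis
      using ceval_tuple_val[of \<sigma> "[x]" ?d "phi_univ \<Psi>" n w s] \<Psi> by (auto simp: hat_univ_def qf_interp_def)
  qed
  \<comment> \<open>Agreement of \<open>v\<close> with the decoded tuples is asked for on the prefix
    only, so the equation serves both directions: once with the decoded valuation, once with a given
    one that is being coded.\<close>
  have M: "cmatrix (\<lambda>r xs. ceval s (tuple_val n w ?d xs) (cnth (list_encode (map fm_code (phi_rels \<Psi>))) r))
       (\<lambda>x y. ceval s (tuple_val n w ?d (Suc (pair x (Suc (pair y 0))))) (fm_code (phi_eq \<Psi>))) (fm_code \<psi>) = 1 \<longleftrightarrow>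
     matrix (\<lambda>r xs. holds ?A (phi_rels \<Psi> ! r) (concat (map v xs))) (\<lambda>x y. holds ?A (phi_eq \<Psi>) (v x @ v y)) \<psi>"
    if v: "\<And>x. x \<in> qvars \<psi> \<Longrightarrow> v x = tuple_of n w ?d x \<and> v x \<in> hat_univ \<Psi> ?A" for w v
    unfolding cmatrix_fm_code of_bool_eq_1_iff
  proof (rule matrix_cong[OF wf])
    have set: "set (tuple_of n w ?d x) \<subseteq> {..<n}" if "x \<in> qvars \<psi>" for x
      using v[OF that] by (auto simp: hat_univ_def)
    fix r xs assume r: "r < length \<tau>" "length xs = \<tau> ! r" and xs: "set xs \<subseteq> qvars \<psi>"
    then have "map v xs = map (tuple_of n w ?d) xs" using v by auto
    moreover have "ceval s (tuple_val n w ?d (list_encode xs)) (fm_code (phi_rels \<Psi> ! r)) =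
        holds ?A (phi_rels \<Psi> ! r) (concat (map (tuple_of n w ?d) xs))"
      by (rule ceval_tuple_val) (use rels[OF r(1)] r(2) xs set in auto)
    ultimately show "ceval s (tuple_val n w ?d (list_encode xs)) (cnth (list_encode (map fm_code (phi_rels \<Psi>))) r) =
        holds ?A (phi_rels \<Psi> ! r) (concat (map v xs))"
      using len[OF r(1)] r(1) by (simp only: cnth_list_encode length_map nth_map)
  next
    fix x y assume xy: "x \<in> qvars \<psi>" "y \<in> qvars \<psi>"
    have "set (tuple_of n w ?d z) \<subseteq> {..<n}" if "z \<in> set [x, y]" for z
    proof -
      have "tuple_of n w ?d z \<in> hat_univ \<Psi> ?A" using v[of z] that xy by auto
      then show ?thesis by (simp add: hat_univ_def)
    qed
    note ceval_tuple_val[of \<sigma> "[x, y]" ?d "phi_eq \<Psi>" n w s, OF _ this]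
    then show "ceval s (tuple_val n w ?d (Suc (pair x (Suc (pair y 0))))) (fm_code (phi_eq \<Psi>)) =
        holds ?A (phi_eq \<Psi>) (v x @ v y)"
      using v xy \<Psi> by (simp add: qf_interp_def numeral_2_eq_2)
  qed
  show ?thesis
  proof
    assume "csat_interp n s (fm_code \<psi>) (interp_code \<Psi>)"
    then obtain w where w: "chd (fm_code \<psi>) = 6 \<longrightarrow> (\<forall>x<fm_code \<psi>. tuple_of n w ?d x \<in> hat_univ \<Psi> ?A)"
      and m: "cmatrix (\<lambda>r xs. ceval s (tuple_val n w ?d xs) (cnth (list_encode (map fm_code (phi_rels \<Psi>))) r))
       (\<lambda>x y. ceval s (tuple_val n w ?d (Suc (pair x (Suc (pair y 0))))) (fm_code (phi_eq \<Psi>))) (fm_code \<psi>) = 1"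
      unfolding csat_interp_def cnth_interp_code One_nat_def U by blast
    have v: "tuple_of n w ?d x \<in> hat_univ \<Psi> ?A" if "x \<in> qvars \<psi>" for x
      using w that qvars_empty_iff[of \<psi>] qvars_less_fm_code[OF that] by auto
    then show "isat \<Psi> \<psi> ?A" unfolding isat_def exsat_def
      using m M[of "tuple_of n w ?d" w] by (intro exI[of _ "tuple_of n w ?d"]) auto
  next
    assume "isat \<Psi> \<psi> ?A"
    \<comment> \<open>The default must have length \<open>?d\<close>, as the digits are laid out in
      blocks of that length.\<close>
    from exsat_total[OF \<psi> this[unfolded isat_def], of "replicate ?d 0"]
    obtain v where v: "qvars \<psi> \<noteq> {} \<longrightarrow> (\<forall>x. v x \<in> hat_univ \<Psi> ?A)" "qvars \<psi> = {} \<longrightarrow> (\<forall>x. v x = replicate ?d 0)"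
      and m: "matrix (\<lambda>r xs. holds ?A (phi_rels \<Psi> ! r) (concat (map v xs))) (\<lambda>x y. holds ?A (phi_eq \<Psi>) (v x @ v y)) \<psi>"
      by auto
    have lv: "length (v x) = ?d" for x using v by (cases "qvars \<psi> = {}") (auto simp: hat_univ_def)
    have vn: "v x ! j < Suc n" if "j < ?d" for x j
    proof (cases "qvars \<psi> = {}")
      case False
      then have "set (v x) \<subseteq> {..<n}" using v(1) by (auto simp: hat_univ_def)
      moreover have "v x ! j \<in> set (v x)" using that lv by simp
      ultimately have "v x ! j \<in> {..<n}" by (rule subsetD)
      then show ?thesis by simp
    qed (use v that in auto)
    define f where "f i = v (i div ?d) ! (i mod ?d)" for i
    have "f i < Suc n" if "i < fm_code \<psi> * ?d" for i
      unfolding f_def using that by (intro vn) (cases "?d = 0", auto)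
    then obtain w where w: "w < Suc n ^ (fm_code \<psi> * ?d)" "\<forall>i<fm_code \<psi> * ?d. digit (Suc n) w i = f i"
      using ex_digits[of "fm_code \<psi> * ?d" f "Suc n"] by blast
    have vt: "tuple_of n w ?d x = v x" if "x < fm_code \<psi>" for x
    proof (rule nth_equalityI)
      fix j assume "j < length (tuple_of n w ?d x)"
      then have j: "j < ?d" by simp
      have "x * ?d + j < Suc x * ?d" using j by simp
      also have "\<dots> \<le> fm_code \<psi> * ?d" using that by (intro mult_le_mono1) simp
      finally have "digit (Suc n) w (x * ?d + j) = f (x * ?d + j)" using w(2) by blast
      then show "tuple_of n w ?d x ! j = v x ! j" using j by (simp add: tuple_of_def f_def)
    qed (simp add: lv)
    have "cmatrix (\<lambda>r xs. ceval s (tuple_val n w ?d xs) (cnth (list_encode (map fm_code (phi_rels \<Psi>))) r))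
       (\<lambda>x y. ceval s (tuple_val n w ?d (Suc (pair x (Suc (pair y 0))))) (fm_code (phi_eq \<Psi>))) (fm_code \<psi>) = 1"
      by (subst M[where v = v]) (use v(1) m vt qvars_less_fm_code in auto)
    moreover have "chd (fm_code \<psi>) = 6 \<longrightarrow> (\<forall>x<fm_code \<psi>. tuple_of n w ?d x \<in> hat_univ \<Psi> ?A)"
      using v(1) vt qvars_empty_iff[of \<psi>] by auto
    ultimately show "csat_interp n s (fm_code \<psi>) (interp_code \<Psi>)"
      unfolding csat_interp_def cnth_interp_code One_nat_def U using w(1) by blast
  qed
qed

section \<open>Reductions given by interpretations\<close>

lemma decidable_onI:
  assumes "decidable P" "\<And>i. i \<in> I \<Longrightarrow> P (code i) \<longleftrightarrow> Q i"
  shows "decidable_on code I Q"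
proof -
  from assms(1) obtain F where "recfn (Suc 0) F" "\<And>xs. length xs = Suc 0 \<Longrightarrow> F xs = of_bool (P (xs ! 0))"
    unfolding decidable_def computable_def lcomputable_def by blast
  then show ?thesis
    unfolding decidable_on_def using assms(2) by (intro exI[of _ F]) auto
qed

lemma computable_bit_bound [comp_intros]:
  "computable f \<Longrightarrow> computable g \<Longrightarrow> computable (\<lambda>x. bit_bound (f x) (g x))"
  unfolding bit_bound_def by (intro comp_intros computable_list_bound)

theorem interpretation_reduction_decidable:
  "decidable_on
     (\<lambda>(\<sigma>, \<tau>, \<phi>, \<psi>, \<Psi>). list_encode
        [list_encode \<sigma>, list_encode \<tau>, fm_code \<phi>, fm_code \<psi>, interp_code \<Psi>])
     {(\<sigma>, \<tau>, \<phi>, \<psi>, \<Psi>). exfo_sentence \<sigma> \<phi> \<and> exfo_sentence \<tau> \<psi> \<and> qf_interp \<sigma> \<tau> \<Psi>}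
     (\<lambda>(\<sigma>, \<tau>, \<phi>, \<psi>, \<Psi>). is_reduction (structs \<sigma>) (interpret_struct \<tau> \<Psi>)
        (models (structs \<sigma>) \<phi>) (models (structs \<tau>) \<psi>))"
proof (rule decidable_onI)
  \<comment> \<open>The sum of the two witness bounds serves for both sides, since such bounds may
    be enlarged.\<close>
  let ?N = "\<lambda>x. cnth x 2 + cnth x 3 * cnth (cnth x 4) 0"
  show "decidable (\<lambda>x. \<forall>n<Suc (?N x). \<forall>s<2 ^ bit_bound (cnth x 0) (?N x).
      csat n s (cnth x 2) \<longleftrightarrow> csat_interp n s (cnth x 3) (cnth x 4))"
    by (intro comp_intros decidable_csat decidable_csat_interp)
  fix i assume "i \<in> {(\<sigma>, \<tau>, \<phi>, \<psi>, \<Psi>). exfo_sentence \<sigma> \<phi> \<and> exfo_sentence \<tau> \<psi> \<and> qf_interp \<sigma> \<tau> \<Psi>}"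
  then obtain \<sigma> \<tau> \<phi> \<psi> \<Psi> where i: "i = (\<sigma>, \<tau>, \<phi>, \<psi>, \<Psi>)"
    and \<phi>: "exfo_sentence \<sigma> \<phi>" and \<psi>: "exfo_sentence \<tau> \<psi>" and \<Psi>: "qf_interp \<sigma> \<tau> \<Psi>" by auto
  let ?x = "(\<lambda>(\<sigma>, \<tau>, \<phi>, \<psi>, \<Psi>). list_encode [list_encode \<sigma>, list_encode \<tau>, fm_code \<phi>, fm_code \<psi>, interp_code \<Psi>]) i"
  let ?M = "fm_code \<phi> + fm_code \<psi> * dim \<Psi>"
  have "is_reduction (structs \<sigma>) (interpret_struct \<tau> \<Psi>) (models (structs \<sigma>) \<phi>) (models (structs \<tau>) \<psi>)
    \<longleftrightarrow> (\<forall>A\<in>structs \<sigma>. dsat \<phi> A \<longleftrightarrow> isat \<Psi> \<psi> A)"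
    by (simp add: is_reduction_def models_dsat[OF \<phi>] interpret_struct_sat[OF \<Psi> _ \<psi>])
  also have "\<dots> \<longleftrightarrow> (\<forall>n<Suc ?M. \<forall>s<2 ^ bit_bound (list_encode \<sigma>) ?M. bit_struct \<sigma> n s \<in> structs \<sigma> \<longrightarrow>
      (dsat \<phi> (bit_struct \<sigma> n s) \<longleftrightarrow> isat \<Psi> \<psi> (bit_struct \<sigma> n s)))"
    by (rule small_witness_eq[OF small_witness_mono[OF small_witness_dsat[OF \<phi>]]
        small_witness_mono[OF small_witness_isat[OF \<Psi> \<psi>]] subset_refl induced_in_structs]) auto
  finally show "(\<forall>n<Suc (?N ?x).
      \<forall>s<2 ^ bit_bound (cnth ?x 0)
        (?N ?x).
      csat n s (cnth ?x 2) \<longleftrightarrow>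
      csat_interp n s (cnth ?x 3)
        (cnth ?x 4)) \<longleftrightarrow>
    (\<lambda>(\<sigma>, \<tau>, \<phi>, \<psi>, \<Psi>). is_reduction (structs \<sigma>) (interpret_struct \<tau> \<Psi>)
        (models (structs \<sigma>) \<phi>) (models (structs \<tau>) \<psi>)) i"
    by (simp add: i bit_struct_in_structs csat_iff_dsat[OF \<phi>] csat_interp_iff_isat[OF \<Psi> \<psi>] del: fm_code.simps)
qed

text \<open>The instance fixed for \<open>P\<close> may have another target schema than the input:
  what is compared are two pullbacks, both of them conditions on structures over the source
  schema.\<close>

theorem interpretation_reduction_from_class_decidable:
  "decidable_on
     (\<lambda>(\<tau>, \<psi>, \<Psi>). list_encode [list_encode \<tau>, fm_code \<psi>, interp_code \<Psi>])
     {(\<tau>, \<psi>, \<Psi>). exfo_sentence \<tau> \<psi> \<and> qf_interp \<sigma> \<tau> \<Psi>}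
     (\<lambda>(\<tau>, \<psi>, \<Psi>). is_reduction (structs \<sigma>) (interpret_struct \<tau> \<Psi>) P (models (structs \<tau>) \<psi>))"
proof (cases "\<exists>\<tau> \<psi> \<Psi>. exfo_sentence \<tau> \<psi> \<and> qf_interp \<sigma> \<tau> \<Psi> \<and>
    is_reduction (structs \<sigma>) (interpret_struct \<tau> \<Psi>) P (models (structs \<tau>) \<psi>)")
  case False
  then show ?thesis by (intro decidable_onI[OF decidable_const[of False]]) auto
next
  case True
  then obtain \<tau>\<^sub>0 \<psi>\<^sub>0 \<Psi>\<^sub>0 where \<psi>\<^sub>0: "exfo_sentence \<tau>\<^sub>0 \<psi>\<^sub>0" and \<Psi>\<^sub>0: "qf_interp \<sigma> \<tau>\<^sub>0 \<Psi>\<^sub>0"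
    and red: "is_reduction (structs \<sigma>) (interpret_struct \<tau>\<^sub>0 \<Psi>\<^sub>0) P (models (structs \<tau>\<^sub>0) \<psi>\<^sub>0)" by blast
  have P: "A \<in> P \<longleftrightarrow> isat \<Psi>\<^sub>0 \<psi>\<^sub>0 A" if "A \<in> structs \<sigma>" for A
    using red that by (simp add: is_reduction_def interpret_struct_sat[OF \<Psi>\<^sub>0 _ \<psi>\<^sub>0])
  let ?N = "\<lambda>x. fm_code \<psi>\<^sub>0 * dim \<Psi>\<^sub>0 + cnth x 1 * cnth (cnth x 2) 0"
  show ?thesis
  proof (rule decidable_onI)
    show "decidable (\<lambda>x. \<forall>n<Suc (?N x). \<forall>s<2 ^ bit_bound (list_encode \<sigma>) (?N x).
        csat_interp n s (fm_code \<psi>\<^sub>0) (interp_code \<Psi>\<^sub>0) \<longleftrightarrow> csat_interp n s (cnth x 1) (cnth x 2))"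
      by (intro comp_intros decidable_csat_interp)
    fix i assume "i \<in> {(\<tau>, \<psi>, \<Psi>). exfo_sentence \<tau> \<psi> \<and> qf_interp \<sigma> \<tau> \<Psi>}"
    then obtain \<tau> \<psi> \<Psi> where i: "i = (\<tau>, \<psi>, \<Psi>)"
      and \<psi>: "exfo_sentence \<tau> \<psi>" and \<Psi>: "qf_interp \<sigma> \<tau> \<Psi>" by auto
    let ?M = "fm_code \<psi>\<^sub>0 * dim \<Psi>\<^sub>0 + fm_code \<psi> * dim \<Psi>"
    let ?x = "(\<lambda>(\<tau>, \<psi>, \<Psi>). list_encode [list_encode \<tau>, fm_code \<psi>, interp_code \<Psi>]) i"
    have "is_reduction (structs \<sigma>) (interpret_struct \<tau> \<Psi>) P (models (structs \<tau>) \<psi>)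
      \<longleftrightarrow> (\<forall>A\<in>structs \<sigma>. isat \<Psi>\<^sub>0 \<psi>\<^sub>0 A \<longleftrightarrow> isat \<Psi> \<psi> A)"
      by (simp add: is_reduction_def P interpret_struct_sat[OF \<Psi> _ \<psi>])
    also have "\<dots> \<longleftrightarrow> (\<forall>n<Suc ?M. \<forall>s<2 ^ bit_bound (list_encode \<sigma>) ?M. bit_struct \<sigma> n s \<in> structs \<sigma> \<longrightarrow>
        (isat \<Psi>\<^sub>0 \<psi>\<^sub>0 (bit_struct \<sigma> n s) \<longleftrightarrow> isat \<Psi> \<psi> (bit_struct \<sigma> n s)))"
      by (rule small_witness_eq[OF small_witness_mono[OF small_witness_isat[OF \<Psi>\<^sub>0 \<psi>\<^sub>0]]
          small_witness_mono[OF small_witness_isat[OF \<Psi> \<psi>]] subset_refl induced_in_structs]) auto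
    finally show "(\<forall>n<Suc (?N ?x). \<forall>s<2 ^ bit_bound (list_encode \<sigma>) (?N ?x).
        csat_interp n s (fm_code \<psi>\<^sub>0) (interp_code \<Psi>\<^sub>0) \<longleftrightarrow> csat_interp n s (cnth ?x 1) (cnth ?x 2)) \<longleftrightarrow>
      (\<lambda>(\<tau>, \<psi>, \<Psi>). is_reduction (structs \<sigma>) (interpret_struct \<tau> \<Psi>) P (models (structs \<tau>) \<psi>)) i"
      by (simp add: i bit_struct_in_structs csat_interp_iff_isat[OF \<Psi>\<^sub>0 \<psi>\<^sub>0] csat_interp_iff_isat[OF \<Psi> \<psi>])
  qed
qed

section \<open>Composition for edge gadgets\<close>

lemma sat_cong_fv:
  "(\<And>x. x \<in> fv \<phi> \<Longrightarrow> v x = v' x) \<Longrightarrow> (\<And>X. X \<in> fv_set \<phi> \<Longrightarrow> V X = V' X) \<Longrightarrow>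
   sat A v V \<phi> \<longleftrightarrow> sat A v' V' \<phi>"
proof (induction \<phi> arbitrary: v v' V V')
  case (Rel r xs)
  then have "map v xs = map v' xs" by simp
  then show ?case by (simp only: sat.simps)
next
  case (Ex x \<phi>)
  have "sat A (v(x := a)) V \<phi> \<longleftrightarrow> sat A (v'(x := a)) V' \<phi>" for a
    by (rule Ex.IH) (use Ex.prems in auto)
  then show ?case by simp
next
  case (ExSet X \<phi>)
  have "sat A v (V(X := Y)) \<phi> \<longleftrightarrow> sat A v' (V'(X := Y)) \<phi>" for Y
    by (rule ExSet.IH) (use ExSet.prems in auto)
  then show ?case by simp
next
  case (Neg \<phi>)
  have "sat A v V \<phi> \<longleftrightarrow> sat A v' V' \<phi>" by (rule Neg.IH) (use Neg.prems in auto)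
  then show ?case by simp
next
  case (And \<phi> \<psi>)
  have "sat A v V \<phi> \<longleftrightarrow> sat A v' V' \<phi>" by (rule And.IH) (use And.prems in auto)
  moreover have "sat A v V \<psi> \<longleftrightarrow> sat A v' V' \<psi>" by (rule And.IH) (use And.prems in auto)
  ultimately show ?case by simp
qed auto

text \<open>Monadic second-order logic over gadgets with sets as the only variables. An element of
  the reduced graph leaves one node or none on a copy, so element variables also turn into sets;
  \<open>GSing\<close> and \<open>GMeet i i\<close> tell the cases apart. \<open>GC\<close> and
  \<open>GD\<close> speak about the terminals, where a copy touches the rest of the graph.\<close>

datatype gfm =
    GC nat
  | GD nat
  | GAdj nat nat
  | GMeet nat nat
  | GSing nat
  | GTrue
  | GNeg gfm
  | GAnd gfm gfm
  | GEx nat gfm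

fun geval :: "gadget \<Rightarrow> (nat \<Rightarrow> nat set) \<Rightarrow> gfm \<Rightarrow> bool" where
  "geval g W (GC i) = (gc g \<in> W i)"
| "geval g W (GD i) = (gd g \<in> W i)"
| "geval g W (GAdj i j) = (\<exists>x y. (x, y) \<in> set (gedges g) \<and> x \<in> W i \<and> y \<in> W j)"
| "geval g W (GMeet i j) = (\<exists>x. x \<in> W i \<and> x \<in> W j)"
| "geval g W (GSing i) = (\<exists>x. W i = {x})"
| "geval g W GTrue = True"
| "geval g W (GNeg \<theta>) = (\<not> geval g W \<theta>)"
| "geval g W (GAnd \<theta> \<eta>) = (geval g W \<theta> \<and> geval g W \<eta>)"
| "geval g W (GEx i \<theta>) = (\<exists>Y\<subseteq>{..<gsize g}. geval g (W(i := Y)) \<theta>)"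

text \<open>The analogue of a Hintikka formula relative to the list: it prescribes the truth value
  of every member.\<close>

fun literals :: "gfm set \<Rightarrow> gfm list \<Rightarrow> gfm" where
  "literals T [] = GTrue"
| "literals T (\<theta> # l) = GAnd (if \<theta> \<in> T then \<theta> else GNeg \<theta>) (literals T l)"

lemma geval_literals: "geval g W (literals T l) \<longleftrightarrow> (\<forall>\<theta>\<in>set l. geval g W \<theta> \<longleftrightarrow> \<theta> \<in> T)"
  by (induction l) auto

text \<open>The formulas over which agreement guarantees that a move in slot \<open>i\<close> can be answered with
  agreement on \<open>\<Phi>\<close>.\<close>

definition back_forth :: "nat \<Rightarrow> gfm set \<Rightarrow> gfm set" where
  "back_forth i \<Phi> = (\<lambda>T. GEx i (literals T (SOME l. set l = \<Phi>))) ` Pow \<Phi>"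

lemma finite_back_forth: "finite \<Phi> \<Longrightarrow> finite (back_forth i \<Phi>)"
  by (simp add: back_forth_def)

text \<open>Describe the situation after the move by the set \<open>T\<close> of formulas in
  \<open>\<Phi>\<close> that are then true. That some move leads to exactly \<open>T\<close> is a
  formula in \<open>back_forth\<close>, true for \<open>g\<close> and hence for \<open>g'\<close>,
  and any witness of it there is an answer.\<close>

lemma back_forth_answer:
  assumes fin: "finite \<Phi>" and agree: "\<And>\<theta>. \<theta> \<in> back_forth i \<Phi> \<Longrightarrow> geval g W \<theta> \<longleftrightarrow> geval g' W' \<theta>"
    and Y: "Y \<subseteq> {..<gsize g}"
  shows "\<exists>Y'\<subseteq>{..<gsize g'}. \<forall>\<theta>\<in>\<Phi>. geval g (W(i := Y)) \<theta> \<longleftrightarrow> geval g' (W'(i := Y')) \<theta>"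
proof -
  define l where "l = (SOME l. set l = \<Phi>)"
  have l: "set l = \<Phi>" unfolding l_def using finite_list[OF fin] by (rule someI_ex)
  define T where "T = {\<theta> \<in> \<Phi>. geval g (W(i := Y)) \<theta>}"
  have "GEx i (literals T l) \<in> back_forth i \<Phi>" by (auto simp: back_forth_def l_def T_def)
  moreover have "geval g W (GEx i (literals T l))"
    using Y by (auto simp: geval_literals l T_def)
  ultimately have "geval g' W' (GEx i (literals T l))" using agree by blast
  then obtain Y' where "Y' \<subseteq> {..<gsize g'}" "\<forall>\<theta>\<in>\<Phi>. geval g' (W'(i := Y')) \<theta> \<longleftrightarrow> \<theta> \<in> T"
    by (auto simp: geval_literals l)
  then show ?thesis by (intro exI[of _ Y']) (auto simp: T_def)
qed

section \<open>Copies of the gadget and the gluing of local answers\<close>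

definition oedges :: "nat fstruct \<Rightarrow> (nat \<times> nat) set" where
  "oedges G = {(u, v). [u, v] \<in> rels G ! 0 \<and> u < v}"

definition copy_node :: "gadget \<Rightarrow> nat \<times> nat \<Rightarrow> nat \<Rightarrow> nat + nat \<times> nat \<times> nat" where
  "copy_node g e x = gadget_node g (fst e) (snd e) x"

definition trace :: "gadget \<Rightarrow> nat \<times> nat \<Rightarrow> (nat + nat \<times> nat \<times> nat) set \<Rightarrow> nat set" where
  "trace g e Y = {x. x < gsize g \<and> copy_node g e x \<in> Y}"

lemma univ_gadget_reduction: "univ (gadget_reduction g G) =
    Inl ` univ G \<union> {copy_node g e x | e x. e \<in> oedges G \<and> x < gsize g}"
  unfolding gadget_reduction_def oedges_def copy_node_def by fastforce

lemma rels_gadget_reduction: "rels (gadget_reduction g G) ! 0 =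
    {[copy_node g e x, copy_node g e y] | e x y. e \<in> oedges G \<and> (x, y) \<in> set (gedges g)}"
  unfolding gadget_reduction_def oedges_def copy_node_def by fastforce

lemma copy_node_gc [simp]: "copy_node g e (gc g) = Inl (fst e)"
  by (simp add: copy_node_def gadget_node_def)

lemma copy_node_gd: "edge_gadget g \<Longrightarrow> copy_node g e (gd g) = Inl (snd e)"
  by (simp add: copy_node_def gadget_node_def edge_gadget_def)

lemma copy_node_Inl: "copy_node g e x = Inl u \<Longrightarrow> x = gc g \<and> u = fst e \<or> x = gd g \<and> u = snd e"
  by (auto simp: copy_node_def gadget_node_def split: if_splits)

lemma copy_node_Inr: "copy_node g e x = Inr z \<Longrightarrow> z = (fst e, snd e, x)"
  by (auto simp: copy_node_def gadget_node_def split: if_splits)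

text \<open>The endpoints of an oriented edge differ, so identifying the terminals with them merges
  no two gadget nodes.\<close>

lemma copy_node_inj: "e \<in> oedges G \<Longrightarrow> copy_node g e x = copy_node g e y \<longleftrightarrow> x = y"
  by (auto simp: copy_node_def gadget_node_def oedges_def split: if_splits)

lemma oedges_univ: "G \<in> graphs \<Longrightarrow> e \<in> oedges G \<Longrightarrow> fst e \<in> univ G \<and> snd e \<in> univ G"
  by (fastforce simp: graphs_def structs_def oedges_def list_all2_Cons2)

lemma gedges_gsize: "edge_gadget g \<Longrightarrow> (x, y) \<in> set (gedges g) \<Longrightarrow> x < gsize g \<and> y < gsize g"
  by (fastforce simp: edge_gadget_def gadget_graph_def graphs_def structs_def)

lemma gedges_sym: "edge_gadget g \<Longrightarrow> (x, y) \<in> set (gedges g) \<Longrightarrow> (y, x) \<in> set (gedges g) \<and> x \<noteq> y"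
  by (fastforce simp: edge_gadget_def gadget_graph_def graphs_def)

lemma finite_oedges:
  assumes "G \<in> graphs" shows "finite (oedges G)"
proof (rule finite_subset)
  show "oedges G \<subseteq> univ G \<times> univ G" using oedges_univ[OF assms] by auto
  show "finite (univ G \<times> univ G)" using assms by (auto simp: graphs_def structs_def)
qed

lemma gadget_reduction_in_graphs:
  assumes g: "edge_gadget g" and G: "G \<in> graphs"
  shows "gadget_reduction g G \<in> graphs"
proof -
  let ?H = "gadget_reduction g G"
  have "{copy_node g e x | e x. e \<in> oedges G \<and> x < gsize g} = (\<lambda>(e, x). copy_node g e x) ` (oedges G \<times> {..<gsize g})"
    by auto
  then have "finite (univ ?H)"
    using finite_oedges[OF G] G by (simp add: univ_gadget_reduction graphs_def structs_def)
  moreover have "rels ?H = [rels ?H ! 0]" by (simp add: gadget_reduction_def)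
  moreover have "rels ?H ! 0 \<subseteq> {as. length as = 2 \<and> set as \<subseteq> univ ?H}"
    using gedges_gsize[OF g] by (fastforce simp: rels_gadget_reduction univ_gadget_reduction)
  ultimately have "?H \<in> structs [2]" unfolding structs_def by (auto simp: list_all2_Cons2)
  moreover have "u \<noteq> v \<and> [v, u] \<in> rels ?H ! 0" if "[u, v] \<in> rels ?H ! 0" for u v
    using that gedges_sym[OF g] copy_node_inj unfolding rels_gadget_reduction by fastforce
  ultimately show ?thesis by (auto simp: graphs_def)
qed

text \<open>Two copies overlap only in nodes of \<open>G\<close>, since an inner node carries its
  edge as a label. Sets chosen separately for the copies can therefore be united as soon as they
  treat the terminals as prescribed by \<open>Y\<close>.\<close>

lemma glue:
  assumes G: "G \<in> graphs" and g': "edge_gadget g'"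
    and S: "\<And>e. e \<in> oedges G \<Longrightarrow> S e \<subseteq> {..<gsize g'} \<and> (gc g' \<in> S e \<longleftrightarrow> Inl (fst e) \<in> Y) \<and>
      (gd g' \<in> S e \<longleftrightarrow> Inl (snd e) \<in> Y)"
  shows "\<exists>Y'\<subseteq>univ (gadget_reduction g' G). (\<forall>u\<in>univ G. Inl u \<in> Y \<longleftrightarrow> Inl u \<in> Y') \<and>
    (\<forall>e\<in>oedges G. trace g' e Y' = S e)"
proof -
  define Y' where "Y' = {Inl u | u. u \<in> univ G \<and> Inl u \<in> Y} \<union> {copy_node g' e x | e x. e \<in> oedges G \<and> x \<in> S e}"
  have Inl_iff: "Inl u \<in> Y' \<longleftrightarrow> u \<in> univ G \<and> Inl u \<in> Y" for u
  proof
    assume "Inl u \<in> Y'"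
    then consider "u \<in> univ G \<and> Inl u \<in> Y" | e x where "e \<in> oedges G" "x \<in> S e" "copy_node g' e x = Inl u"
      by (auto simp: Y'_def)
    then show "u \<in> univ G \<and> Inl u \<in> Y"
    proof cases
      case 2
      then show ?thesis using copy_node_Inl[OF 2(3)] S[OF 2(1)] oedges_univ[OF G 2(1)] by auto
    qed
  qed (auto simp: Y'_def)
  have "trace g' e Y' = S e" if e: "e \<in> oedges G" for e
  proof
    have "copy_node g' e x \<in> Y'" if "x \<in> S e" for x unfolding Y'_def using that e by blast
    then show "S e \<subseteq> trace g' e Y'" using S[OF e] by (auto simp: trace_def)
    show "trace g' e Y' \<subseteq> S e"
    proof
      fix x assume "x \<in> trace g' e Y'"
      then have x: "copy_node g' e x \<in> Y'" by (simp add: trace_def)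
      show "x \<in> S e"
      proof (cases "copy_node g' e x")
        case (Inl u)
        then show ?thesis using x Inl_iff[of u] copy_node_Inl[OF Inl] S[OF e] Inl by auto
      next
        case (Inr z)
        then obtain e' x' where "e' \<in> oedges G" "x' \<in> S e'" "copy_node g' e' x' = Inr z"
          using x by (auto simp: Y'_def)
        moreover have "e' = e" "x' = x"
          using copy_node_Inr[OF Inr] copy_node_Inr[OF calculation(3)] by (auto intro: prod_eqI)
        ultimately show ?thesis by simp
      qed
    qed
  qed
  moreover have "Y' \<subseteq> univ (gadget_reduction g' G)"
    using S by (fastforce simp: Y'_def univ_gadget_reduction)
  ultimately show ?thesis using Inl_iff by (intro exI[of _ Y']) auto
qed

text \<open>Answers are chosen independently for the edges. Because \<open>GC i\<close> and
  \<open>GD i\<close> belong to \<open>\<Phi>\<close>, each contains precisely the terminals whose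
  images lie in \<open>Y\<close>, which is the hypothesis for gluing.\<close>

lemma answer:
  assumes G: "G \<in> graphs" and g: "edge_gadget g" and g': "edge_gadget g'"
    and fin: "finite \<Phi>" and CD: "{GC i, GD i} \<subseteq> \<Phi>"
    and agree: "\<And>e \<theta>. e \<in> oedges G \<Longrightarrow> \<theta> \<in> back_forth i \<Phi> \<Longrightarrow> geval g (W e) \<theta> \<longleftrightarrow> geval g' (W' e) \<theta>"
  shows "\<exists>Y'\<subseteq>univ (gadget_reduction g' G). (\<forall>u\<in>univ G. Inl u \<in> Y \<longleftrightarrow> Inl u \<in> Y') \<and>
    (\<forall>e\<in>oedges G. \<forall>\<theta>\<in>\<Phi>. geval g ((W e)(i := trace g e Y)) \<theta> \<longleftrightarrow> geval g' ((W' e)(i := trace g' e Y')) \<theta>)"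
proof -
  have "\<forall>e\<in>oedges G. \<exists>S\<subseteq>{..<gsize g'}. \<forall>\<theta>\<in>\<Phi>. geval g ((W e)(i := trace g e Y)) \<theta> \<longleftrightarrow> geval g' ((W' e)(i := S)) \<theta>"
    using back_forth_answer[OF fin agree] by (simp add: trace_def subset_iff)
  then obtain S where S: "\<And>e. e \<in> oedges G \<Longrightarrow> S e \<subseteq> {..<gsize g'}"
    "\<And>e \<theta>. e \<in> oedges G \<Longrightarrow> \<theta> \<in> \<Phi> \<Longrightarrow> geval g ((W e)(i := trace g e Y)) \<theta> \<longleftrightarrow> geval g' ((W' e)(i := S e)) \<theta>"
    by metis
  have "gc g' \<in> S e \<longleftrightarrow> Inl (fst e) \<in> Y" if "e \<in> oedges G" for e
    using S(2)[OF that, of "GC i"] CD g by (simp add: trace_def edge_gadget_def)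
  moreover have "gd g' \<in> S e \<longleftrightarrow> Inl (snd e) \<in> Y" if "e \<in> oedges G" for e
    using S(2)[OF that, of "GD i"] CD g by (simp add: trace_def copy_node_gd) (simp add: edge_gadget_def)
  ultimately obtain Y' where "Y' \<subseteq> univ (gadget_reduction g' G)" "\<forall>u\<in>univ G. Inl u \<in> Y \<longleftrightarrow> Inl u \<in> Y'"
    "\<And>e. e \<in> oedges G \<Longrightarrow> trace g' e Y' = S e"
    using glue[OF G g', of S Y] S(1) by auto
  then show ?thesis using S(2) by (intro exI[of _ Y']) auto
qed

text \<open>The singleton \<open>{a}\<close> is played as a set move. On each copy the answer, like
  the trace of \<open>{a}\<close>, is empty or a single node; what remains is to exclude that it
  takes different nodes in different copies.\<close>

lemma answer_singleton:
  assumes G: "G \<in> graphs" and g: "edge_gadget g" and g': "edge_gadget g'"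
    and fin: "finite \<Phi>" and CD: "{GC i, GD i, GSing i, GMeet i i} \<subseteq> \<Phi>"
    and agree: "\<And>e \<theta>. e \<in> oedges G \<Longrightarrow> \<theta> \<in> back_forth i \<Phi> \<Longrightarrow> geval g (W e) \<theta> \<longleftrightarrow> geval g' (W' e) \<theta>"
    and a: "a \<in> univ (gadget_reduction g G)"
  shows "\<exists>a'\<in>univ (gadget_reduction g' G). (\<forall>u\<in>univ G. a = Inl u \<longleftrightarrow> a' = Inl u) \<and>
    (\<forall>e\<in>oedges G. \<forall>\<theta>\<in>\<Phi>. geval g ((W e)(i := trace g e {a})) \<theta> \<longleftrightarrow> geval g' ((W' e)(i := trace g' e {a'})) \<theta>)"
proof -
  have "\<exists>Y'\<subseteq>univ (gadget_reduction g' G). (\<forall>u\<in>univ G. Inl u \<in> {a} \<longleftrightarrow> Inl u \<in> Y') \<and>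
    (\<forall>e\<in>oedges G. \<forall>\<theta>\<in>\<Phi>. geval g ((W e)(i := trace g e {a})) \<theta> \<longleftrightarrow> geval g' ((W' e)(i := trace g' e Y')) \<theta>)"
    by (rule answer[OF G g g' fin]) (use CD agree in auto)
  then obtain Y' where Y': "Y' \<subseteq> univ (gadget_reduction g' G)" "\<And>u. u \<in> univ G \<Longrightarrow> Inl u = a \<longleftrightarrow> Inl u \<in> Y'"
    and ev: "\<And>e \<theta>. e \<in> oedges G \<Longrightarrow> \<theta> \<in> \<Phi> \<Longrightarrow>
      geval g ((W e)(i := trace g e {a})) \<theta> \<longleftrightarrow> geval g' ((W' e)(i := trace g' e Y')) \<theta>"
    by auto
  have C: "gc g \<in> trace g e {a} \<longleftrightarrow> gc g' \<in> trace g' e Y'"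
    and D: "gd g \<in> trace g e {a} \<longleftrightarrow> gd g' \<in> trace g' e Y'"
    and S: "(\<exists>x. trace g e {a} = {x}) \<longleftrightarrow> (\<exists>x. trace g' e Y' = {x})"
    and M: "trace g e {a} \<noteq> {} \<longleftrightarrow> trace g' e Y' \<noteq> {}" if "e \<in> oedges G" for e
    using ev[OF that, of "GC i"] ev[OF that, of "GD i"] ev[OF that, of "GSing i"] ev[OF that, of "GMeet i i"] CD
    by auto
  have sing: "trace g e {a} = {x}" if "e \<in> oedges G" "x \<in> trace g e {a}" for e x
    using that copy_node_inj[OF that(1), of g] by (auto simp: trace_def)
  have sing': "y = z" if e: "e \<in> oedges G" and yz: "y \<in> trace g' e Y'" "z \<in> trace g' e Y'" for e y z
  proof -
    from M[OF e] yz(1) obtain x where "x \<in> trace g e {a}" by blast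
    with sing[OF e] S[OF e] obtain x' where "trace g' e Y' = {x'}" by blast
    then show ?thesis using yz by simp
  qed
  have "\<exists>a'. Y' = {a'}"
  proof (cases a)
    case (Inl u)
    then have "u \<in> univ G"
      using a oedges_univ[OF G] by (auto simp: univ_gadget_reduction dest!: copy_node_Inl sym[of "Inl u"])
    have "b = Inl u" if b: "b \<in> Y'" for b
    proof (cases b)
      case (Inl w)
      then have "w \<in> univ G" using Y'(1) b oedges_univ[OF G]
        by (auto simp: univ_gadget_reduction dest!: subsetD copy_node_Inl sym[of "Inl w"])
      then show ?thesis using Y'(2) b Inl \<open>a = Inl u\<close> by auto
    next
      case (Inr z)
      then obtain e x' where e: "e \<in> oedges G" "x' < gsize g'" "b = copy_node g' e x'"
        using Y'(1) b by (auto simp: univ_gadget_reduction)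
      then have x': "x' \<in> trace g' e Y'" using b by (simp add: trace_def)
      then obtain x where x: "x \<in> trace g e {a}" using M[OF e(1)] by blast
      then have "copy_node g e x = Inl u" using Inl \<open>a = Inl u\<close> by (simp add: trace_def)
      then have "x = gc g \<or> x = gd g" using copy_node_Inl by blast
      \<comment> \<open>On this copy \<open>a\<close> is a terminal, so the corresponding terminal
        is in the answer and is its only node there. This rules out that \<open>b\<close> is an
        inner node.\<close>
      then have "x' = gc g' \<or> x' = gd g'" using C[OF e(1)] D[OF e(1)] x sing'[OF e(1) x'] by blast
      then show ?thesis using e(3) Inr copy_node_gd[OF g', of e] by auto
    qed
    moreover have "Inl u \<in> Y'" using Y'(2) \<open>u \<in> univ G\<close> Inl by blast
    ultimately show ?thesis by blast
  next
    case (Inr z)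
    then obtain e x where e: "e \<in> oedges G" "x < gsize g" "a = copy_node g e x"
      using a by (auto simp: univ_gadget_reduction)
    then have "x \<in> trace g e {a}" by (simp add: trace_def)
    then obtain x' where x': "x' \<in> trace g' e Y'" using M[OF e(1)] by blast
    have "b = copy_node g' e x'" if b: "b \<in> Y'" for b
    proof (cases b)
      case (Inl w)
      then have "w \<in> univ G" using Y'(1) b oedges_univ[OF G]
        by (auto simp: univ_gadget_reduction dest!: subsetD copy_node_Inl sym[of "Inl w"])
      then show ?thesis using Y'(2) b Inl Inr by auto
    next
      case (Inr z')
      then obtain e2 y where e2: "e2 \<in> oedges G" "y < gsize g'" "b = copy_node g' e2 y"
        using Y'(1) b by (auto simp: univ_gadget_reduction)
      then have y: "y \<in> trace g' e2 Y'" using b by (simp add: trace_def)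
      then obtain x2 where "x2 \<in> trace g e2 {a}" using M[OF e2(1)] by blast
      then have "copy_node g e2 x2 = Inr z" using \<open>a = Inr z\<close> by (simp add: trace_def)
      moreover have "copy_node g e x = Inr z" using e(3) \<open>a = Inr z\<close> by simp
      \<comment> \<open>An inner node determines its copy: \<open>a\<close> leaves a trace on no
        other copy, so neither does the answer.\<close>
      ultimately have "e2 = e" using copy_node_Inr by (metis prod.inject prod.collapse)
      then show ?thesis using sing'[OF e(1) x'] y e2(3) by auto
    qed
    moreover have "copy_node g' e x' \<in> Y'" using x' by (simp add: trace_def)
    ultimately show ?thesis by blast
  qed
  then obtain a' where a': "Y' = {a'}" by blast
  show ?thesis
    using Y' ev unfolding a' by (intro bexI[of _ a']) (auto simp: eq_commute)
qed

text \<open>The sets that a valuation of element variables (even slots) and set variables (odd slots)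
  induces on the copy of the gadget for \<open>e\<close>.\<close>

definition local_sets :: "gadget \<Rightarrow> (nat \<Rightarrow> nat + nat \<times> nat \<times> nat) \<Rightarrow>
    (nat \<Rightarrow> (nat + nat \<times> nat \<times> nat) set) \<Rightarrow> nat \<times> nat \<Rightarrow> nat \<Rightarrow> nat set" where
  "local_sets g v V e i = trace g e (if even i then {v (i div 2)} else V (i div 2))"

lemma local_sets_simps [simp]:
  "local_sets g v V e (2 * x) = trace g e {v x}"
  "local_sets g v V e (Suc (2 * x)) = trace g e (V x)"
  by (simp_all add: local_sets_def)

lemma local_sets_upd:
  "local_sets g (v(x := a)) V e = (local_sets g v V e)(2 * x := trace g e {a})"
  "local_sets g v (V(X := Y)) e = (local_sets g v V e)(Suc (2 * X) := trace g e Y)"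
  by (auto simp: local_sets_def fun_eq_iff elim!: evenE oddE)

text \<open>The invariant of an Ehrenfeucht-Fraisse game on two reductions of the same graph.
  Agreement on the nodes of \<open>G\<close> is stated apart from the copies, since an isolated node
  lies in no copy.\<close>

definition matching :: "nat fstruct \<Rightarrow> gadget \<Rightarrow> gadget \<Rightarrow> nat set \<Rightarrow> nat set \<Rightarrow> gfm set \<Rightarrow>
    (nat \<Rightarrow> nat + nat \<times> nat \<times> nat) \<Rightarrow> (nat \<Rightarrow> (nat + nat \<times> nat \<times> nat) set) \<Rightarrow>
    (nat \<Rightarrow> nat + nat \<times> nat \<times> nat) \<Rightarrow> (nat \<Rightarrow> (nat + nat \<times> nat \<times> nat) set) \<Rightarrow> bool" where
  "matching G g g' X XS \<Phi> v V v' V' \<longleftrightarrow>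
    (\<forall>x\<in>X. v x \<in> univ (gadget_reduction g G) \<and> v' x \<in> univ (gadget_reduction g' G) \<and>
      (\<forall>u\<in>univ G. v x = Inl u \<longleftrightarrow> v' x = Inl u)) \<and>
    (\<forall>Y\<in>XS. \<forall>u\<in>univ G. Inl u \<in> V Y \<longleftrightarrow> Inl u \<in> V' Y) \<and>
    (\<forall>e\<in>oedges G. \<forall>\<theta>\<in>\<Phi>. geval g (local_sets g v V e) \<theta> \<longleftrightarrow> geval g' (local_sets g' v' V' e) \<theta>)"

lemma matching_sym: "matching G g g' X XS \<Phi> v V v' V' \<Longrightarrow> matching G g' g X XS \<Phi> v' V' v V"
  by (auto simp: matching_def)

lemma matching_mono:
  "matching G g g' X XS \<Phi> v V v' V' \<Longrightarrow> X' \<subseteq> X \<Longrightarrow> XS' \<subseteq> XS \<Longrightarrow> \<Phi>' \<subseteq> \<Phi> \<Longrightarrow> matching G g g' X' XS' \<Phi>' v V v' V'"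
  unfolding matching_def by (meson subsetD)

text \<open>One implication is enough because \<open>matching\<close> is symmetric; the case of
  negation uses it with the sides exchanged.\<close>

definition determines :: "gfm set \<Rightarrow> fm \<Rightarrow> bool" where
  "determines \<Phi> \<chi> \<longleftrightarrow> (\<forall>G g g' v V v' V'. G \<in> graphs \<longrightarrow> edge_gadget g \<longrightarrow> edge_gadget g' \<longrightarrow>
     matching G g g' (fv \<chi>) (fv_set \<chi>) \<Phi> v V v' V' \<longrightarrow>
     sat (gadget_reduction g G) v V \<chi> \<longrightarrow> sat (gadget_reduction g' G) v' V' \<chi>)"

lemma determinesI:
  assumes "\<And>G g g' v V v' V'. G \<in> graphs \<Longrightarrow> edge_gadget g \<Longrightarrow> edge_gadget g' \<Longrightarrow>
     matching G g g' (fv \<chi>) (fv_set \<chi>) \<Phi> v V v' V' \<Longrightarrow>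
     sat (gadget_reduction g G) v V \<chi> \<Longrightarrow> sat (gadget_reduction g' G) v' V' \<chi>"
  shows "determines \<Phi> \<chi>"
  using assms unfolding determines_def by blast

lemma determinesD:
  "determines \<Phi> \<chi> \<Longrightarrow> G \<in> graphs \<Longrightarrow> edge_gadget g \<Longrightarrow> edge_gadget g' \<Longrightarrow>
     matching G g g' (fv \<chi>) (fv_set \<chi>) \<Phi> v V v' V' \<Longrightarrow>
     sat (gadget_reduction g G) v V \<chi> \<Longrightarrow> sat (gadget_reduction g' G) v' V' \<chi>"
  unfolding determines_def by blast

text \<open>Every edge of the reduced graph lies inside a single copy, so adjacency is a local
  matter.\<close>

lemma determines_Rel: "determines {GAdj (2 * x) (2 * y)} (Rel 0 [x, y])"
proof (rule determinesI)
  fix G g g' v V v' V'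
  assume g: "edge_gadget g" "edge_gadget g'"
    and m: "matching G g g' (fv (Rel 0 [x, y])) (fv_set (Rel 0 [x, y])) {GAdj (2 * x) (2 * y)} v V v' V'"
  assume "sat (gadget_reduction g G) v V (Rel 0 [x, y])"
  then have "[v x, v y] \<in> rels (gadget_reduction g G) ! 0" by simp
  then obtain e a b where e: "e \<in> oedges G" "(a, b) \<in> set (gedges g)" "v x = copy_node g e a" "v y = copy_node g e b"
    unfolding rels_gadget_reduction by blast
  then have "geval g (local_sets g v V e) (GAdj (2 * x) (2 * y))"
    using gedges_gsize[OF g(1)] by (auto simp: trace_def)
  then have "geval g' (local_sets g' v' V' e) (GAdj (2 * x) (2 * y))"
    using m e(1) by (simp add: matching_def)
  then obtain a' b' where ab: "(a', b') \<in> set (gedges g')" "v' x = copy_node g' e a'" "v' y = copy_node g' e b'"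
    by (auto simp: trace_def)
  then have "[v' x, v' y] \<in> rels (gadget_reduction g' G) ! 0"
    unfolding rels_gadget_reduction ab(2,3) using e(1) ab(1) by blast
  then show "sat (gadget_reduction g' G) v' V' (Rel 0 [x, y])" by simp
qed

lemma univ_gadget_reduction_cases:
  assumes "a \<in> univ (gadget_reduction g G)"
  obtains u where "u \<in> univ G" "a = Inl u"
  | e x where "e \<in> oedges G" "x < gsize g" "a = copy_node g e x"
  using assms by (auto simp: univ_gadget_reduction)

text \<open>If the common value belongs to a copy, a nonempty intersection there witnesses the
  equality; otherwise it is a node of \<open>G\<close>, on which the invariant demands agreement
  directly.\<close>

lemma determines_Eq: "determines {GMeet (2 * x) (2 * y)} (Eq x y)"
proof (rule determinesI)
  fix G g g' v V v' V'
  assume m: "matching G g g' (fv (Eq x y)) (fv_set (Eq x y)) {GMeet (2 * x) (2 * y)} v V v' V'"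
  assume "sat (gadget_reduction g G) v V (Eq x y)"
  then have eq: "v x = v y" by simp
  have "v x \<in> univ (gadget_reduction g G)" using m by (simp add: matching_def)
  then show "sat (gadget_reduction g' G) v' V' (Eq x y)"
  proof (cases rule: univ_gadget_reduction_cases)
    case (1 u)
    then have "v' x = Inl u" "v' y = Inl u" using m eq by (auto simp: matching_def)
    then show ?thesis by simp
  next
    case (2 e a)
    then have "geval g (local_sets g v V e) (GMeet (2 * x) (2 * y))" using eq by (auto simp: trace_def)
    then have "geval g' (local_sets g' v' V' e) (GMeet (2 * x) (2 * y))"
      using m 2(1) by (simp add: matching_def)
    then show ?thesis by (auto simp: trace_def)
  qed
qed

lemma determines_Mem: "determines {GMeet (2 * x) (Suc (2 * X))} (Mem x X)"
proof (rule determinesI)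
  fix G g g' v V v' V'
  assume m: "matching G g g' (fv (Mem x X)) (fv_set (Mem x X)) {GMeet (2 * x) (Suc (2 * X))} v V v' V'"
  assume "sat (gadget_reduction g G) v V (Mem x X)"
  then have mem: "v x \<in> V X" by simp
  have "v x \<in> univ (gadget_reduction g G)" using m by (simp add: matching_def)
  then show "sat (gadget_reduction g' G) v' V' (Mem x X)"
  proof (cases rule: univ_gadget_reduction_cases)
    case (1 u)
    then have "v' x = Inl u" "Inl u \<in> V' X" using m mem by (auto simp: matching_def)
    then show ?thesis by simp
  next
    case (2 e a)
    then have "geval g (local_sets g v V e) (GMeet (2 * x) (Suc (2 * X)))" using mem by (auto simp: trace_def)
    then have "geval g' (local_sets g' v' V' e) (GMeet (2 * x) (Suc (2 * X)))"
      using m 2(1) by (simp add: matching_def)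
    then show ?thesis by (auto simp: trace_def)
  qed
qed

lemma determines_Neg:
  assumes "determines \<Phi> \<chi>" shows "determines \<Phi> (Neg \<chi>)"
proof (rule determinesI)
  fix G g g' v V v' V'
  assume "G \<in> graphs" "edge_gadget g" "edge_gadget g'"
    "matching G g g' (fv (Neg \<chi>)) (fv_set (Neg \<chi>)) \<Phi> v V v' V'" "sat (gadget_reduction g G) v V (Neg \<chi>)"
  then show "sat (gadget_reduction g' G) v' V' (Neg \<chi>)"
    using determinesD[OF assms, of G g' g v' V' v V] matching_sym by auto
qed

lemma determines_And:
  assumes "determines \<Phi> \<chi>" "determines \<Phi>' \<chi>'" shows "determines (\<Phi> \<union> \<Phi>') (And \<chi> \<chi>')"
proof (rule determinesI)
  fix G g g' v V v' V'
  assume a: "G \<in> graphs" "edge_gadget g" "edge_gadget g'"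
    and m: "matching G g g' (fv (And \<chi> \<chi>')) (fv_set (And \<chi> \<chi>')) (\<Phi> \<union> \<Phi>') v V v' V'"
    and s: "sat (gadget_reduction g G) v V (And \<chi> \<chi>')"
  have "matching G g g' (fv \<chi>) (fv_set \<chi>) \<Phi> v V v' V'" "matching G g g' (fv \<chi>') (fv_set \<chi>') \<Phi>' v V v' V'"
    using matching_mono[OF m] by auto
  then show "sat (gadget_reduction g' G) v' V' (And \<chi> \<chi>')"
    using determinesD[OF assms(1) a] determinesD[OF assms(2) a] s by simp
qed

lemma determines_ExSet:
  assumes "determines \<Phi> \<chi>" and fin: "finite \<Phi>"
  shows "determines (back_forth (Suc (2 * X)) (\<Phi> \<union> {GC (Suc (2 * X)), GD (Suc (2 * X))})) (ExSet X \<chi>)"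
proof (rule determinesI)
  let ?i = "Suc (2 * X)"
  let ?\<Phi> = "\<Phi> \<union> {GC ?i, GD ?i}"
  fix G g g' v V v' V'
  assume a: "G \<in> graphs" "edge_gadget g" "edge_gadget g'"
    and m: "matching G g g' (fv (ExSet X \<chi>)) (fv_set (ExSet X \<chi>)) (back_forth ?i ?\<Phi>) v V v' V'"
    and "sat (gadget_reduction g G) v V (ExSet X \<chi>)"
  then obtain Y where Y: "sat (gadget_reduction g G) v (V(X := Y)) \<chi>" by auto
  have "finite ?\<Phi>" "{GC ?i, GD ?i} \<subseteq> ?\<Phi>" using fin by auto
  from answer[OF a this, of "local_sets g v V" "local_sets g' v' V'" Y] m
  obtain Y' where Y': "Y' \<subseteq> univ (gadget_reduction g' G)" "\<forall>u\<in>univ G. Inl u \<in> Y \<longleftrightarrow> Inl u \<in> Y'"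
    and ev: "\<forall>e\<in>oedges G. \<forall>\<theta>\<in>?\<Phi>. geval g ((local_sets g v V e)(?i := trace g e Y)) \<theta> \<longleftrightarrow>
      geval g' ((local_sets g' v' V' e)(?i := trace g' e Y')) \<theta>"
    unfolding matching_def by blast
  have "matching G g g' (fv \<chi>) (fv_set \<chi>) \<Phi> v (V(X := Y)) v' (V'(X := Y'))"
    using m Y'(2) ev unfolding matching_def local_sets_upd by auto
  from determinesD[OF assms(1) a this Y] show "sat (gadget_reduction g' G) v' V' (ExSet X \<chi>)"
    using Y'(1) by auto
qed

lemma determines_Ex:
  assumes "determines \<Phi> \<chi>" and fin: "finite \<Phi>"
  shows "determines (back_forth (2 * x) (\<Phi> \<union> {GC (2 * x), GD (2 * x), GSing (2 * x), GMeet (2 * x) (2 * x)})) (Ex x \<chi>)"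
proof (rule determinesI)
  let ?i = "2 * x"
  let ?\<Phi> = "\<Phi> \<union> {GC ?i, GD ?i, GSing ?i, GMeet ?i ?i}"
  fix G g g' v V v' V'
  assume G: "G \<in> graphs" "edge_gadget g" "edge_gadget g'"
    and m: "matching G g g' (fv (Ex x \<chi>)) (fv_set (Ex x \<chi>)) (back_forth ?i ?\<Phi>) v V v' V'"
    and "sat (gadget_reduction g G) v V (Ex x \<chi>)"
  then obtain a where a: "a \<in> univ (gadget_reduction g G)" "sat (gadget_reduction g G) (v(x := a)) V \<chi>" by auto
  have "finite ?\<Phi>" "{GC ?i, GD ?i, GSing ?i, GMeet ?i ?i} \<subseteq> ?\<Phi>" using fin by auto
  from answer_singleton[OF G this, of "local_sets g v V" "local_sets g' v' V'" a] m a(1)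
  obtain a' where a': "a' \<in> univ (gadget_reduction g' G)" "\<forall>u\<in>univ G. a = Inl u \<longleftrightarrow> a' = Inl u"
    and ev: "\<forall>e\<in>oedges G. \<forall>\<theta>\<in>?\<Phi>. geval g ((local_sets g v V e)(?i := trace g e {a})) \<theta> \<longleftrightarrow>
      geval g' ((local_sets g' v' V' e)(?i := trace g' e {a'})) \<theta>"
    unfolding matching_def by blast
  have "matching G g g' (fv \<chi>) (fv_set \<chi>) \<Phi> (v(x := a)) V (v'(x := a')) V'"
    using m a(1) a' ev unfolding matching_def local_sets_upd by auto
  from determinesD[OF assms(1) G this a(2)] show "sat (gadget_reduction g' G) v' V' (Ex x \<chi>)"
    using a'(1) by auto
qed

lemma ex_determines: "wf_fm [2] \<chi> \<Longrightarrow> \<exists>\<Phi>. finite \<Phi> \<and> determines \<Phi> \<chi>"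
proof (induction \<chi>)
  case Falsity
  show ?case by (intro exI[of _ "{}"]) (auto simp: determines_def)
next
  case (Rel r xs)
  then obtain x y where "r = 0" "xs = [x, y]" by (auto simp: length_Suc_conv numeral_2_eq_2)
  then show ?case using determines_Rel by blast
next
  case (Eq x y)
  then show ?case using determines_Eq by blast
next
  case (Mem x X)
  then show ?case using determines_Mem by blast
next
  case (Neg \<chi>)
  then show ?case using determines_Neg by auto
next
  case (And \<chi> \<chi>')
  then obtain \<Phi> \<Phi>' where "finite \<Phi>" "determines \<Phi> \<chi>" "finite \<Phi>'" "determines \<Phi>' \<chi>'" by auto
  then show ?case using determines_And[of \<Phi> \<chi> \<Phi>' \<chi>'] by (intro exI[of _ "\<Phi> \<union> \<Phi>'"]) auto
next
  case (Ex x \<chi>)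
  then obtain \<Phi> where "finite \<Phi>" "determines \<Phi> \<chi>" by auto
  then show ?case using determines_Ex[of \<Phi> \<chi> x]
    by (intro exI conjI) (auto intro!: finite_back_forth)
next
  case (ExSet X \<chi>)
  then obtain \<Phi> where "finite \<Phi>" "determines \<Phi> \<chi>" by auto
  then show ?case using determines_ExSet[of \<Phi> \<chi> X]
    by (intro exI conjI) (auto intro!: finite_back_forth)
qed

text \<open>Before the first move nothing has been placed on the gadget, so every slot is
  empty.\<close>

definition gadget_type :: "gfm set \<Rightarrow> gadget \<Rightarrow> gfm set" where
  "gadget_type \<Phi> g = {\<theta> \<in> \<Phi>. geval g (\<lambda>_. {}) \<theta>}"

lemma gadget_type_determines:
  assumes \<chi>: "sentence [2] \<chi>" and \<Phi>: "determines \<Phi> \<chi>"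
    and g: "edge_gadget g" "edge_gadget g'" "gadget_type \<Phi> g = gadget_type \<Phi> g'" and G: "G \<in> graphs"
  shows "gadget_reduction g G \<in> models graphs \<chi> \<longleftrightarrow> gadget_reduction g' G \<in> models graphs \<chi>"
proof -
  \<comment> \<open>No oriented edge is \<open>(0, 0)\<close>, so this dummy value leaves no trace
    on any copy.\<close>
  define v :: "nat \<Rightarrow> nat + nat \<times> nat \<times> nat" where "v = (\<lambda>_. Inr (0, 0, 0))"
  have loc: "local_sets h v (\<lambda>_. {}) e = (\<lambda>_. {})" if "e \<in> oedges G" for h e
  proof -
    have "copy_node h e x \<noteq> Inr (0, 0, 0)" for x
      using that copy_node_Inr[of h e x] by (auto simp: oedges_def)
    then show ?thesis by (auto simp: local_sets_def trace_def v_def fun_eq_iff)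
  qed
  have "geval g (\<lambda>_. {}) \<theta> \<longleftrightarrow> geval g' (\<lambda>_. {}) \<theta>" if "\<theta> \<in> \<Phi>" for \<theta>
    using g(3) that unfolding gadget_type_def by blast
  then have m: "matching G g g' (fv \<chi>) (fv_set \<chi>) \<Phi> v (\<lambda>_. {}) v (\<lambda>_. {})"
    using \<chi> loc by (simp add: matching_def sentence_def)
  have sat: "sat A (\<lambda>_. undefined) (\<lambda>_. {}) \<chi> \<longleftrightarrow> sat A v (\<lambda>_. {}) \<chi>" for A
    by (rule sat_cong_fv) (use \<chi> in \<open>auto simp: sentence_def\<close>)
  show ?thesis
    using determinesD[OF \<Phi> G g(1,2) m] determinesD[OF \<Phi> G g(2,1) matching_sym[OF m]]
      gadget_reduction_in_graphs[OF g(1) G] gadget_reduction_in_graphs[OF g(2) G]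
    by (auto simp: models_def sat)
qed

section \<open>Types of gadgets\<close>

text \<open>Node sets are bit masks. The formula is not coded: it comes from the finite set fixed
  together with the target class, so only the gadget code and the masks are data. In the case
  \<open>GAdj\<close>, a nonzero remaining tail certifies that position \<open>k\<close> is within
  the edge list.\<close>

fun cgeval :: "nat \<Rightarrow> (nat \<Rightarrow> nat) \<Rightarrow> gfm \<Rightarrow> bool" where
  "cgeval c m (GC i) = (digit 2 (m i) (cnth c 2) = 1)"
| "cgeval c m (GD i) = (digit 2 (m i) (cnth c 3) = 1)"
| "cgeval c m (GAdj i j) = (\<exists>x<cnth c 0. \<exists>y<cnth c 0.
     (\<exists>k<cnth c 1. (ctl ^^ k) (cnth c 1) \<noteq> 0 \<and> cnth (cnth c 1) k = pair x y) \<and>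
     digit 2 (m i) x = 1 \<and> digit 2 (m j) y = 1)"
| "cgeval c m (GMeet i j) = (\<exists>x<cnth c 0. digit 2 (m i) x = 1 \<and> digit 2 (m j) x = 1)"
| "cgeval c m (GSing i) = (\<exists>x<cnth c 0. digit 2 (m i) x = 1 \<and> (\<forall>y<cnth c 0. digit 2 (m i) y = 1 \<longrightarrow> y = x))"
| "cgeval c m GTrue = True"
| "cgeval c m (GNeg \<theta>) = (\<not> cgeval c m \<theta>)"
| "cgeval c m (GAnd \<theta> \<eta>) = (cgeval c m \<theta> \<and> cgeval c m \<eta>)"
| "cgeval c m (GEx i \<theta>) = (\<exists>w<2 ^ cnth c 0. cgeval c (m(i := w)) \<theta>)"

text \<open>The masks are given slot by slot as computable functions of the input, so for
  \<open>GEx\<close> one of them is replaced by the variable of a bounded search.\<close>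

lemma decidable_cgeval:
  "computable c \<Longrightarrow> (\<And>i. computable (\<lambda>x. m x i)) \<Longrightarrow> decidable (\<lambda>x. cgeval (c x) (m x) \<theta>)"
proof (induction \<theta> arbitrary: c m)
  case (GEx i \<theta>)
  have "decidable (\<lambda>p. cgeval (c (psnd p)) ((m (psnd p))(i := pfst p)) \<theta>)"
  proof (rule GEx.IH)
    show "computable (\<lambda>p. c (psnd p))" by (intro computable_comp[OF GEx.prems(1)] comp_intros)
    fix j
    have "computable (\<lambda>p. m (psnd p) j)" by (intro computable_comp[OF GEx.prems(2)] comp_intros)
    moreover have "computable (\<lambda>p. pfst p)" by (intro comp_intros)
    ultimately show "computable (\<lambda>p. ((m (psnd p))(i := pfst p)) j)" by (cases "j = i") simp_all
  qed
  then show ?case unfolding cgeval.simps by (intro comp_intros GEx.prems)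
next
  case (GC i)
  note c = computable_comp[OF GC.prems(1)] and m = computable_comp[OF GC.prems(2)]
  show ?case unfolding cgeval.simps by (intro comp_intros c m)
next
  case (GD i)
  note c = computable_comp[OF GD.prems(1)] and m = computable_comp[OF GD.prems(2)]
  show ?case unfolding cgeval.simps by (intro comp_intros c m)
next
  case (GAdj i j)
  note c = computable_comp[OF GAdj.prems(1)] and m = computable_comp[OF GAdj.prems(2)]
  show ?case unfolding cgeval.simps by (intro comp_intros c m)
next
  case (GMeet i j)
  note c = computable_comp[OF GMeet.prems(1)] and m = computable_comp[OF GMeet.prems(2)]
  show ?case unfolding cgeval.simps by (intro comp_intros c m)
next
  case (GSing i)
  note c = computable_comp[OF GSing.prems(1)] and m = computable_comp[OF GSing.prems(2)]
  show ?case unfolding cgeval.simps by (intro comp_intros c m)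
qed (simp_all add: decidable_const decidable_not decidable_conj)

text \<open>The code of a list bounds its length, and beyond the end \<open>ctl\<close> stays at
  0.\<close>

lemma ex_code_mem: "(\<exists>k<list_encode xs. (ctl ^^ k) (list_encode xs) \<noteq> 0 \<and> cnth (list_encode xs) k = x) \<longleftrightarrow> x \<in> set xs"
proof
  assume "\<exists>k<list_encode xs. (ctl ^^ k) (list_encode xs) \<noteq> 0 \<and> cnth (list_encode xs) k = x"
  then obtain k where k: "(ctl ^^ k) (list_encode xs) \<noteq> 0" "cnth (list_encode xs) k = x" by blast
  have "k < length xs"
  proof (rule ccontr)
    assume "\<not> k < length xs"
    then obtain j where j: "k = j + length xs" by (metis add.commute le_iff_add not_less)
    have "(ctl ^^ j) 0 = 0"
    proof (induction j)
      case (Suc j)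
      have "psnd 0 = 0" using le_pair2[of "psnd 0" "pfst 0"] by (simp add: pair_surj)
      then show ?case using Suc by (simp add: ctl_def)
    qed simp
    then show False using k(1) by (simp add: j funpow_add ctl_drop)
  qed
  then show "x \<in> set xs" using k(2) by (auto simp: cnth_list_encode)
next
  assume "x \<in> set xs"
  then obtain k where k: "k < length xs" "xs ! k = x" by (auto simp: in_set_conv_nth)
  moreover have "(ctl ^^ k) (list_encode xs) \<noteq> 0"
    using k by (simp add: ctl_drop Cons_nth_drop_Suc[symmetric])
  moreover have "k < list_encode xs" using k(1) length_le_list_encode[of xs] by linarith
  ultimately show "\<exists>k<list_encode xs. (ctl ^^ k) (list_encode xs) \<noteq> 0 \<and> cnth (list_encode xs) k = x"
    by (auto simp: cnth_list_encode)
qed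

definition mask_set :: "nat \<Rightarrow> nat \<Rightarrow> nat set" where
  "mask_set n w = {x. x < n \<and> digit 2 w x = 1}"

lemma ex_mask_set:
  assumes "Y \<subseteq> {..<n}" shows "\<exists>w<2 ^ n. mask_set n w = Y"
proof -
  have "of_bool (i \<in> Y) < (2 :: nat)" for i by simp
  from ex_digits[of n "\<lambda>i. of_bool (i \<in> Y)" 2, OF this]
  obtain w where "w < 2 ^ n" "\<forall>i<n. digit 2 w i = of_bool (i \<in> Y)" by blast
  then show ?thesis using assms by (intro exI[of _ w]) (auto simp: mask_set_def simp del: One_nat_def)
qed

lemma cnth_gadget_code [simp]:
  "cnth (gadget_code g) 0 = gsize g" "cnth (gadget_code g) (Suc 0) = list_encode (map prod_encode (gedges g))"
  "cnth (gadget_code g) 2 = gc g" "cnth (gadget_code g) 3 = gd g"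
  by (simp_all add: gadget_code_def)

lemma cgeval_gadget_code:
  assumes g: "edge_gadget g"
  shows "cgeval (gadget_code g) m \<theta> \<longleftrightarrow> geval g (\<lambda>i. mask_set (gsize g) (m i)) \<theta>"
proof (induction \<theta> arbitrary: m)
  case (GAdj i j)
  have "pair x y \<in> set (map prod_encode (gedges g)) \<longleftrightarrow> (x, y) \<in> set (gedges g)" for x y
    by (auto simp: pair_def image_iff)
  then show ?case
    unfolding cgeval.simps cnth_gadget_code One_nat_def ex_code_mem
    using gedges_gsize[OF g] by (fastforce simp: mask_set_def)
next
  case (GEx i \<theta>)
  have upd: "(\<lambda>j. mask_set (gsize g) ((m(i := w)) j)) = (\<lambda>j. mask_set (gsize g) (m j))(i := mask_set (gsize g) w)" for w
    by (rule ext) simp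
  have "(\<exists>w<2 ^ gsize g. geval g ((\<lambda>j. mask_set (gsize g) (m j))(i := mask_set (gsize g) w)) \<theta>) \<longleftrightarrow>
      (\<exists>Y\<subseteq>{..<gsize g}. geval g ((\<lambda>j. mask_set (gsize g) (m j))(i := Y)) \<theta>)"
    (is "?L = ?R")
  proof
    assume ?R
    then show ?L using ex_mask_set by metis
  next
    assume ?L
    moreover have "mask_set (gsize g) w \<subseteq> {..<gsize g}" for w by (auto simp: mask_set_def)
    ultimately show ?R by blast
  qed
  then show ?case by (simp add: GEx.IH upd del: fun_upd_apply)
qed (use g in \<open>auto simp: mask_set_def edge_gadget_def\<close>)

lemma geval_empty_iff: "edge_gadget g \<Longrightarrow> geval g (\<lambda>_. {}) \<theta> \<longleftrightarrow> cgeval (gadget_code g) (\<lambda>_. 0) \<theta>"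
  by (simp add: cgeval_gadget_code mask_set_def digit_def)

text \<open>Each \<open>T\<close> may have its own algorithm, with no uniformity in
  \<open>T\<close>; the predicates \<open>D\<close> select which of the finitely many is run. The
  induction splits on one formula at a time.\<close>

lemma decidable_finite_cases:
  assumes "finite \<Phi>" "\<And>\<theta>. \<theta> \<in> \<Phi> \<Longrightarrow> decidable (D \<theta>)" "\<And>T. T \<subseteq> \<Phi> \<Longrightarrow> decidable (Q T)"
  shows "decidable (\<lambda>x. Q {\<theta> \<in> \<Phi>. D \<theta> x} x)"
  using assms
proof (induction \<Phi> arbitrary: Q)
  case (insert \<eta> \<Phi>)
  have "decidable (Q (insert \<eta> T))" "decidable (Q T)" if "T \<subseteq> \<Phi>" for T
    by (rule insert.prems(2), use that in blast)+
  then have "decidable (\<lambda>x. Q (insert \<eta> {\<theta> \<in> \<Phi>. D \<theta> x}) x)" "decidable (\<lambda>x. Q {\<theta> \<in> \<Phi>. D \<theta> x} x)"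
    using insert.IH[of "\<lambda>T. Q (insert \<eta> T)"] insert.IH[of Q] insert.prems(1) by blast+
  then have dec: "decidable (\<lambda>x. if D \<eta> x then Q (insert \<eta> {\<theta> \<in> \<Phi>. D \<theta> x}) x else Q {\<theta> \<in> \<Phi>. D \<theta> x} x)"
    using insert.prems(1) by (intro comp_intros) auto
  have "(if D \<eta> x then Q (insert \<eta> {\<theta> \<in> \<Phi>. D \<theta> x}) x else Q {\<theta> \<in> \<Phi>. D \<theta> x} x) = Q {\<theta> \<in> insert \<eta> \<Phi>. D \<theta> x} x" for x
  proof -
    have "{\<theta> \<in> insert \<eta> \<Phi>. D \<theta> x} = (if D \<eta> x then insert \<eta> {\<theta> \<in> \<Phi>. D \<theta> x} else {\<theta> \<in> \<Phi>. D \<theta> x})"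
      by auto
    then show ?thesis by presburger
  qed
  with dec show ?case by (simp only:)
qed simp

section \<open>Comparing two sentences on small graphs\<close>

definition cgraph :: "nat \<Rightarrow> nat \<Rightarrow> bool" where
  "cgraph n s \<longleftrightarrow> (\<forall>u<n. \<forall>v<n. bit_rel s 0 (Suc (pair u (Suc (pair v 0)))) \<longrightarrow>
     \<not> u = v \<and> bit_rel s 0 (Suc (pair v (Suc (pair u 0)))))"

lemma cgraph_iff: "cgraph n s \<longleftrightarrow> bit_struct [2] n s \<in> graphs"
  using bit_struct_in_structs[of "[2]" n s] by (auto simp: cgraph_def graphs_def rels_bit_struct)

lemma decidable_cgraph:
  assumes "computable n" "computable s" shows "decidable (\<lambda>x. cgraph (n x) (s x))"
  unfolding cgraph_def bit_rel_def
  by (intro comp_intros computable_comp[OF assms(1)] computable_comp[OF assms(2)])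

lemma graphs_structs: "graphs \<subseteq> structs [2]"
  by (auto simp: graphs_def)

lemma induced_graphs_closed:
  assumes "B \<in> graphs" "inj_on h {..<n}"
  shows "induced h n B \<in> graphs"
proof -
  have "length (rels B) = 1" using assms(1) by (auto simp: graphs_def structs_def dest: list_all2_lengthD)
  then show ?thesis using assms induced_in_structs[of B "[2]" h n]
    by (auto simp: graphs_def induced_def)
qed

lemma graph_agreement:
  assumes \<phi>: "exfo_sentence [2] \<phi>" and \<psi>: "exfo_sentence [2] \<psi>"
  shows "(\<forall>G\<in>graphs. dsat \<phi> G \<longleftrightarrow> dsat \<psi> G) \<longleftrightarrow>
    (\<forall>n<Suc (fm_code \<phi> + fm_code \<psi>). \<forall>s<2 ^ bit_bound (list_encode [2]) (fm_code \<phi> + fm_code \<psi>).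
       cgraph n s \<longrightarrow> (csat n s (fm_code \<phi>) \<longleftrightarrow> csat n s (fm_code \<psi>)))"
  unfolding csat_iff_dsat[OF \<phi>] csat_iff_dsat[OF \<psi>] cgraph_iff
  by (rule small_witness_eq[OF small_witness_mono[OF small_witness_dsat[OF \<phi>]]
      small_witness_mono[OF small_witness_dsat[OF \<psi>]] graphs_structs induced_graphs_closed]) auto

theorem gadget_reduction_decidable:
  assumes \<chi>: "sentence [2] \<chi>"
  shows "decidable_on
    (\<lambda>(\<phi>, g). list_encode [fm_code \<phi>, gadget_code g])
    {(\<phi>, g). exfo_sentence [2] \<phi> \<and> edge_gadget g}
    (\<lambda>(\<phi>, g). is_reduction graphs (gadget_reduction g) (models graphs \<phi>) (models graphs \<chi>))"
proof -
  obtain \<Phi> where fin: "finite \<Phi>" and \<Phi>: "determines \<Phi> \<chi>"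
    using ex_determines[of \<chi>] \<chi> unfolding sentence_def by blast
  \<comment> \<open>The gadget is quantified: a sentence suits a type if it gives a reduction with
    some gadget of that type, possibly not the one in the input.\<close>
  define good where "good T \<phi> \<longleftrightarrow> exfo_sentence [2] \<phi> \<and> (\<exists>g. edge_gadget g \<and> gadget_type \<Phi> g = T \<and>
    is_reduction graphs (gadget_reduction g) (models graphs \<phi>) (models graphs \<chi>))" for T \<phi>
  \<comment> \<open>For fixed \<open>T\<close>, \<open>Eps (good T)\<close> is a constant, so
    \<open>Q T\<close> is decidable although the choice is not effective.\<close>
  define Q where "Q T x \<longleftrightarrow> (\<exists>\<phi>. good T \<phi>) \<and> (\<forall>n<Suc (fm_code (Eps (good T)) + cnth x 0).
    \<forall>s<2 ^ bit_bound (list_encode [2]) (fm_code (Eps (good T)) + cnth x 0).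
      cgraph n s \<longrightarrow> (csat n s (fm_code (Eps (good T))) \<longleftrightarrow> csat n s (cnth x 0)))" for T x
  show ?thesis
  proof (rule decidable_onI)
    show "decidable (\<lambda>x. Q {\<theta> \<in> \<Phi>. cgeval (cnth x 1) (\<lambda>_. 0) \<theta>} x)"
    proof (rule decidable_finite_cases[OF fin])
      show "decidable (\<lambda>x. cgeval (cnth x 1) (\<lambda>_. 0) \<theta>)" for \<theta>
        by (intro decidable_cgeval comp_intros)
      show "decidable (Q T)" for T
        unfolding Q_def by (intro comp_intros decidable_csat decidable_cgraph)
    qed
    fix i assume "i \<in> {(\<phi>, g). exfo_sentence [2] \<phi> \<and> edge_gadget g}"
    then obtain \<phi> g where i: "i = (\<phi>, g)" and \<phi>: "exfo_sentence [2] \<phi>" and g: "edge_gadget g" by auto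
    let ?x = "list_encode [fm_code \<phi>, gadget_code g]" and ?T = "gadget_type \<Phi> g"
    have "Q ?T ?x \<longleftrightarrow> is_reduction graphs (gadget_reduction g) (models graphs \<phi>) (models graphs \<chi>)"
    proof (cases "\<exists>\<phi>. good ?T \<phi>")
      case True
      define \<psi> where "\<psi> = Eps (good ?T)"
      have "good ?T \<psi>" unfolding \<psi>_def using True by (rule someI_ex)
      then obtain g' where \<psi>: "exfo_sentence [2] \<psi>" and g': "edge_gadget g'" "gadget_type \<Phi> g' = ?T"
        and red: "is_reduction graphs (gadget_reduction g') (models graphs \<psi>) (models graphs \<chi>)"
        unfolding good_def by blast
      \<comment> \<open>Gadgets of equal type produce graphs that agree on \<open>\<chi>\<close>, so
        the target class has the same pullback along both, namely the models of
        \<open>\<psi>\<close>.\<close>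
      have "dsat \<psi> G \<longleftrightarrow> gadget_reduction g G \<in> models graphs \<chi>" if "G \<in> graphs" for G
        using red that gadget_type_determines[OF \<chi> \<Phi> g' (1) g g'(2) that] models_dsat[OF \<psi> that]
        by (simp add: is_reduction_def)
      then have "is_reduction graphs (gadget_reduction g) (models graphs \<phi>) (models graphs \<chi>) \<longleftrightarrow>
          (\<forall>G\<in>graphs. dsat \<psi> G \<longleftrightarrow> dsat \<phi> G)"
        unfolding is_reduction_def by (auto simp: models_dsat[OF \<phi>])
      also have "\<dots> \<longleftrightarrow> Q ?T ?x"
        unfolding graph_agreement[OF \<psi> \<phi>] Q_def \<psi>_def[symmetric] using True by simp
      finally show ?thesis by simp
    next
      case False
      then have "\<not> is_reduction graphs (gadget_reduction g) (models graphs \<phi>) (models graphs \<chi>)"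
        using \<phi> g unfolding good_def by blast
      then show ?thesis using False by (simp add: Q_def)
    qed
    moreover have "{\<theta> \<in> \<Phi>. cgeval (gadget_code g) (\<lambda>_. 0) \<theta>} = ?T"
      by (simp add: gadget_type_def geval_empty_iff[OF g])
    ultimately show "Q {\<theta> \<in> \<Phi>. cgeval (cnth ((\<lambda>(\<phi>, g). list_encode [fm_code \<phi>, gadget_code g]) i) 1) (\<lambda>_. 0) \<theta>}
        ((\<lambda>(\<phi>, g). list_encode [fm_code \<phi>, gadget_code g]) i) \<longleftrightarrow>
      (\<lambda>(\<phi>, g). is_reduction graphs (gadget_reduction g) (models graphs \<phi>) (models graphs \<chi>)) i"
      by (simp add: i)
  qed
qed

theorem theorem11:
  shows
    "decidable_on
       (\<lambda>(\<sigma>, \<tau>, \<phi>, \<psi>, \<Psi>). list_encode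
          [list_encode \<sigma>, list_encode \<tau>, fm_code \<phi>, fm_code \<psi>, interp_code \<Psi>])
       {(\<sigma>, \<tau>, \<phi>, \<psi>, \<Psi>). exfo_sentence \<sigma> \<phi> \<and> exfo_sentence \<tau> \<psi> \<and> qf_interp \<sigma> \<tau> \<Psi>}
       (\<lambda>(\<sigma>, \<tau>, \<phi>, \<psi>, \<Psi>). is_reduction (structs \<sigma>) (interpret_struct \<tau> \<Psi>)
          (models (structs \<sigma>) \<phi>) (models (structs \<tau>) \<psi>))
   \<and> (\<forall>\<sigma> P. P \<subseteq> structs \<sigma> \<and> iso_closed P \<longrightarrow>
       decidable_on
         (\<lambda>(\<tau>, \<psi>, \<Psi>). list_encode [list_encode \<tau>, fm_code \<psi>, interp_code \<Psi>])
         {(\<tau>, \<psi>, \<Psi>). exfo_sentence \<tau> \<psi> \<and> qf_interp \<sigma> \<tau> \<Psi>}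
         (\<lambda>(\<tau>, \<psi>, \<Psi>). is_reduction (structs \<sigma>) (interpret_struct \<tau> \<Psi>)
            P (models (structs \<tau>) \<psi>)))
   \<and> (\<forall>\<chi>. sentence [2] \<chi> \<longrightarrow>
       decidable_on
         (\<lambda>(\<phi>, g). list_encode [fm_code \<phi>, gadget_code g])
         {(\<phi>, g). exfo_sentence [2] \<phi> \<and> edge_gadget g}
         (\<lambda>(\<phi>, g). is_reduction graphs (gadget_reduction g)
            (models graphs \<phi>) (models graphs \<chi>)))"
  using interpretation_reduction_decidable interpretation_reduction_from_class_decidable
    gadget_reduction_decidable by blast

end
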